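(* Let $n\ge1$ and suppose that $P_n=\{X_1,\ldots,X_n\}\subset\mathbb{S}^1$ is a random point set on the circle, i.e., $X_1,\ldots,X_n$ are independent, uniformly distributed $\mathbb{S}^1$-valued random variables. Then $$\mathbb{E}[\ell(\beta_1(P_n))]=1-\left(\sum_{k\ge1}(-1)^{k-1}\binom{n}{k}\int_0^{\min\left(\frac12,\frac1k\right)}\pi\cos(\pi t)(1-kt)^{n-1}\,dt\right).$$
   Context: $\mathbb{S}^1=\{x\in\mathbb{R}^2: x_1^2+x_2^2=1\}$ is the unit circle in the Euclidean plane. For a finite nonempty set $P\subset\mathbb{S}^1$ and $t\ge0$, let $P_t=\{x\in\mathbb{R}^2: d(x,P)\le t\}$ be the closed Euclidean $t$-neighborhood in $\mathbb{R}^2$. The persistence module $\mathrm{PH}_1(P)$ is $t\mapsto H_1(P_t,\mathbf{k})$, $t\ge0$, with coefficients in a fixed field $\mathbf{k}$ and maps induced by inclusions. It decomposes as a direct sum of finitely many interval modules (an interval module is $\mathbf{k}$ on an interval and $0$ outside, with identity maps inside); $\beta_1(P)$ is the multiset of these intervals (its barcode). It consists of at most one interval, and $\ell(\beta_1(P))\in[0,1]$ denotes the length of this interval ($0$ if there is none). *)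

theory Defs
  imports
    "HOL-Probability.Probability"
    "HOL-Homology.Homology"
begin

section \<open>Singular homology with coefficients in a field\<close>

text \<open>
  HOL-Homology only treats integer coefficients. We keep its singular simplices and their faces
  and take chains to be finitely supported functions from simplices to the coefficients.
  For integer coefficients this agrees with the library (\<open>coeff_boundary_int\<close>).
\<close>

type_synonym ('a, 'k) coeff_chain = "((nat \<Rightarrow> real) \<Rightarrow> 'a) \<Rightarrow>\<^sub>0 'k"

definition coeff_chains :: "nat \<Rightarrow> 'a topology \<Rightarrow> ('a, 'k::comm_ring_1) coeff_chain set" where
  "coeff_chains p X = {c. Poly_Mapping.keys c \<subseteq> singular_simplex_set p X}"

definition coeff_boundary ::
    "nat \<Rightarrow> ('a, 'k::comm_ring_1) coeff_chain \<Rightarrow> ('a, 'k) coeff_chain" where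
  "coeff_boundary p c =
     (if p = 0 then 0
      else \<Sum>\<sigma>\<in>Poly_Mapping.keys c. \<Sum>k\<le>p.
             Poly_Mapping.single (singular_face p k \<sigma>) ((-1) ^ k * Poly_Mapping.lookup c \<sigma>))"

lemma coeff_chains_int: "coeff_chains p X = singular_chain_set p X"
  by (auto simp: coeff_chains_def singular_chain_def)

lemma coeff_boundary_int:
  fixes c :: "'a chain"
  shows "coeff_boundary p c = chain_boundary p c"
proof (cases "p = 0")
  case False
  have *: "frag_cmul a (\<Sum>k\<le>p. frag_cmul ((-1) ^ k) (frag_of (singular_face p k f))) =
        (\<Sum>k\<le>p. Poly_Mapping.single (singular_face p k f) ((-1) ^ k * a))"
    for a and f :: "(nat \<Rightarrow> real) \<Rightarrow> 'a"
    unfolding frag_cmul_sum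
    by (rule sum.cong[OF refl], rule poly_mapping_eqI) (simp add: lookup_frag_cmul lookup_single when_def)
  show ?thesis
    using False by (simp add: coeff_boundary_def chain_boundary_def frag_extend_def *)
qed (simp add: coeff_boundary_def chain_boundary_def)

definition coeff_cycles :: "nat \<Rightarrow> 'a topology \<Rightarrow> ('a, 'k::comm_ring_1) coeff_chain set" where
  "coeff_cycles p X = {c \<in> coeff_chains p X. coeff_boundary p c = 0}"

definition coeff_boundaries :: "nat \<Rightarrow> 'a topology \<Rightarrow> ('a, 'k::comm_ring_1) coeff_chain set" where
  "coeff_boundaries p X = coeff_boundary (Suc p) ` coeff_chains (Suc p) X"

definition homologous ::
    "nat \<Rightarrow> 'a topology \<Rightarrow> (('a, 'k::comm_ring_1) coeff_chain \<times> ('a, 'k) coeff_chain) set" where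
  "homologous p X =
     {(a, b). a \<in> coeff_cycles p X \<and> b \<in> coeff_cycles p X \<and> a - b \<in> coeff_boundaries p X}"

lemma coeff_boundary_lookup:
  assumes "finite S" "Poly_Mapping.keys c \<subseteq> S" "p \<noteq> 0"
  shows "coeff_boundary p c =
     (\<Sum>\<sigma>\<in>S. \<Sum>k\<le>p. Poly_Mapping.single (singular_face p k \<sigma>) ((-1) ^ k * Poly_Mapping.lookup c \<sigma>))"
  unfolding coeff_boundary_def using assms
  by (auto intro!: sum.mono_neutral_left simp: in_keys_iff)

lemma coeff_boundary_add: "coeff_boundary p (a + b) = coeff_boundary p a + coeff_boundary p b"
proof (cases "p = 0")
  case False
  let ?S = "Poly_Mapping.keys a \<union> Poly_Mapping.keys b"
  have "Poly_Mapping.keys (a + b) \<subseteq> ?S" by (rule keys_add)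
  then show ?thesis
    using False
    by (simp add: coeff_boundary_lookup[of ?S] lookup_add distrib_left single_add sum.distrib)
qed (simp add: coeff_boundary_def)

lemma lookup_scale: "Poly_Mapping.lookup (Poly_Mapping.map ((*) (r::'k::comm_ring_1)) c) x = r * Poly_Mapping.lookup c x"
  by (simp add: Poly_Mapping.map.rep_eq when_def)

lemma coeff_boundary_scale:
  "coeff_boundary p (Poly_Mapping.map ((*) r) c) = Poly_Mapping.map ((*) r) (coeff_boundary p c)"
proof (cases "p = 0")
  case False
  have "Poly_Mapping.keys (Poly_Mapping.map ((*) r) c) \<subseteq> Poly_Mapping.keys c"
    by (auto simp: in_keys_iff lookup_scale)
  then show ?thesis
    using False
    by (intro poly_mapping_eqI)
       (simp add: coeff_boundary_lookup[of "Poly_Mapping.keys c"] lookup_scale lookup_sum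
          lookup_single sum_distrib_left when_def if_distrib mult_ac cong: if_cong)
qed (auto simp: coeff_boundary_def intro!: poly_mapping_eqI simp: lookup_scale)

lemma coeff_boundary_diff: "coeff_boundary p (a - b) = coeff_boundary p a - coeff_boundary p b"
  using coeff_boundary_add[of p "a - b" b] by (simp add: algebra_simps)

lemma coeff_chains_closed:
  "0 \<in> coeff_chains p X"
  "a \<in> coeff_chains p X \<Longrightarrow> b \<in> coeff_chains p X \<Longrightarrow> a + b \<in> coeff_chains p X"
  "a \<in> coeff_chains p X \<Longrightarrow> Poly_Mapping.map ((*) r) a \<in> coeff_chains p X"
proof -
  show "0 \<in> coeff_chains p X" by (simp add: coeff_chains_def)
  show "a + b \<in> coeff_chains p X" if "a \<in> coeff_chains p X" "b \<in> coeff_chains p X"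
    using that keys_add[of a b] by (auto simp: coeff_chains_def)
  show "Poly_Mapping.map ((*) r) a \<in> coeff_chains p X" if "a \<in> coeff_chains p X"
  proof -
    have "Poly_Mapping.keys (Poly_Mapping.map ((*) r) a) \<subseteq> Poly_Mapping.keys a"
      by (auto simp: in_keys_iff lookup_scale)
    with that show ?thesis by (auto simp: coeff_chains_def)
  qed
qed

lemma coeff_cycles_closed:
  "0 \<in> coeff_cycles p X"
  "a \<in> coeff_cycles p X \<Longrightarrow> b \<in> coeff_cycles p X \<Longrightarrow> a + b \<in> coeff_cycles p X"
  "a \<in> coeff_cycles p X \<Longrightarrow> Poly_Mapping.map ((*) r) a \<in> coeff_cycles p X"
  by (auto simp: coeff_cycles_def coeff_chains_closed coeff_boundary_add coeff_boundary_scale)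
     (auto simp: coeff_boundary_def intro!: poly_mapping_eqI simp: lookup_scale)

lemma coeff_boundaries_closed:
  "0 \<in> coeff_boundaries p X"
  "a \<in> coeff_boundaries p X \<Longrightarrow> b \<in> coeff_boundaries p X \<Longrightarrow> a + b \<in> coeff_boundaries p X"
  "a \<in> coeff_boundaries p X \<Longrightarrow> Poly_Mapping.map ((*) r) a \<in> coeff_boundaries p X"
proof -
  have "coeff_boundary (Suc p) 0 = 0" by (simp add: coeff_boundary_def)
  then show "0 \<in> coeff_boundaries p X"
    unfolding coeff_boundaries_def by (metis coeff_chains_closed(1) image_eqI)
qed (auto simp: coeff_boundaries_def coeff_boundary_add[symmetric] coeff_boundary_scale[symmetric]
      intro!: imageI coeff_chains_closed)

lemma scale_minus_one: "Poly_Mapping.map ((*) (-1 :: 'k::comm_ring_1)) c = - c"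
  by (auto intro!: poly_mapping_eqI simp: lookup_scale)

lemma scale_simps:
  fixes r s :: "'k::comm_ring_1"
  shows "Poly_Mapping.map ((*) (r + s)) c = Poly_Mapping.map ((*) r) c + Poly_Mapping.map ((*) s) c"
    and "Poly_Mapping.map ((*) r) (c + d) = Poly_Mapping.map ((*) r) c + Poly_Mapping.map ((*) r) d"
    and "Poly_Mapping.map ((*) (r * s)) c = Poly_Mapping.map ((*) r) (Poly_Mapping.map ((*) s) c)"
    and "Poly_Mapping.map ((*) 1) c = c"
  by (auto intro!: poly_mapping_eqI simp: lookup_scale lookup_add algebra_simps)

lemma equiv_homologous: "equiv (coeff_cycles p X) (homologous p X)"
proof (rule equivI)
  show "sym (homologous p X)"
  proof (rule symI)
    fix a b assume "(a, b) \<in> homologous p X"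
    then show "(b, a) \<in> homologous p X"
      using coeff_boundaries_closed(3)[of "a - b" p X "-1"]
      by (auto simp: homologous_def scale_minus_one)
  qed
  show "trans (homologous p X)"
  proof (rule transI)
    fix a b c assume "(a, b) \<in> homologous p X" "(b, c) \<in> homologous p X"
    then show "(a, c) \<in> homologous p X"
      using coeff_boundaries_closed(2)[of "a - b" p X "b - c"] by (auto simp: homologous_def)
  qed
qed (auto simp: homologous_def refl_on_def coeff_boundaries_closed)

lemma homologous_class_eq:
  assumes "a \<in> coeff_cycles p X" "b \<in> coeff_cycles p X"
  shows "homologous p X `` {a} = homologous p X `` {b} \<longleftrightarrow> a - b \<in> coeff_boundaries p X"
  using eq_equiv_class_iff[OF equiv_homologous assms] assms by (simp add: homologous_def)

text \<open>
  The homology space is the quotient of cycles by boundaries, with homology classes represented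
  as sets of cycles. The record fields \<open>mult\<close> and \<open>one\<close>, inherited by modules from rings,
  carry no meaning.
\<close>

definition homology_space ::
    "nat \<Rightarrow> 'a topology \<Rightarrow> ('k::field, ('a, 'k) coeff_chain set) module" where
  "homology_space p X =
     \<lparr>carrier = coeff_cycles p X // homologous p X,
      mult = undefined,
      one = undefined,
      zero = homologous p X `` {0},
      add = (\<lambda>A B. \<Union>a\<in>A. \<Union>b\<in>B. homologous p X `` {a + b}),
      smult = (\<lambda>r A. \<Union>a\<in>A. homologous p X `` {Poly_Mapping.map ((*) r) a})\<rparr>"

text \<open>
  The map induced in homology by an inclusion into \<open>Y\<close> sends the class of a cycle \<open>c\<close> to the
  class of \<open>c\<close> in \<open>Y\<close>.
\<close>

definition homology_inclusion ::
    "nat \<Rightarrow> 'a topology \<Rightarrow> ('a, 'k::field) coeff_chain set \<Rightarrow> ('a, 'k) coeff_chain set" where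
  "homology_inclusion p Y A = homologous p Y `` A"


lemma homology_space_cases:
  assumes "A \<in> carrier (homology_space p X)"
  obtains a where "a \<in> coeff_cycles p X" "A = homologous p X `` {a}"
  using assms by (auto simp: homology_space_def elim!: quotientE)

lemma homology_space_ops:
  fixes a :: "('a, 'k::field) coeff_chain"
  assumes a: "a \<in> coeff_cycles p X"
  shows "homologous p X `` {a} \<in> carrier (homology_space p X)"
    and "b \<in> coeff_cycles p X \<Longrightarrow> homologous p X `` {a} \<oplus>\<^bsub>homology_space p X\<^esub> homologous p X `` {b} = homologous p X `` {a + b}"
    and "r \<odot>\<^bsub>homology_space p X\<^esub> homologous p X `` {a} = homologous p X `` {Poly_Mapping.map ((*) r) a}"
proof -
  show "homologous p X `` {a} \<in> carrier (homology_space p X)"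
    using a by (simp add: homology_space_def quotientI)
  have "congruent2 (homologous p X) (homologous p X)
      (\<lambda>a b :: ('a, 'k) coeff_chain. homologous p X `` {a + b})"
  proof (rule congruent2I')
    fix a b c d :: "('a, 'k) coeff_chain"
    assume *: "(a, b) \<in> homologous p X" "(c, d) \<in> homologous p X"
    then have "(a - b) + (c - d) \<in> coeff_boundaries p X"
      by (intro coeff_boundaries_closed) (auto simp: homologous_def)
    then show "homologous p X `` {a + c} = homologous p X `` {b + d}"
      using * by (subst homologous_class_eq)
        (auto simp: homologous_def coeff_cycles_closed algebra_simps)
  qed
  from UN_equiv_class2[OF equiv_homologous equiv_homologous this a]
  show "homologous p X `` {a} \<oplus>\<^bsub>homology_space p X\<^esub> homologous p X `` {b} = homologous p X `` {a + b}"
    if "b \<in> coeff_cycles p X"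
    using that by (simp add: homology_space_def)
  have "congruent (homologous p X) (\<lambda>a :: ('a, 'k) coeff_chain. homologous p X `` {Poly_Mapping.map ((*) r) a})"
  proof (rule congruentI)
    fix a b :: "('a, 'k) coeff_chain"
    assume *: "(a, b) \<in> homologous p X"
    have eq: "Poly_Mapping.map ((*) r) (a - b) = Poly_Mapping.map ((*) r) a - Poly_Mapping.map ((*) r) b"
      by (auto intro!: poly_mapping_eqI simp: lookup_scale lookup_minus right_diff_distrib)
    have "Poly_Mapping.map ((*) r) (a - b) \<in> coeff_boundaries p X"
      using * by (intro coeff_boundaries_closed) (auto simp: homologous_def)
    then show "homologous p X `` {Poly_Mapping.map ((*) r) a} = homologous p X `` {Poly_Mapping.map ((*) r) b}"
      using * by (subst homologous_class_eq) (auto simp: homologous_def coeff_cycles_closed eq)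
  qed
  from UN_equiv_class[OF equiv_homologous this a]
  show "r \<odot>\<^bsub>homology_space p X\<^esub> homologous p X `` {a} = homologous p X `` {Poly_Mapping.map ((*) r) a}"
    by (simp add: homology_space_def)
qed

definition scalar_ring :: "'k::field ring" where
  "scalar_ring = \<lparr>carrier = UNIV, mult = (*), one = 1, zero = 0, add = (+)\<rparr>"

lemma cring_scalar_ring: "cring scalar_ring"
proof (rule cringI)
  show "abelian_group (scalar_ring :: 'k::field ring)"
    by (rule abelian_groupI) (auto simp: scalar_ring_def algebra_simps intro: exI[of _ "- _"] left_minus)
  show "Group.comm_monoid (scalar_ring :: 'k::field ring)"
    by (rule comm_monoidI) (auto simp: scalar_ring_def)
qed (auto simp: scalar_ring_def algebra_simps)

lemma module_homology_space: "module scalar_ring (homology_space p X)"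
proof (rule moduleI)
  have zero: "\<zero>\<^bsub>homology_space p X\<^esub> = homologous p X `` {0}"
    by (simp add: homology_space_def)
  have neg: "- a \<in> coeff_cycles p X" if "a \<in> coeff_cycles p X"
    for a :: "('b, 'c::field) coeff_chain"
    using coeff_cycles_closed(3)[OF that, of "-1"] by (simp add: scale_minus_one)
  show "abelian_group (homology_space p X)"
  proof (rule abelian_groupI)
    fix A assume "A \<in> carrier (homology_space p X)"
    then obtain a where a: "a \<in> coeff_cycles p X" "A = homologous p X `` {a}"
      by (rule homology_space_cases)
    show "\<exists>B\<in>carrier (homology_space p X). B \<oplus>\<^bsub>homology_space p X\<^esub> A = \<zero>\<^bsub>homology_space p X\<^esub>"
      by (rule bexI[of _ "homologous p X `` {- a}"])
         (simp_all only: a homology_space_ops neg zero add.left_inverse left_minus)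
  qed (auto elim!: homology_space_cases simp: homology_space_ops coeff_cycles_closed zero add_ac)
qed (use cring_scalar_ring in \<open>auto elim!: homology_space_cases
      simp: homology_space_ops coeff_cycles_closed scale_simps scalar_ring_def\<close>)


section \<open>Persistence modules and barcodes\<close>

text \<open>
  Persistence modules are indexed by the reals \<open>t \<ge> 0\<close>; the values of the two fields at negative
  parameters, and of \<open>trans_map s t\<close> for \<open>t < s\<close>, are irrelevant.
\<close>

record ('k, 'v) pers_mod =
  space_at :: "real \<Rightarrow> ('k, 'v) module"
  trans_map :: "real \<Rightarrow> real \<Rightarrow> 'v \<Rightarrow> 'v"

definition linear_between :: "('k, 'v) module \<Rightarrow> ('k, 'w) module \<Rightarrow> ('v \<Rightarrow> 'w) \<Rightarrow> bool" where
  "linear_between V W f \<longleftrightarrow>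
     f \<in> carrier V \<rightarrow> carrier W \<and>
     (\<forall>x\<in>carrier V. \<forall>y\<in>carrier V. f (x \<oplus>\<^bsub>V\<^esub> y) = f x \<oplus>\<^bsub>W\<^esub> f y) \<and>
     (\<forall>r. \<forall>x\<in>carrier V. f (r \<odot>\<^bsub>V\<^esub> x) = r \<odot>\<^bsub>W\<^esub> f x)"

definition is_pers_mod :: "('k::field, 'v) pers_mod \<Rightarrow> bool" where
  "is_pers_mod M \<longleftrightarrow>
     (\<forall>t\<ge>0. module scalar_ring (space_at M t)) \<and>
     (\<forall>s\<ge>0. \<forall>t\<ge>s. linear_between (space_at M s) (space_at M t) (trans_map M s t)) \<and>
     (\<forall>t\<ge>0. \<forall>x\<in>carrier (space_at M t). trans_map M t t x = x) \<and>
     (\<forall>r\<ge>0. \<forall>s\<ge>r. \<forall>t\<ge>s. \<forall>x\<in>carrier (space_at M r).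
        trans_map M s t (trans_map M r s x) = trans_map M r t x)"

definition pers_iso :: "('k, 'v) pers_mod \<Rightarrow> ('k, 'w) pers_mod \<Rightarrow> bool" where
  "pers_iso M N \<longleftrightarrow>
     (\<exists>\<theta>. (\<forall>t\<ge>0. linear_between (space_at M t) (space_at N t) (\<theta> t) \<and>
                 bij_betw (\<theta> t) (carrier (space_at M t)) (carrier (space_at N t))) \<and>
          (\<forall>s\<ge>0. \<forall>t\<ge>s. \<forall>x\<in>carrier (space_at M s).
             \<theta> t (trans_map M s t x) = trans_map N s t (\<theta> s x)))"

definition interval_mod :: "real set \<Rightarrow> ('k::field, 'k) pers_mod" where
  "interval_mod I =
     \<lparr>space_at = (\<lambda>t. \<lparr>carrier = (if t \<in> I then UNIV else {0}), mult = undefined, one = undefined,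
                       zero = 0, add = (+), smult = (*)\<rparr>),
      trans_map = (\<lambda>s t x. if s \<in> I \<and> t \<in> I then x else 0)\<rparr>"

lemma is_pers_mod_interval_mod:
  assumes "is_interval I"
  shows "is_pers_mod (interval_mod I)"
proof -
  have mod: "module scalar_ring (space_at (interval_mod I :: ('a::field, 'a) pers_mod) t)" for t
  proof (rule moduleI)
    show "abelian_group (space_at (interval_mod I :: ('a, 'a) pers_mod) t)"
    proof (rule abelian_groupI)
      fix x assume "x \<in> carrier (space_at (interval_mod I :: ('a, 'a) pers_mod) t)"
      then show "\<exists>y\<in>carrier (space_at (interval_mod I) t).
          y \<oplus>\<^bsub>space_at (interval_mod I) t\<^esub> x = \<zero>\<^bsub>space_at (interval_mod I) t\<^esub>"
        by (intro bexI[of _ "- x"]) (auto simp: interval_mod_def)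
    qed (auto simp: interval_mod_def)
  qed (rule cring_scalar_ring, auto simp: interval_mod_def scalar_ring_def algebra_simps)
  have between: "s \<in> I" if "r \<in> I" "t \<in> I" "r \<le> s" "s \<le> t" for r s t
    using mem_is_interval_1_I[OF assms] that by blast
  have "linear_between (space_at (interval_mod I :: ('a::field, 'a) pers_mod) s)
      (space_at (interval_mod I) t) (trans_map (interval_mod I) s t)" for s t
    by (auto simp: linear_between_def interval_mod_def)
  moreover have "trans_map (interval_mod I) s t (trans_map (interval_mod I) r s x) =
      trans_map (interval_mod I) r t (x :: 'a::field)" if "r \<le> s" "s \<le> t" for r s t x
    using between[of r t s] that by (simp add: interval_mod_def)
  moreover have "trans_map (interval_mod I) t t x = (x :: 'a::field)"
    if "x \<in> carrier (space_at (interval_mod I) t)" for t x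
    using that by (simp add: interval_mod_def split: if_splits)
  ultimately show ?thesis
    using mod by (simp add: is_pers_mod_def)
qed

text \<open>The elements of a finite direct sum are lists of elements of the summands.\<close>

definition pers_sum :: "('k, 'v) pers_mod list \<Rightarrow> ('k, 'v list) pers_mod" where
  "pers_sum Ms =
     \<lparr>space_at = (\<lambda>t.
        \<lparr>carrier = {xs. length xs = length Ms \<and>
                        (\<forall>i<length Ms. xs ! i \<in> carrier (space_at (Ms ! i) t))},
         mult = undefined,
         one = undefined,
         zero = map (\<lambda>M. \<zero>\<^bsub>space_at M t\<^esub>) Ms,
         add = (\<lambda>xs ys. map (\<lambda>i. xs ! i \<oplus>\<^bsub>space_at (Ms ! i) t\<^esub> ys ! i) [0..<length Ms]),
         smult = (\<lambda>r xs. map (\<lambda>i. r \<odot>\<^bsub>space_at (Ms ! i) t\<^esub> xs ! i) [0..<length Ms])\<rparr>),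
      trans_map = (\<lambda>s t xs. map (\<lambda>i. trans_map (Ms ! i) s t (xs ! i)) [0..<length Ms])\<rparr>"

definition has_barcode :: "('k::field, 'v) pers_mod \<Rightarrow> real set multiset \<Rightarrow> bool" where
  "has_barcode M B \<longleftrightarrow>
     (\<forall>I\<in>#B. is_interval I \<and> I \<noteq> {} \<and> I \<subseteq> {0..}) \<and>
     (\<exists>Is. mset Is = B \<and> pers_iso M (pers_sum (map interval_mod Is)))"

definition barcode :: "('k::field, 'v) pers_mod \<Rightarrow> real set multiset" where
  "barcode M = (THE B. has_barcode M B)"


section \<open>Persistent homology of neighbourhoods\<close>

definition closed_nbhd :: "'a::metric_space set \<Rightarrow> real \<Rightarrow> 'a set" where
  "closed_nbhd P t = {x. infdist x P \<le> t}"

definition PH ::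
    "nat \<Rightarrow> 'a::metric_space set \<Rightarrow> ('k::field, ('a, 'k) coeff_chain set) pers_mod" where
  "PH p P =
     \<lparr>space_at = (\<lambda>t. homology_space p (top_of_set (closed_nbhd P t))),
      trans_map = (\<lambda>s t. homology_inclusion p (top_of_set (closed_nbhd P t)))\<rparr>"

lemma coeff_chains_mono: "S \<subseteq> T \<Longrightarrow> coeff_chains p (top_of_set S) \<subseteq> coeff_chains p (top_of_set T)"
  by (auto simp: coeff_chains_def singular_simplex_def continuous_map_in_subtopology subset_eq)

lemma homology_inclusion_class:
  fixes c :: "('a::topological_space, 'k::field) coeff_chain"
  assumes "S \<subseteq> T" "c \<in> coeff_cycles p (top_of_set S)"
  shows "c \<in> coeff_cycles p (top_of_set T)"
    and "homology_inclusion p (top_of_set T) (homologous p (top_of_set S) `` {c}) =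
         homologous p (top_of_set T) `` {c}"
proof -
  note mono = coeff_chains_mono[OF assms(1)]
  have sub: "homologous p (top_of_set S) \<subseteq>
      (homologous p (top_of_set T) :: (('a, 'k) coeff_chain \<times> _) set)"
    using mono[of p] mono[of "Suc p"]
    by (auto simp: homologous_def coeff_cycles_def coeff_boundaries_def)
  show "c \<in> coeff_cycles p (top_of_set T)"
    using assms(2) mono by (auto simp: coeff_cycles_def)
  have "(c, c) \<in> homologous p (top_of_set S)"
    using assms(2) equiv_homologous[of p "top_of_set S"] by (auto simp: equiv_def refl_on_def)
  then show "homology_inclusion p (top_of_set T) (homologous p (top_of_set S) `` {c}) =
         homologous p (top_of_set T) `` {c}"
    using sub equiv_homologous[of p "top_of_set T"]
    unfolding homology_inclusion_def equiv_def by (blast dest: transD)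
qed

lemma is_pers_mod_PH: "is_pers_mod (PH p P)"
proof -
  have sub: "closed_nbhd P s \<subseteq> closed_nbhd P t" if "s \<le> t" for s t
    using that by (auto simp: closed_nbhd_def)
  note incl = homology_inclusion_class[OF sub]
  show ?thesis
    unfolding is_pers_mod_def
    by (auto simp: PH_def module_homology_space linear_between_def homology_space_ops
        coeff_cycles_closed incl elim!: homology_space_cases)
qed

text \<open>The type argument is the coefficient field.\<close>

definition beta1 :: "'k::field itself \<Rightarrow> (real^2) set \<Rightarrow> real set multiset" where
  "beta1 _ P = barcode (PH 1 P :: ('k, (real^2, 'k) coeff_chain set) pers_mod)"

text \<open>
  The length of a barcode with at most one bar. Barcodes with several bars, which do not occur as
  first barcodes of subsets of the circle, are given the default value \<open>0\<close>.
\<close>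

definition bar_length :: "real set multiset \<Rightarrow> real" where
  "bar_length B = (if \<exists>I. B = {#I#} then measure lborel (THE I. B = {#I#}) else 0)"


section \<open>The uniform distribution on the circle\<close>

definition circle :: "(real^2) set" where
  "circle = {x. (x $ 1)\<^sup>2 + (x $ 2)\<^sup>2 = 1}"

definition circle_borel :: "(real^2) measure" where
  "circle_borel = restrict_space borel circle"

text \<open>The normalised arc length measure.\<close>

definition circle_uniform :: "(real^2) measure" where
  "circle_uniform =
     distr (uniform_measure lborel {0..<2 * pi}) circle_borel (\<lambda>\<phi>. vector [cos \<phi>, sin \<phi>])"

lemma prob_space_circle_uniform: "prob_space circle_uniform"
proof -
  have "(\<lambda>\<phi>::real. \<chi> i::2. if i = 1 then cos \<phi> else sin \<phi>) \<in> borel \<rightarrow>\<^sub>M borel"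
    by (intro borel_measurable_continuous_onI continuous_on_vec_lambda)
       (rename_tac i, case_tac "i = 1", simp_all add: continuous_on_cos continuous_on_sin)
  also have "(\<lambda>\<phi>::real. \<chi> i::2. if i = 1 then cos \<phi> else sin \<phi>) = (\<lambda>\<phi>. vector [cos \<phi>, sin \<phi>])"
    by (auto simp: vec_eq_iff forall_2)
  finally have "(\<lambda>\<phi>::real. vector [cos \<phi>, sin \<phi>] :: real^2) \<in> borel \<rightarrow>\<^sub>M circle_borel"
    by (auto simp: circle_borel_def circle_def intro!: measurable_restrict_space2)
  then show ?thesis
    unfolding circle_uniform_def
    by (intro prob_space.prob_space_distr prob_space_uniform_measure) auto
qed

end

theory Submission
  imports Defs
begin

text \<open>
  Let \<open>0 \<le> t < 1\<close> and \<open>c = sqrt (1 - t\<^sup>2)\<close>. The ray from the origin in direction \<open>u\<close> meets the ball of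
  radius \<open>t\<close> about a point \<open>p\<close> of the circle iff \<open>u \<bullet> p \<ge> c\<close>, and then in an interval that contains
  \<open>c u\<close> (\<open>ray_iff\<close>, \<open>slice_nbhd\<close>). Hence the neighbourhood \<open>P\<^sub>t\<close> can be pushed along rays onto
  a subset of the circle of radius \<open>c\<close>, the union of the arcs of half-angle \<open>arcsin t\<close> around the
  points of \<open>P\<close>. If these arcs cover the circle, \<open>P\<^sub>t\<close> is an annulus up to homotopy, and the winding
  number about the origin identifies its first homology with the field; since that number does not
  depend on \<open>t\<close>, the inclusions become identities. If the arcs leave out a direction, all components
  of \<open>P\<^sub>t\<close> are contractible, and for \<open>t \<ge> 1\<close> the set \<open>P\<^sub>t\<close> is star-shaped about the origin; in both
  cases the first homology vanishes. So the barcode is the set of all \<open>t < 1\<close> at which the arcs cover,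
  provided that it is nonempty, and the length of the bar is the measure of this set
  (\<open>bar_length_beta1\<close>).

  Homology is taken over a field, whereas homotopy invariance is at hand for integral chains. In
  degree one the passage is direct. A cycle over the field is a combination of single simplices, and
  each simplex, closed up by chains to base points, is an integral cycle, to which the integral theory
  applies; the closing chains cancel in the combination (\<open>one_cycle_reduction\<close>). For the annulus this is
  done in the universal covering given by the exponential map (\<open>annulus_cycle\<close>). Injectivity of the
  winding number on homology comes from there, and that it is well defined from lifting triangles
  (\<open>winding_cocycle\<close>). That a module with one bar has no other barcode is \<open>single_bar_unique\<close>.

  The expected length is thus the integral over \<open>t\<close> of the probability that the arcs cover. Write
  \<open>t = sin (\<pi> g)\<close> with \<open>0 < g \<le> 1/2\<close>. Arcs of half-angle \<open>\<pi> g\<close> cover iff no gap between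
  neighbouring points exceeds the fraction \<open>g\<close> of the circle (\<open>covers_iff_spaced\<close>). One of the points
  may be used to cut the circle open, which leaves \<open>n - 1\<close> uniform points in an interval of length
  one. The probability that all \<open>n\<close> gaps are at most \<open>g\<close> follows by induction on the number of
  points: the first point has to lie within \<open>g\<close> of the left end, and the rest is the same problem in
  a shorter interval
  (\<open>spaced_probability\<close>). The recursion is solved by the alternating sum of truncated powers
  \<open>(1 - k g)\<^sub>+\<^sup>n\<^sup>-\<^sup>1\<close>, whose integrals against \<open>\<pi> cos (\<pi> g)\<close> are the terms of the formula.
\<close>

section \<open>Chains and cycles in degree one\<close>

abbreviation scale :: "'k \<Rightarrow> ('a, 'k::comm_ring_1) coeff_chain \<Rightarrow> ('a, 'k) coeff_chain" where
  "scale r \<equiv> Poly_Mapping.map ((*) r)"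

lemma scale_0_left: "scale 0 c = 0" and scale_0_right: "scale r 0 = 0"
  and scale_diff: "scale r (c - d) = scale r c - scale r d"
  by (rule poly_mapping_eqI, simp only: lookup_scale lookup_minus lookup_uminus lookup_zero
      mult_zero_left mult_zero_right mult_minus_right left_diff_distrib right_diff_distrib)+

lemma scale_single: "scale r (Poly_Mapping.single x a) = Poly_Mapping.single x (r * a)"
  by (auto intro!: poly_mapping_eqI simp: lookup_scale lookup_single when_def)

lemma scale_sum_left: "scale (sum f A) c = (\<Sum>x\<in>A. scale (f x) c)"
  by (rule poly_mapping_eqI) (simp add: lookup_scale lookup_sum sum_distrib_right)

lemma coeff_boundaries_sum:
  "(\<And>x. x \<in> A \<Longrightarrow> f x \<in> coeff_boundaries p X) \<Longrightarrow> sum f A \<in> coeff_boundaries p X"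
  by (induction A rule: infinite_finite_induct) (simp_all add: coeff_boundaries_closed)

lemma coeff_boundaries_diff:
  "a \<in> coeff_boundaries p X \<Longrightarrow> b \<in> coeff_boundaries p X \<Longrightarrow> a - b \<in> coeff_boundaries p X"
  using coeff_boundaries_closed(2)[of a p X "- b"] coeff_boundaries_closed(3)[of b p X "-1"]
  by (simp add: scale_minus_one)

lemma chain_eq_sum_single:
  "c = (\<Sum>x\<in>Poly_Mapping.keys c. Poly_Mapping.single x (Poly_Mapping.lookup c x))"
  by (rule poly_mapping_eqI) (auto simp: lookup_sum lookup_single when_def in_keys_iff)

text \<open>
  The counterpart of \<open>frag_extend\<close> for coefficients in a ring.
\<close>

definition chain_extend ::
    "('b \<Rightarrow> ('a, 'k::comm_ring_1) coeff_chain) \<Rightarrow> ('b \<Rightarrow>\<^sub>0 'k) \<Rightarrow> ('a, 'k) coeff_chain" where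
  "chain_extend g c = (\<Sum>x\<in>Poly_Mapping.keys c. scale (Poly_Mapping.lookup c x) (g x))"

lemma chain_extend_superset:
  assumes "finite S" "Poly_Mapping.keys c \<subseteq> S"
  shows "chain_extend g c = (\<Sum>x\<in>S. scale (Poly_Mapping.lookup c x) (g x))"
  unfolding chain_extend_def using assms
  by (intro sum.mono_neutral_left) (auto simp: in_keys_iff scale_0_left)

lemma chain_extend_add: "chain_extend g (c + d) = chain_extend g c + chain_extend g d"
proof -
  let ?S = "Poly_Mapping.keys c \<union> Poly_Mapping.keys d"
  have "Poly_Mapping.keys (c + d) \<subseteq> ?S" by (rule keys_add)
  then show ?thesis
    by (simp add: chain_extend_superset[of ?S] lookup_add scale_simps sum.distrib)
qed

lemma chain_extend_0: "chain_extend g 0 = 0"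
  by (simp add: chain_extend_def)

lemma chain_extend_sum: "chain_extend g (sum f A) = (\<Sum>x\<in>A. chain_extend g (f x))"
  by (induction A rule: infinite_finite_induct) (simp_all add: chain_extend_0 chain_extend_add)

lemma chain_extend_single: "chain_extend g (Poly_Mapping.single x a) = scale a (g x)"
  by (simp add: chain_extend_superset[of "{x}"])

lemma coeff_boundary_1:
  "coeff_boundary 1 c = (\<Sum>\<sigma>\<in>Poly_Mapping.keys c.
      Poly_Mapping.single (singular_face 1 0 \<sigma>) (Poly_Mapping.lookup c \<sigma>)
    - Poly_Mapping.single (singular_face 1 1 \<sigma>) (Poly_Mapping.lookup c \<sigma>))"
  by (simp add: coeff_boundary_def single_uminus)

text \<open>
  The chain-level core of both homology computations. On a cycle the values of \<open>\<delta>\<close> at the end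
  points of the simplices cancel. So if every single simplex agrees, up to boundaries, with the
  difference of the values of \<open>\<delta>\<close> at its end points plus a multiple of \<open>l\<close>, then every cycle is
  homologous to a multiple of \<open>l\<close>.
\<close>

lemma one_cycle_reduction:
  fixes \<delta> :: "((nat \<Rightarrow> real) \<Rightarrow> 'a) \<Rightarrow> ('a, 'k::comm_ring_1) coeff_chain" and l :: "('a, 'k) coeff_chain"
    and w :: "((nat \<Rightarrow> real) \<Rightarrow> 'a) \<Rightarrow> 'k"
  assumes \<delta>: "\<And>\<sigma>. singular_simplex 1 X \<sigma> \<Longrightarrow>
      Poly_Mapping.single \<sigma> 1 - \<delta> (singular_face 1 0 \<sigma>) + \<delta> (singular_face 1 1 \<sigma>) - scale (w \<sigma>) l
        \<in> coeff_boundaries 1 X"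
    and c: "c \<in> coeff_cycles 1 X"
  shows "c - scale (\<Sum>\<sigma>\<in>Poly_Mapping.keys c. Poly_Mapping.lookup c \<sigma> * w \<sigma>) l
           \<in> coeff_boundaries 1 X"
proof -
  let ?K = "Poly_Mapping.keys c" and ?c = "Poly_Mapping.lookup c"
  let ?f = "\<lambda>\<sigma>. Poly_Mapping.single \<sigma> 1 - \<delta> (singular_face 1 0 \<sigma>) + \<delta> (singular_face 1 1 \<sigma>)
              - scale (w \<sigma>) l"
  have *: "(\<Sum>\<sigma>\<in>?K. scale (?c \<sigma>) (?f \<sigma>)) \<in> coeff_boundaries 1 X"
    using c by (intro coeff_boundaries_sum coeff_boundaries_closed(3) \<delta>)
      (auto simp: coeff_cycles_def coeff_chains_def)
  have neg: "chain_extend \<delta> (- d) = - chain_extend \<delta> d" for d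
    using chain_extend_add[of \<delta> d "- d"] by (simp add: chain_extend_0 add_eq_0_iff)
  have "0 = chain_extend \<delta> (coeff_boundary 1 c)"
    using c by (simp add: coeff_cycles_def chain_extend_0)
  also have "\<dots> = (\<Sum>\<sigma>\<in>?K. scale (?c \<sigma>) (\<delta> (singular_face 1 0 \<sigma>)) - scale (?c \<sigma>) (\<delta> (singular_face 1 1 \<sigma>)))"
    unfolding coeff_boundary_1 chain_extend_sum
    by (intro sum.cong refl)
      (simp only: chain_extend_add neg chain_extend_single diff_conv_add_uminus)
  finally have 0: "(\<Sum>\<sigma>\<in>?K. scale (?c \<sigma>) (\<delta> (singular_face 1 0 \<sigma>)) - scale (?c \<sigma>) (\<delta> (singular_face 1 1 \<sigma>))) = 0"
    by simp
  have "(\<Sum>\<sigma>\<in>?K. scale (?c \<sigma>) (?f \<sigma>)) =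
      (\<Sum>\<sigma>\<in>?K. Poly_Mapping.single \<sigma> (?c \<sigma>)) -
      (\<Sum>\<sigma>\<in>?K. scale (?c \<sigma>) (\<delta> (singular_face 1 0 \<sigma>)) - scale (?c \<sigma>) (\<delta> (singular_face 1 1 \<sigma>))) -
      (\<Sum>\<sigma>\<in>?K. scale (?c \<sigma> * w \<sigma>) l)"
    unfolding sum_subtractf[symmetric]
    by (intro sum.cong refl) (simp add: scale_diff scale_simps scale_single)
  also have "\<dots> = c - scale (\<Sum>\<sigma>\<in>?K. ?c \<sigma> * w \<sigma>) l"
    by (simp only: 0 scale_sum_left chain_eq_sum_single[symmetric]) simp
  finally show ?thesis using * by simp
qed

text \<open>
  Change of coefficients along the homomorphism from the integers. It turns relations between
  integral chains, which homotopy invariance of integral homology supplies, into relations over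
  the field.
\<close>

definition int_chain :: "'a chain \<Rightarrow> ('a, 'k::comm_ring_1) coeff_chain" where
  "int_chain = Poly_Mapping.map of_int"

lemma lookup_int_chain: "Poly_Mapping.lookup (int_chain c) x = of_int (Poly_Mapping.lookup c x)"
  by (simp add: int_chain_def Poly_Mapping.map.rep_eq when_def)

lemma int_chain_simps:
  "int_chain 0 = 0" "int_chain (c + d) = int_chain c + int_chain d"
  "int_chain (c - d) = int_chain c - int_chain d" "int_chain (- c) = - int_chain c"
  "int_chain (frag_cmul a c) = scale (of_int a) (int_chain c)"
  "int_chain (Poly_Mapping.single x a) = Poly_Mapping.single x (of_int a)"
  "int_chain (frag_of x) = Poly_Mapping.single x 1"
  by (auto intro!: poly_mapping_eqI
      simp: lookup_int_chain lookup_add lookup_minus lookup_scale lookup_single when_def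
        lookup_frag_of)

lemma int_chain_sum: "int_chain (sum f A) = (\<Sum>x\<in>A. int_chain (f x))"
  by (induction A rule: infinite_finite_induct) (simp_all add: int_chain_simps)

lemma coeff_boundary_int_chain:
  "coeff_boundary p (int_chain c :: ('a, 'k::comm_ring_1) coeff_chain) = int_chain (chain_boundary p c)"
proof (cases "p = 0")
  case True
  then show ?thesis by (simp add: coeff_boundary_def chain_boundary_def int_chain_simps)
next
  case False
  have "Poly_Mapping.keys (int_chain c :: ('a, 'k) coeff_chain) \<subseteq> Poly_Mapping.keys c"
    by (auto simp: in_keys_iff lookup_int_chain)
  with False show ?thesis
    unfolding coeff_boundary_int[symmetric]
    by (simp add: coeff_boundary_lookup[of "Poly_Mapping.keys c"] lookup_int_chain int_chain_sum
        int_chain_simps)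
qed

lemma int_chain_in_chains: "singular_chain p X c \<Longrightarrow> int_chain c \<in> coeff_chains p X"
  unfolding coeff_chains_def singular_chain_def subset_iff in_keys_iff mem_Collect_eq lookup_int_chain
  by (metis of_int_0)

lemma int_chain_boundary:
  "singular_relboundary p X {} c \<Longrightarrow> int_chain c \<in> coeff_boundaries p X"
  unfolding singular_boundary coeff_boundaries_def
  using int_chain_in_chains coeff_boundary_int_chain[symmetric] by blast

lemma int_chain_cycle:
  "singular_relcycle p X {} c \<Longrightarrow> int_chain c \<in> coeff_cycles p X"
  unfolding singular_cycle coeff_cycles_def
  by (simp add: coeff_boundary_int_chain int_chain_in_chains int_chain_simps)

text \<open>
  By homotopy invariance a cycle is homologous to its image under a constant map, and in a
  one-point space every cycle of positive degree bounds.
\<close>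

lemma contractible_cycle_bounds:
  assumes S: "contractible S" and c: "singular_relcycle p (top_of_set S) {} c" and p: "1 \<le> p"
  shows "singular_relboundary p (top_of_set S) {} c"
proof -
  obtain a where a: "homotopic_with_canon (\<lambda>x. True) S S id (\<lambda>x. a)"
    using S by (auto simp: contractible_def)
  have hom: "homotopic_with (\<lambda>h. h \<in> {} \<rightarrow> {}) (top_of_set S) (top_of_set S) id (\<lambda>x. a)"
    by (rule homotopic_with_mono[OF a]) auto
  have ch: "singular_chain p (top_of_set S) c" using c by (simp add: singular_cycle)
  have id: "chain_map p id c = c"
    using chain_map_id_gen[OF ch, of id] by simp
  show ?thesis
  proof (cases "c = 0")
    case False
    then have "S \<noteq> {}"
      using ch by (metis singular_chain_empty topspace_euclidean_subtopology)
    then have aS: "a \<in> S"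
      using homotopic_with_imp_subset2[OF a] by auto
    have cm: "continuous_map (top_of_set S) (top_of_set {a}) (\<lambda>x. a)" by simp
    have "singular_relcycle p (top_of_set {a}) {} (chain_map p (\<lambda>x. a) c)"
      by (rule singular_relcycle_chain_map[OF c cm]) auto
    then have "singular_relboundary p (top_of_set {a}) {} (chain_map p (\<lambda>x. a) c)"
      using singular_boundary_eq_cycle_singleton[of "top_of_set {a}" a p] p by simp
    then have 1: "singular_relboundary p (top_of_set S) {} (chain_map p (\<lambda>x. a) c)"
      by (rule singular_boundary_mono[rotated]) (use aS in simp)
    have "singular_relboundary p (top_of_set S) {} (c - chain_map p (\<lambda>x. a) c)"
      using homotopic_imp_homologous_rel_chain_maps[OF hom c] by (simp add: id homologous_rel_def)
    from singular_relboundary_add[OF this 1] show ?thesis by simp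
  qed simp
qed

definition point_simplex :: "'a \<Rightarrow> (nat \<Rightarrow> real) \<Rightarrow> 'a" where
  "point_simplex y = (\<lambda>x\<in>standard_simplex 0. y)"

lemma singular_simplex_point: "y \<in> topspace X \<Longrightarrow> singular_simplex 0 X (point_simplex y)"
  by (auto simp: singular_simplex_def point_simplex_def)

text \<open>
  Connectedness is only used through such chains, so that paths never have to be concatenated.
\<close>

lemma path_connected_joining_chain:
  assumes "path_connected S" "x \<in> S" "y \<in> S"
  obtains d where "singular_chain 1 (top_of_set S) d"
    "chain_boundary 1 d = frag_of (point_simplex x) - frag_of (point_simplex y)"
proof -
  have "path_connected_space (top_of_set S)"
    using assms(1) by (simp add: path_connectedin_topspace[symmetric])
  from iso_integer_zeroth_homology_group_aux[OF this singular_simplex_point[of x] singular_simplex_point[of y]]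
  show ?thesis using assms that by (auto simp: homologous_rel_def singular_boundary)
qed

lemma chain_boundary_1_of:
  "chain_boundary 1 (frag_of \<sigma>) = frag_of (singular_face 1 0 \<sigma>) - frag_of (singular_face 1 1 \<sigma>)"
  by (simp add: chain_boundary_of)

section \<open>Logarithms of simplices and winding numbers\<close>

lemma singular_simplex_top_of_set:
  "singular_simplex p (top_of_set S) \<sigma> \<longleftrightarrow>
     continuous_on (standard_simplex p) \<sigma> \<and> \<sigma> ` standard_simplex p \<subseteq> S \<and>
     \<sigma> \<in> extensional (standard_simplex p)"
  by (auto simp: singular_simplex_def continuous_map_in_subtopology euclidean_product_topology
      continuous_map_iff_continuous image_subset_iff)

text \<open>
  Padding with zeros makes this a point of all standard simplices of dimension at least \<open>k\<close>.
\<close>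

definition vertex :: "nat \<Rightarrow> nat \<Rightarrow> real" where
  "vertex k = (\<lambda>j. if j = k then 1 else 0)"

lemma vertex_in: "vertex k \<in> standard_simplex p \<longleftrightarrow> k \<le> p"
  by (simp add: vertex_def)

lemma simplical_face_vertex: "simplical_face k (vertex j)
    = (if j < k then vertex j else vertex (Suc j))"
  by (auto simp: simplical_face_def vertex_def fun_eq_iff)

lemma point_simplex_vertex: "point_simplex y (vertex 0) = y"
  by (simp add: point_simplex_def vertex_in)

lemma singular_face_vertex:
  "k \<le> Suc p \<Longrightarrow> j \<le> p \<Longrightarrow> singular_face (Suc p) k \<sigma> (vertex j)
      = \<sigma> (if j < k then vertex j else vertex (Suc j))"
  by (simp add: singular_face_def simplical_face_vertex vertex_in)

lemma singular_face_1:
  "singular_face 1 0 \<sigma> = point_simplex (\<sigma> (vertex 1))" "singular_face 1 1 \<sigma>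
      = point_simplex (\<sigma> (vertex 0))"
proof -
  have eq: "standard_simplex 0 = {vertex 0}" by (simp add: standard_simplex_0 vertex_def)
  have *: "f = point_simplex (f (vertex 0))" if "f \<in> extensional {vertex 0}"
      for f :: "(nat \<Rightarrow> real) \<Rightarrow> 'b"
  proof
    fix x show "f x = point_simplex (f (vertex 0)) x"
      using that by (cases "x = vertex 0") (simp_all add: point_simplex_def eq extensional_def)
  qed
  have "singular_face 1 k \<sigma> \<in> extensional {vertex 0}" for k
    by (simp add: singular_face_def eq)
  note f = *[OF this]
  show "singular_face 1 0 \<sigma> = point_simplex (\<sigma> (vertex 1))"
    by (subst f) (use singular_face_vertex[of 0 0 0 \<sigma>] in simp)
  show "singular_face 1 1 \<sigma> = point_simplex (\<sigma> (vertex 0))"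
    by (subst f) (use singular_face_vertex[of 1 0 0 \<sigma>] in simp)
qed

definition to_complex :: "real^2 \<Rightarrow> complex" where
  "to_complex x = Complex (x $ 1) (x $ 2)"

text \<open>
  The exponential map, as the universal covering of the punctured plane.
\<close>

definition wrap :: "complex \<Rightarrow> real^2" where
  "wrap z = vector [Re (exp z), Im (exp z)]"

lemma to_complex_wrap [simp]: "to_complex (wrap z) = exp z"
  by (simp add: to_complex_def wrap_def complex_eq_iff)

lemma to_complex_inj: "to_complex x = to_complex y \<longleftrightarrow> x = y"
  by (auto simp: to_complex_def vec_eq_iff forall_2)

lemma to_complex_0 [simp]: "to_complex 0 = 0"
  by (simp add: to_complex_def complex_eq_iff)

lemma wrap_Ln: "x \<noteq> 0 \<Longrightarrow> wrap (Ln (to_complex x)) = x"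
  by (metis exp_Ln to_complex_0 to_complex_inj to_complex_wrap)

lemma continuous_on_to_complex [continuous_intros]:
  "continuous_on S f \<Longrightarrow> continuous_on S (\<lambda>x. to_complex (f x))"
  unfolding to_complex_def Complex_eq by (intro continuous_intros)

lemma continuous_on_wrap [continuous_intros]:
  assumes "continuous_on S f" shows "continuous_on S (\<lambda>x. wrap (f x))"
proof -
  have *: "wrap z = (\<chi> i. if i = 1 then Re (exp z) else Im (exp z))" for z
    by (simp add: wrap_def vec_eq_iff forall_2)
  show ?thesis unfolding *
    by (rule continuous_on_vec_lambda, case_tac "i = 1") (auto intro!: continuous_intros assms)
qed

lemma wrap_eq_iff: "wrap z = wrap y \<longleftrightarrow> exp z = exp y"
  by (metis to_complex_inj to_complex_wrap)

abbreviation turns :: "int \<Rightarrow> complex" where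
  "turns k \<equiv> of_int k * (2 * of_real pi * \<i>)"

lemma exp_turns [simp]: "exp (z + turns k) = exp z"
  by (simp add: exp_add exp_eq_1 mult_ac)

lemma wrap_turns [simp]: "wrap (z + turns k) = wrap z"
  by (simp add: wrap_eq_iff)

lemma exp_eq_turns: "exp z = exp y \<longleftrightarrow> (\<exists>k. z = y + turns k)"
  by (auto simp: exp_eq mult_ac)

text \<open>
  A simplex of dimension at most two is parametrised by a convex subset of the plane, and there a
  nowhere vanishing continuous function has a continuous logarithm.
\<close>

lemma simplex_lift:
  assumes \<sigma>: "singular_simplex p (top_of_set S) \<sigma>" and p: "p \<le> 2" and S: "0 \<notin> S"
  obtains \<tau> where "singular_simplex p (top_of_set (wrap -` S)) \<tau>" "simplex_map p wrap \<tau> = \<sigma>"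
proof -
  \<comment> \<open>The coordinates \<open>x 1\<close> and \<open>x 2\<close> determine a point of the simplex, since the coordinates sum to one.\<close>
  define j :: "real \<times> real \<Rightarrow> nat \<Rightarrow> real" where
    "j = (\<lambda>u i. if i = 0 then 1 - fst u - snd u else if i = 1 then fst u else if i
        = 2 then snd u else 0)"
  define r :: "(nat \<Rightarrow> real) \<Rightarrow> real \<times> real" where "r = (\<lambda>x. (x 1, x 2))"
  define K where "K = {u. j u \<in> standard_simplex p}"
  have jr: "j (r x) = x" if "x \<in> standard_simplex p" for x
  proof
    fix i
    have "x \<in> standard_simplex 2" using that standard_simplex_mono[OF p] by auto
    then have "x 0 + x 1 + x 2 = 1" "\<forall>i>2. x i = 0"
      by (auto simp: standard_simplex_def numeral_2_eq_2)
    then show "j (r x) i = x i" by (auto simp: j_def r_def)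
  qed
  have jlin: "j (u *\<^sub>R x + v *\<^sub>R y) = (\<lambda>i. (1 - v) * j x i + v * j y i)" if "u + v = 1" for u v x y
  proof -
    have u: "u = 1 - v" using that by simp
    show ?thesis by (auto simp: j_def u algebra_simps)
  qed
  have "convex K"
    unfolding convex_def K_def by (auto simp: jlin convex_standard_simplex)
  then have contrK: "contractible K" by (rule convex_imp_contractible)
  have contj: "continuous_on K j"
  proof (rule continuous_on_coordinatewise_then_product)
    show "continuous_on K (\<lambda>u. j u i)" for i
    proof -
      consider "i = 0" | "i = 1" | "i = 2" | "i > 2" by linarith
      then show ?thesis
        by cases (simp_all add: j_def continuous_intros)
    qed
  qed
  have contr: "continuous_on (standard_simplex p) r"
    unfolding r_def by (intro continuous_intros continuous_on_product_coordinates continuous_on_subset[OF _ subset_UNIV])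
  have \<sigma>': "continuous_on (standard_simplex p) \<sigma>" "\<sigma> ` standard_simplex p \<subseteq> S"
      "\<sigma> \<in> extensional (standard_simplex p)"
    using \<sigma> by (auto simp: singular_simplex_top_of_set)
  have "continuous_on K (\<lambda>u. to_complex (\<sigma> (j u)))"
    by (intro continuous_intros continuous_on_compose2[OF \<sigma>'(1) contj]) (auto simp: K_def)
  moreover have "to_complex (\<sigma> (j u)) \<noteq> 0" if "u \<in> K" for u
  proof -
    have "\<sigma> (j u) \<in> S" using that \<sigma>'(2) by (auto simp: K_def)
    with S have "\<sigma> (j u) \<noteq> 0" by metis
    then show ?thesis by (metis to_complex_0 to_complex_inj)
  qed
  ultimately obtain g where g: "continuous_on K g" "\<And>u. u \<in> K \<Longrightarrow> to_complex (\<sigma> (j u)) = exp (g u)"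
    using continuous_logarithm_on_contractible[OF _ contrK] by metis
  have rK: "r x \<in> K" if "x \<in> standard_simplex p" for x using that by (simp add: K_def jr)
  let ?\<tau> = "restrict (g \<circ> r) (standard_simplex p)"
  have wr: "wrap (g (r x)) = \<sigma> x" if "x \<in> standard_simplex p" for x
    using g(2)[OF rK[OF that]] jr[OF that] by (metis to_complex_inj to_complex_wrap)
  show thesis
  proof
    have "continuous_on (standard_simplex p) (g \<circ> r)"
      by (rule continuous_on_compose[OF contr continuous_on_subset[OF g(1)]]) (use rK in auto)
    then have "continuous_on (standard_simplex p) ?\<tau>"
      by (rule continuous_on_eq) auto
    then show "singular_simplex p (top_of_set (wrap -` S)) ?\<tau>"
      using \<sigma>'(2) by (auto simp: singular_simplex_top_of_set wr)
    show "simplex_map p wrap ?\<tau> = \<sigma>"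
      using \<sigma>'(3) by (auto simp: simplex_map_def fun_eq_iff extensional_def wr)
  qed
qed

text \<open>
  Two logarithms of one function differ by a multiple of \<open>2\<pi>\<i>\<close>, and such a difference is locally
  constant.
\<close>

lemma log_difference_constant:
  fixes g h :: "'a::topological_space \<Rightarrow> complex"
  assumes C: "connected C" and g: "continuous_on C g" and h: "continuous_on C h"
    and eq: "\<And>x. x \<in> C \<Longrightarrow> exp (g x) = exp (h x)" and xy: "x \<in> C" "y \<in> C"
  shows "g x - g y = h x - h y"
proof -
  let ?d = "\<lambda>x. g x - h x"
  have "?d constant_on C"
  proof (rule continuous_discrete_range_constant[OF C])
    show "continuous_on C ?d" by (intro continuous_intros g h)
    fix x assume x: "x \<in> C"
    show "\<exists>e>0. \<forall>y. y \<in> C \<and> ?d y \<noteq> ?d x \<longrightarrow> e \<le> norm (?d y - ?d x)"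
    proof (intro exI[of _ "2 * pi"] conjI allI impI)
      fix y assume y: "y \<in> C \<and> ?d y \<noteq> ?d x"
      obtain k l where "g x = h x + turns k" "g y = h y + turns l"
        using eq[OF x] eq[of y] y by (auto simp: exp_eq_turns)
      then have d: "?d y - ?d x = turns (l - k)" and "l \<noteq> k" using y by (auto simp: algebra_simps)
      have "norm (turns m) = \<bar>of_int m\<bar> * (2 * pi)" for m
        by (simp add: norm_mult)
      then have "norm (?d y - ?d x) = \<bar>of_int (l - k)\<bar> * (2 * pi)"
        unfolding d .
      moreover have "1 \<le> \<bar>real_of_int (l - k)\<bar>" using \<open>l \<noteq> k\<close> by linarith
      ultimately show "2 * pi \<le> norm (?d y - ?d x)" by simp
    qed simp
  qed
  then show ?thesis using xy by (auto simp: constant_on_def algebra_simps)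
qed

lemma connected_standard_simplex: "connected (standard_simplex p)"
  using connectedin_standard_simplex[of p] by (simp add: euclidean_product_topology)

text \<open>
  The number of turns of a lift, corrected by the principal logarithms of the end points, which
  makes it an integer also for paths that are not closed. The corrections cancel on cycles.
\<close>

definition winding :: "((nat \<Rightarrow> real) \<Rightarrow> real^2) \<Rightarrow> int" where
  "winding \<sigma> = (SOME k. \<exists>\<tau>. singular_simplex 1 (top_of_set UNIV) \<tau> \<and> simplex_map 1 wrap \<tau> = \<sigma> \<and>
     \<tau> (vertex 1) - \<tau> (vertex 0) = Ln (to_complex (\<sigma> (vertex 1))) - Ln (to_complex (\<sigma> (vertex 0))) + turns k)"

text \<open>
  The defining choice of a lift does not matter, by \<open>log_difference_constant\<close>.
\<close>

lemma winding_lift: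
  assumes \<tau>: "singular_simplex 1 (top_of_set S) \<tau>"
  defines "\<sigma> \<equiv> simplex_map 1 wrap \<tau>"
  shows "\<tau> (vertex 1) - \<tau> (vertex 0) =
      Ln (to_complex (\<sigma> (vertex 1))) - Ln (to_complex (\<sigma> (vertex 0))) + turns (winding \<sigma>)"
proof -
  let ?P = "\<lambda>k \<tau>. singular_simplex 1 (top_of_set UNIV) \<tau> \<and> simplex_map 1 wrap \<tau> = \<sigma> \<and>
     \<tau> (vertex 1) - \<tau> (vertex 0) = Ln (to_complex (\<sigma> (vertex 1))) - Ln (to_complex (\<sigma> (vertex 0))) + turns k"
  have \<tau>U: "singular_simplex 1 (top_of_set UNIV) \<tau>"
    using \<tau> unfolding singular_simplex_top_of_set by auto
  have \<sigma>w: "\<sigma> x = wrap (\<tau> x)" if "x \<in> standard_simplex 1" for x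
    using that by (simp add: \<sigma>_def simplex_map_def)
  have "\<exists>k. \<tau> (vertex j) = Ln (to_complex (\<sigma> (vertex j))) + turns k" if "j \<le> 1" for j
    using \<sigma>w[of "vertex j"] that unfolding exp_eq_turns[symmetric] by (simp add: vertex_in)
  from this[of 0] this[of 1] obtain k0 k1
      where k: "\<tau> (vertex 0) = Ln (to_complex (\<sigma> (vertex 0))) + turns k0"
      "\<tau> (vertex 1) = Ln (to_complex (\<sigma> (vertex 1))) + turns k1"
    by auto
  have "?P (k1 - k0) \<tau>"
    unfolding k using \<tau>U by (simp add: \<sigma>_def left_diff_distrib)
  then have "\<exists>k \<tau>. ?P k \<tau>" by blast
  then have "\<exists>\<tau>. ?P (winding \<sigma>) \<tau>" unfolding winding_def by (rule someI_ex)
  then obtain \<tau>' where \<tau>': "?P (winding \<sigma>) \<tau>'" by blast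
  have "\<tau> (vertex 1) - \<tau> (vertex 0) = \<tau>' (vertex 1) - \<tau>' (vertex 0)"
  proof (rule log_difference_constant[OF connected_standard_simplex[of 1]])
    fix x assume x: "x \<in> standard_simplex 1"
    have "simplex_map 1 wrap \<tau>' x = \<sigma> x" using \<tau>' by blast
    then have "wrap (\<tau> x) = wrap (\<tau>' x)" using x \<sigma>w[OF x] by (simp add: simplex_map_def)
    then show "exp (\<tau> x) = exp (\<tau>' x)" by (simp only: wrap_eq_iff)
  next
    show "continuous_on (standard_simplex 1) \<tau>" "continuous_on (standard_simplex 1) \<tau>'"
      using \<tau>U \<tau>' unfolding singular_simplex_top_of_set by blast+
  qed (simp_all add: vertex_in)
  with \<tau>' show ?thesis by simp
qed

lemma turns_eq_iff [simp]: "turns k = turns l \<longleftrightarrow> k = l"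
  by simp

text \<open>
  The triangle has a single lift, so the end points of the lifted edges cancel in the alternating
  sum, and so do the principal logarithms.
\<close>

lemma winding_cocycle:
  assumes \<sigma>: "singular_simplex 2 (top_of_set S) \<sigma>" and S: "0 \<notin> S"
  shows "winding (singular_face 2 0 \<sigma>) - winding (singular_face 2 1 \<sigma>) + winding (singular_face 2 2 \<sigma>) = 0"
proof -
  obtain \<tau> where \<tau>: "singular_simplex 2 (top_of_set (wrap -` S)) \<tau>" "simplex_map 2 wrap \<tau> = \<sigma>"
    by (rule simplex_lift[OF \<sigma> _ S]) auto
  have face: "simplex_map 1 wrap (singular_face 2 k \<tau>) = singular_face 2 k \<sigma>" if "k \<le> 2" for k
    using that unfolding \<tau>(2)[symmetric]
    by (auto simp: singular_face_def simplex_map_def fun_eq_iff simplical_face_in_standard_simplex)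
  have sing: "singular_simplex 1 (top_of_set (wrap -` S)) (singular_face 2 k \<tau>)" if "k \<le> 2" for k
    using singular_simplex_singular_face[OF \<tau>(1), of k] that by simp
  have w: "turns (winding (singular_face 2 k \<sigma>)) =
      singular_face 2 k \<tau> (vertex 1) - singular_face 2 k \<tau> (vertex 0) -
      (Ln (to_complex (singular_face 2 k \<sigma> (vertex 1))) - Ln (to_complex (singular_face 2 k \<sigma> (vertex 0))))"
    if "k \<le> 2" for k
    using winding_lift[OF sing[OF that]] unfolding face[OF that] by simp
  have v: "singular_face 2 k f (vertex j) = f (if j < k then vertex j else vertex (Suc j))"
      if "k \<le> 2" "j \<le> 1"
    for k j and f :: "(nat \<Rightarrow> real) \<Rightarrow> 'b"
    using singular_face_vertex[of k 1 j f] that by (simp add: numeral_2_eq_2)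
  have "turns (winding (singular_face 2 0 \<sigma>) - winding (singular_face 2 1 \<sigma>) + winding (singular_face 2 2 \<sigma>))
      = turns (winding (singular_face 2 0 \<sigma>)) - turns (winding (singular_face 2 1 \<sigma>)) +
        turns (winding (singular_face 2 2 \<sigma>))"
    by (simp add: algebra_simps)
  also have "\<dots> = turns 0"
    by (simp add: w v)
  finally show ?thesis by (simp only: turns_eq_iff)
qed

definition winding_form :: "(real^2, 'k::comm_ring_1) coeff_chain \<Rightarrow> 'k" where
  "winding_form c = (\<Sum>\<sigma>\<in>Poly_Mapping.keys c. Poly_Mapping.lookup c \<sigma> * of_int (winding \<sigma>))"

lemma winding_form_superset:
  assumes "finite S" "Poly_Mapping.keys c \<subseteq> S"
  shows "winding_form c = (\<Sum>\<sigma>\<in>S. Poly_Mapping.lookup c \<sigma> * of_int (winding \<sigma>))"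
  unfolding winding_form_def using assms
  by (intro sum.mono_neutral_left) (auto simp: in_keys_iff)

lemma winding_form_add: "winding_form (c + d) = winding_form c + winding_form d"
proof -
  let ?S = "Poly_Mapping.keys c \<union> Poly_Mapping.keys d"
  have "Poly_Mapping.keys (c + d) \<subseteq> ?S" by (rule keys_add)
  then show ?thesis
    by (simp add: winding_form_superset[of ?S] lookup_add distrib_right sum.distrib)
qed

lemma winding_form_0: "winding_form 0 = 0"
  by (simp add: winding_form_def)

lemma winding_form_sum: "winding_form (sum f A) = (\<Sum>x\<in>A. winding_form (f x))"
  by (induction A rule: infinite_finite_induct) (simp_all add: winding_form_0 winding_form_add)

lemma winding_form_scale: "winding_form (scale r c) = r * winding_form c"
proof -
  have "Poly_Mapping.keys (scale r c) \<subseteq> Poly_Mapping.keys c"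
    by (auto simp: in_keys_iff lookup_scale)
  then show ?thesis
    by (simp add: winding_form_superset[of "Poly_Mapping.keys c"] lookup_scale sum_distrib_left mult.assoc)
qed

lemma winding_form_single: "winding_form (Poly_Mapping.single \<sigma> a) = a * of_int (winding \<sigma>)"
  by (simp add: winding_form_superset[of "{\<sigma>}"])

lemma winding_form_boundary:
  fixes c :: "(real^2, 'k::comm_ring_1) coeff_chain"
  assumes "c \<in> coeff_boundaries 1 (top_of_set S)" and S: "0 \<notin> S"
  shows "winding_form c = 0"
proof -
  obtain d where d: "d \<in> coeff_chains 2 (top_of_set S)" "c = coeff_boundary 2 d"
    using assms(1) by (auto simp: coeff_boundaries_def numeral_2_eq_2)
  have "winding_form c = (\<Sum>\<sigma>\<in>Poly_Mapping.keys d. \<Sum>k\<le>2.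
      (-1) ^ k * Poly_Mapping.lookup d \<sigma> * of_int (winding (singular_face 2 k \<sigma>)))"
    by (simp add: d(2) coeff_boundary_def winding_form_sum winding_form_single)
  also have "\<dots> = (\<Sum>\<sigma>\<in>Poly_Mapping.keys d. Poly_Mapping.lookup d \<sigma> *
      of_int (winding (singular_face 2 0 \<sigma>) - winding (singular_face 2 1 \<sigma>) + winding (singular_face 2 2 \<sigma>)))"
    by (simp add: numeral_2_eq_2 algebra_simps)
  also have "\<dots> = (\<Sum>\<sigma>\<in>Poly_Mapping.keys d. Poly_Mapping.lookup d \<sigma> * of_int 0)"
  proof (intro sum.cong refl)
    fix \<sigma> assume "\<sigma> \<in> Poly_Mapping.keys d"
    then have "singular_simplex 2 (top_of_set S) \<sigma>"
      using d(1) unfolding coeff_chains_def by blast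
    from winding_cocycle[OF this S] show "Poly_Mapping.lookup d \<sigma> *
      of_int (winding (singular_face 2 0 \<sigma>) - winding (singular_face 2 1 \<sigma>) + winding (singular_face 2 2 \<sigma>))
      = Poly_Mapping.lookup d \<sigma> * of_int 0" by (simp only:)
  qed
  finally show ?thesis by simp
qed

section \<open>First homology of annular sets and of sets with contractible components\<close>

lemma chain_map_point: "chain_map 0 f (frag_of (point_simplex y)) = frag_of (point_simplex (f y))"
  by (simp add: simplex_map_def point_simplex_def restrict_def) (simp add: comp_def cong: if_cong)

text \<open>
  Close up each simplex by integral chains to a base point of its component. The result is an
  integral cycle in a contractible set and bounds there, which is the hypothesis of
  \<open>one_cycle_reduction\<close> with \<open>l = 0\<close>.
\<close>

theorem contractible_components_acyclic:
  fixes S :: "'a::real_normed_vector set" and c :: "('a, 'k::comm_ring_1) coeff_chain"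
  assumes comp: "\<And>x. x \<in> S \<Longrightarrow> contractible (path_component_set S x)"
    and c: "c \<in> coeff_cycles 1 (top_of_set S)"
  shows "c \<in> coeff_boundaries 1 (top_of_set S)"
proof -
  define b where "b x = (SOME y. path_component S x y)" for x
  have b: "path_component S x (b x)" if "x \<in> S" for x
    unfolding b_def using that by (metis path_component_refl someI)
  have b_eq: "b x = b y" if "path_component S x y" for x y
  proof -
    have "path_component S x z \<longleftrightarrow> path_component S y z" for z
      using that by (blast intro: path_component_sym path_component_trans)
    then show ?thesis by (simp add: b_def)
  qed
  have ex: "\<exists>d. singular_chain 1 (top_of_set (path_component_set S x)) d \<and>
      chain_boundary 1 d = frag_of (point_simplex x) - frag_of (point_simplex (b x))" if "x \<in> S" for x
  proof -
    have "x \<in> path_component_set S x" "b x \<in> path_component_set S x"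
      using b[OF that] that by (auto simp: path_component_refl)
    from path_connected_joining_chain[OF path_connected_path_component[of S x] this] show ?thesis
      by blast
  qed
  define D where "D x = (SOME d. singular_chain 1 (top_of_set (path_component_set S x)) d \<and>
      chain_boundary 1 d = frag_of (point_simplex x) - frag_of (point_simplex (b x)))" for x
  have D: "singular_chain 1 (top_of_set (path_component_set S x)) (D x)"
      "chain_boundary 1 (D x) = frag_of (point_simplex x) - frag_of (point_simplex (b x))"
          if "x \<in> S" for x
    using someI_ex[OF ex[OF that]] unfolding D_def by blast+
  define \<delta> :: "((nat \<Rightarrow> real) \<Rightarrow> 'a) \<Rightarrow> ('a, 'k) coeff_chain" where
    "\<delta> f = int_chain (D (f (vertex 0)))" for f
  have "c - scale (\<Sum>\<sigma>\<in>Poly_Mapping.keys c. Poly_Mapping.lookup c \<sigma> * 0) 0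
           \<in> coeff_boundaries 1 (top_of_set S)"
  proof (rule one_cycle_reduction[OF _ c, where \<delta> = \<delta>])
    fix \<sigma> :: "(nat \<Rightarrow> real) \<Rightarrow> 'a" assume \<sigma>: "singular_simplex 1 (top_of_set S) \<sigma>"
    let ?x = "\<sigma> (vertex 0)" and ?y = "\<sigma> (vertex 1)"
    let ?C = "path_component_set S ?x"
    have xy: "?x \<in> S" "?y \<in> S"
      using \<sigma> by (auto simp: singular_simplex_top_of_set image_subset_iff vertex_in)
    have "path_connectedin (subtopology (powertop_real UNIV) (standard_simplex 1)) (standard_simplex 1)"
      using path_connectedin_standard_simplex[of 1] by (simp add: path_connectedin_subtopology)
    with \<sigma> have "path_connectedin (top_of_set S) (\<sigma> ` standard_simplex 1)"
      unfolding singular_simplex_def by (blast intro: path_connectedin_continuous_map_image)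
    then have pc: "path_connected (\<sigma> ` standard_simplex 1)"
      by (simp add: path_connectedin_subtopology)
    have sub: "\<sigma> ` standard_simplex 1 \<subseteq> ?C"
      using \<sigma> by (intro path_component_maximal pc)
        (auto simp: singular_simplex_top_of_set vertex_in)
    then have \<sigma>C: "singular_simplex 1 (top_of_set ?C) \<sigma>"
      using \<sigma> by (auto simp: singular_simplex_top_of_set)
    have "vertex 1 \<in> standard_simplex 1" by (simp add: vertex_in)
    then have pcxy: "path_component S ?x ?y" using sub by blast
    then have Ceq: "path_component_set S ?y = ?C"
      by (intro Collect_cong) (blast intro: path_component_sym path_component_trans)
    let ?z = "frag_of \<sigma> - D ?y + D ?x"
    have "singular_chain 1 (top_of_set ?C) (frag_of \<sigma>)"
      using \<sigma>C by (simp only: singular_chain_of)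
    moreover have "singular_chain 1 (top_of_set ?C) (D ?y)"
      using D(1)[OF xy(2)] by (simp only: Ceq)
    ultimately have "singular_chain 1 (top_of_set ?C) ?z"
      by (intro singular_chain_add singular_chain_diff D(1) xy)
    moreover have "chain_boundary 1 ?z = 0"
      unfolding chain_boundary_add chain_boundary_diff chain_boundary_1_of singular_face_1
        D(2)[OF xy(1)] D(2)[OF xy(2)] b_eq[OF pcxy] by simp
    ultimately have "singular_relcycle 1 (top_of_set ?C) {} ?z"
      by (simp only: singular_cycle)
    then have "singular_relboundary 1 (top_of_set ?C) {} ?z"
      by (rule contractible_cycle_bounds[OF comp[OF xy(1)] _ order.refl])
    then have "singular_relboundary 1 (top_of_set S) {} ?z"
      by (rule singular_boundary_mono[OF path_component_subset])
    from int_chain_boundary[OF this] show "Poly_Mapping.single \<sigma> 1 - \<delta> (singular_face 1 0 \<sigma>) +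
        \<delta> (singular_face 1 1 \<sigma>) - scale 0 0 \<in> coeff_boundaries 1 (top_of_set S)"
      unfolding \<delta>_def singular_face_1 point_simplex_vertex scale_0_right int_chain_simps by simp
  qed
  then show ?thesis by (simp only: scale_0_right diff_zero)
qed

corollary contractible_acyclic:
  fixes S :: "'a::real_normed_vector set"
  assumes S: "contractible S" and c: "c \<in> coeff_cycles 1 (top_of_set S)"
  shows "c \<in> coeff_boundaries 1 (top_of_set S)"
proof (rule contractible_components_acyclic[OF _ c])
  fix x assume "x \<in> S"
  then have "path_component_set S x = S"
    using iffD1[OF path_connected_component_set contractible_imp_path_connected[OF S]] by blast
  then show "contractible (path_component_set S x)" using S by (simp only:)
qed

text \<open>
  A lift of one positive turn along the circle of radius \<open>exp a\<close>.
\<close>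

definition circle_edge :: "real \<Rightarrow> (nat \<Rightarrow> real) \<Rightarrow> complex" where
  "circle_edge a = (\<lambda>x\<in>standard_simplex 1. of_real a + of_real (x 1) * turns 1)"

definition circle_cycle :: "real \<Rightarrow> (real^2, 'k::comm_ring_1) coeff_chain" where
  "circle_cycle a = Poly_Mapping.single (simplex_map 1 wrap (circle_edge a)) 1"

lemma singular_simplex_circle_edge:
  assumes "\<And>y. Complex a y \<in> W"
  shows "singular_simplex 1 (top_of_set W) (circle_edge a)"
proof -
  have "continuous_on (standard_simplex 1) (\<lambda>x. of_real a + of_real (x 1) * turns 1)"
    by (intro continuous_intros continuous_on_product_coordinates continuous_on_subset[OF _ subset_UNIV])
  then have "continuous_on (standard_simplex 1) (circle_edge a)"
    unfolding circle_edge_def by (rule continuous_on_eq) auto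
  moreover have "of_real a + of_real r * turns 1 = Complex a (2 * pi * r)" for r
    by (simp add: complex_eq_iff)
  ultimately show ?thesis
    unfolding singular_simplex_top_of_set using assms by (auto simp: circle_edge_def)
qed

lemma circle_edge_ends:
  "circle_edge a (vertex 0) = of_real a" "circle_edge a (vertex 1) = of_real a + turns 1"
  by (simp_all add: circle_edge_def vertex_in) (simp_all add: vertex_def)

lemma winding_form_circle_cycle: "winding_form (circle_cycle a) = 1"
proof -
  have 1: "singular_simplex 1 (top_of_set UNIV) (circle_edge a)"
    by (rule singular_simplex_circle_edge) simp
  have "simplex_map 1 wrap (circle_edge a) (vertex j) = wrap (circle_edge a (vertex j))" if "j \<le> 1"
      for j
    using that by (simp add: simplex_map_def vertex_in)
  then have "turns (winding (simplex_map 1 wrap (circle_edge a))) = turns 1"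
    using winding_lift[OF 1] by (simp only: circle_edge_ends wrap_turns le_refl zero_le) simp
  then have "winding (simplex_map 1 wrap (circle_edge a)) = 1"
    by (simp only: turns_eq_iff)
  then show ?thesis by (simp add: circle_cycle_def winding_form_single)
qed

lemma circle_cycle_in:
  assumes "\<And>y. wrap (Complex a y) \<in> S"
  shows "circle_cycle a \<in> coeff_cycles 1 (top_of_set S)"
proof -
  have e: "singular_simplex 1 (top_of_set (wrap -` S)) (circle_edge a)"
    using assms by (intro singular_simplex_circle_edge) simp
  have cm: "continuous_map (top_of_set (wrap -` S)) (top_of_set S) wrap"
    by (auto intro!: continuous_intros)
  have s: "singular_simplex 1 (top_of_set S) (simplex_map 1 wrap (circle_edge a))" (is "singular_simplex 1 _ ?\<sigma>")
    by (rule singular_simplex_simplex_map[OF e cm])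
  have v: "?\<sigma> (vertex j) = wrap (circle_edge a (vertex j))" if "j \<le> 1" for j
    using that by (simp add: simplex_map_def vertex_in)
  have "singular_relcycle 1 (top_of_set S) {} (frag_of ?\<sigma>)"
    unfolding singular_cycle chain_boundary_1_of singular_face_1
    using s by (simp only: singular_chain_of v le_refl zero_le circle_edge_ends wrap_turns) simp
  from int_chain_cycle[OF this] show ?thesis
    by (simp add: int_chain_simps circle_cycle_def)
qed

text \<open>
  The preimage of \<open>S\<close> under \<open>wrap\<close> is an infinite cyclic covering with contractible total space,
  so the homology is generated by the image of a path from a base point to its translate by one
  turn, and the coefficient of that generator is the winding number. At the level of chains: with
  \<open>E y\<close> joining the base point \<open>b\<close> to \<open>y\<close>, moving \<open>y\<close> by \<open>k\<close> turns changes the image of \<open>E y\<close> by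
  \<open>k\<close> times the generator, up to boundaries (facts \<open>translate\<close>, \<open>step\<close> and \<open>mult\<close> in the proof).
\<close>

theorem annulus_cycle:
  fixes c :: "(real^2, 'k::comm_ring_1) coeff_chain"
  assumes S: "0 \<notin> S" and W: "contractible (wrap -` S)" and a: "\<And>y. wrap (Complex a y) \<in> S"
    and c: "c \<in> coeff_cycles 1 (top_of_set S)"
  shows "c - scale (winding_form c) (circle_cycle a) \<in> coeff_boundaries 1 (top_of_set S)"
proof -
  define W where "W = wrap -` S"
  let ?W = "top_of_set W" and ?S = "top_of_set S"
  have contrW: "contractible W" using assms(2) by (simp add: W_def)
  then have pW: "path_connected W" by (rule contractible_imp_path_connected)
  define b where "b = complex_of_real a"
  have WT: "z + turns k \<in> W \<longleftrightarrow> z \<in> W" for z k by (simp add: W_def)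
  have bW: "b \<in> W" using a[of 0] by (simp add: W_def b_def complex_of_real_def)
  define E where "E y = (SOME d. singular_chain 1 ?W d \<and> chain_boundary 1 d
      = frag_of (point_simplex y) - frag_of (point_simplex b))" for y
  have E: "singular_chain 1 ?W (E y)" "chain_boundary 1 (E y)
      = frag_of (point_simplex y) - frag_of (point_simplex b)"
    if "y \<in> W" for y
  proof -
    have "\<exists>d. singular_chain 1 ?W d \<and> chain_boundary 1 d
        = frag_of (point_simplex y) - frag_of (point_simplex b)"
      using path_connected_joining_chain[OF pW that bW] by metis
    from someI_ex[OF this]
    show "singular_chain 1 ?W (E y)" "chain_boundary 1 (E y)
        = frag_of (point_simplex y) - frag_of (point_simplex b)"
      unfolding E_def by blast+
  qed
  have cm: "continuous_map ?W ?S wrap"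
    by (auto simp: W_def intro!: continuous_intros)
  have cmT: "continuous_map ?W ?W (\<lambda>z. z + turns k)" for k
    by (auto simp: WT intro!: continuous_intros)
  define Q where "Q d = chain_map 1 wrap d" for d
  have Q_bd: "singular_relboundary 1 ?S {} (Q d)"
      if "singular_chain 1 ?W d" "chain_boundary 1 d = 0" for d
  proof -
    have "singular_relcycle 1 ?W {} d" using that by (simp add: singular_cycle)
    from singular_relboundary_chain_map[OF contractible_cycle_bounds[OF contrW this] cm]
    show ?thesis by (simp add: Q_def)
  qed
  have T: "singular_chain 1 ?W (chain_map 1 (\<lambda>z. z + turns k) d)"
      "chain_boundary 1 (chain_map 1 (\<lambda>z. z + turns k) d)
          = chain_map 0 (\<lambda>z. z + turns k) (chain_boundary 1 d)"
      "Q (chain_map 1 (\<lambda>z. z + turns k) d) = Q d" if "singular_chain 1 ?W d" for k d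
  proof -
    show "singular_chain 1 ?W (chain_map 1 (\<lambda>z. z + turns k) d)"
      by (rule singular_chain_chain_map[OF that cmT])
    show "chain_boundary 1 (chain_map 1 (\<lambda>z. z + turns k) d)
        = chain_map 0 (\<lambda>z. z + turns k) (chain_boundary 1 d)"
      using chain_boundary_chain_map[OF that, of "\<lambda>z. z + turns k"] by simp
    have "wrap \<circ> (\<lambda>z. z + turns k) = wrap" by (simp add: fun_eq_iff)
    then show "Q (chain_map 1 (\<lambda>z. z + turns k) d) = Q d"
      unfolding Q_def by (metis chain_map_compose comp_apply)
  qed
  note chain_simps = singular_chain_add singular_chain_diff chain_boundary_add chain_boundary_diff
    chain_map_diff chain_map_add chain_map_point
  have edge: "singular_chain 1 ?W (frag_of (circle_edge a))"
      "chain_boundary 1 (frag_of (circle_edge a))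
          = frag_of (point_simplex (b + turns 1)) - frag_of (point_simplex b)"
  proof -
    show "singular_chain 1 ?W (frag_of (circle_edge a))"
      unfolding singular_chain_of by (rule singular_simplex_circle_edge) (simp add: W_def a)
    show "chain_boundary 1 (frag_of (circle_edge a))
        = frag_of (point_simplex (b + turns 1)) - frag_of (point_simplex b)"
      unfolding chain_boundary_1_of singular_face_1 circle_edge_ends b_def ..
  qed
  define L where "L = Q (frag_of (circle_edge a))"
  have translate: "singular_relboundary 1 ?S {} (Q (E (y + turns k)) - Q (E y) - Q (E (b + turns k)))"
    if y: "y \<in> W" for y k
  proof -
    let ?d = "E (y + turns k) - chain_map 1 (\<lambda>z. z + turns k) (E y) - E (b + turns k)"
    have yk: "y + turns k \<in> W" "b + turns k \<in> W" using y bW by (simp_all only: WT)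
    have "singular_chain 1 ?W ?d"
      using E(1)[OF yk(1)] E(1)[OF yk(2)] T(1)[OF E(1)[OF y]] by (intro singular_chain_diff)
    moreover have "chain_boundary 1 ?d = 0"
      unfolding chain_boundary_diff T(2)[OF E(1)[OF y]] E(2)[OF y] E(2)[OF yk(1)] E(2)[OF yk(2)]
        chain_map_diff chain_map_point by simp
    ultimately have "singular_relboundary 1 ?S {} (Q ?d)" by (rule Q_bd)
    moreover have "Q ?d = Q (E (y + turns k)) - Q (E y) - Q (E (b + turns k))"
      using T(3)[OF E(1)[OF y]] by (simp add: Q_def chain_map_diff)
    ultimately show ?thesis by simp
  qed
  have step: "singular_relboundary 1 ?S {} (Q (E (b + turns (k + 1))) - Q (E (b + turns k)) - L)" for k
  proof -
    let ?d = "E (b + turns (k + 1)) - E (b + turns k) - chain_map 1 (\<lambda>z. z + turns k) (frag_of (circle_edge a))"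
    have bk: "b + turns (k + 1) \<in> W" "b + turns k \<in> W" using bW by (simp_all only: WT)
    have "singular_chain 1 ?W ?d"
      by (intro singular_chain_diff E(1) bk T(1) edge(1))
    moreover have "chain_boundary 1 ?d = 0"
      unfolding chain_boundary_diff T(2)[OF edge(1)] edge(2) E(2)[OF bk(1)] E(2)[OF bk(2)]
        chain_map_diff chain_map_point by (simp add: algebra_simps)
    ultimately have "singular_relboundary 1 ?S {} (Q ?d)" by (rule Q_bd)
    moreover have "Q ?d = Q (E (b + turns (k + 1))) - Q (E (b + turns k)) - L"
      using T(3)[OF edge(1)] by (simp add: Q_def chain_map_diff L_def)
    ultimately show ?thesis by simp
  qed
  have mult: "singular_relboundary 1 ?S {} (Q (E (b + turns k)) - frag_cmul k L)" for k
  proof (induction k rule: int_induct[where k = 0])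
    case base
    have "chain_boundary 1 (E b) = 0" by (simp only: E(2)[OF bW]) simp
    from Q_bd[OF E(1)[OF bW] this] show ?case by simp
  next
    case (step1 i)
    from singular_relboundary_add[OF step1(2) step[of i]] show ?case
      by (simp add: frag_cmul_distrib algebra_simps)
  next
    case (step2 i)
    have "frag_cmul i L = frag_cmul (i - 1) L + L"
      using frag_cmul_distrib[of "i - 1" 1 L] by simp
    then have gen: "A - frag_cmul i L - (A - B - L) = B - frag_cmul (i - 1) L" for A B
      by simp
    from singular_relboundary_diff[OF step2(2) step[of "i - 1", unfolded diff_add_cancel]] show ?case
      unfolding gen .
  qed
  have combine: "singular_relboundary 1 ?S {} (s - Y + X - frag_cmul w L)"
    if "singular_relboundary 1 ?S {} (s - A + B)"
      "singular_relboundary 1 ?S {} (A - Y - P)" "singular_relboundary 1 ?S {} (P - frag_cmul (k + w) L)"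
      "singular_relboundary 1 ?S {} (B - X - R)" "singular_relboundary 1 ?S {} (R - frag_cmul k L)"
    for s A B P R X Y k w
  proof -
    note singular_relboundary_diff[OF singular_relboundary_diff[OF singular_relboundary_add[OF
       singular_relboundary_add[OF that(1,2)] that(3)] that(4)] that(5)]
    then show ?thesis by (simp add: frag_cmul_distrib algebra_simps)
  qed
  define l where "l x = Ln (to_complex x)" for x
  have lW: "l x \<in> W" "wrap (l x) = x" if "x \<in> S" for x
  proof -
    have "x \<noteq> 0" using that S by metis
    then show "l x \<in> W" "wrap (l x) = x" using that by (simp_all add: W_def l_def wrap_Ln)
  qed
  define \<delta> :: "((nat \<Rightarrow> real) \<Rightarrow> real^2) \<Rightarrow> (real^2, 'k) coeff_chain" where
    "\<delta> f = int_chain (Q (E (l (f (vertex 0)))))" for f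
  have "c - scale (\<Sum>\<sigma>\<in>Poly_Mapping.keys c. Poly_Mapping.lookup c \<sigma> * of_int (winding \<sigma>)) (int_chain L)
           \<in> coeff_boundaries 1 ?S"
  proof (rule one_cycle_reduction[OF _ c, where \<delta> = \<delta>])
    fix \<sigma> :: "(nat \<Rightarrow> real) \<Rightarrow> real^2" assume \<sigma>: "singular_simplex 1 ?S \<sigma>"
    let ?x = "\<sigma> (vertex 0)" and ?y = "\<sigma> (vertex 1)" and ?w = "winding \<sigma>"
    have xy: "?x \<in> S" "?y \<in> S"
      using \<sigma> by (auto simp: singular_simplex_top_of_set image_subset_iff vertex_in)
    obtain \<tau> where \<tau>: "singular_simplex 1 ?W \<tau>" "simplex_map 1 wrap \<tau> = \<sigma>"
      using simplex_lift[OF \<sigma> _ S] unfolding W_def by auto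
    have wr: "wrap (\<tau> (vertex j)) = \<sigma> (vertex j)" if "j \<le> 1" for j
      using fun_cong[OF \<tau>(2), of "vertex j"] that by (simp add: simplex_map_def vertex_in)
    have "wrap (\<tau> (vertex 0)) = wrap (l ?x)"
      using wr[of 0] lW(2)[OF xy(1)] by simp
    then have "exp (\<tau> (vertex 0)) = exp (l ?x)" by (simp only: wrap_eq_iff)
    then obtain k where k: "\<tau> (vertex 0) = l ?x + turns k" by (auto simp: exp_eq_turns)
    have \<tau>1: "\<tau> (vertex 1) = l ?y + turns (k + ?w)"
      using winding_lift[OF \<tau>(1)] k unfolding \<tau>(2) l_def[symmetric] by (simp add: algebra_simps)
    have 1: "singular_relboundary 1 ?S {} (frag_of \<sigma> - Q (E (l ?y + turns (k + ?w))) + Q (E (l ?x + turns k)))"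
    proof -
      let ?d = "frag_of \<tau> - E (l ?y + turns (k + ?w)) + E (l ?x + turns k)"
      have yk: "l ?y + turns (k + ?w) \<in> W" "l ?x + turns k \<in> W"
        using xy lW(1) by (simp_all only: WT)
      have "singular_chain 1 ?W ?d"
        using \<tau>(1) by (intro singular_chain_diff singular_chain_add E(1) yk) (simp add: singular_chain_of)
      moreover have "chain_boundary 1 ?d = 0"
        unfolding chain_boundary_diff chain_boundary_add E(2)[OF yk(1)] E(2)[OF yk(2)]
          chain_boundary_1_of singular_face_1 k \<tau>1 by simp
      ultimately have "singular_relboundary 1 ?S {} (Q ?d)" by (rule Q_bd)
      moreover have "Q ?d = frag_of \<sigma> - Q (E (l ?y + turns (k + ?w))) + Q (E (l ?x + turns k))"
        unfolding Q_def chain_map_diff chain_map_add chain_map_of \<tau>(2) ..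
      ultimately show ?thesis by (simp only:)
    qed
    have "singular_relboundary 1 ?S {} (frag_of \<sigma> - Q (E (l ?y)) + Q (E (l ?x)) - frag_cmul ?w L)"
      by (rule combine[OF 1 translate[OF lW(1)[OF xy(2)]] mult translate[OF lW(1)[OF xy(1)]] mult])
    from int_chain_boundary[OF this] show "Poly_Mapping.single \<sigma> 1 - \<delta> (singular_face 1 0 \<sigma>) +
        \<delta> (singular_face 1 1 \<sigma>) - scale (of_int ?w) (int_chain L) \<in> coeff_boundaries 1 ?S"
      unfolding \<delta>_def singular_face_1 point_simplex_vertex int_chain_simps by simp
  qed
  moreover have "int_chain L = (circle_cycle a :: (real^2, 'k) coeff_chain)"
    by (simp add: L_def Q_def circle_cycle_def int_chain_simps)
  ultimately show ?thesis by (simp add: winding_form_def)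
qed

section \<open>Neighbourhoods of finite subsets of the circle\<close>

text \<open>
  Push \<open>W\<close> horizontally onto its part on the line \<open>Re = a\<close>, which is an interval, and contract that.
\<close>

lemma slice_contractible:
  assumes slice: "\<And>z. z \<in> W \<Longrightarrow> closed_segment z (Complex a (Im z)) \<subseteq> W"
    and conn: "convex {y. Complex a y \<in> W}"
  shows "contractible W"
proof (cases "W = {}")
  case False
  then obtain w where w: "w \<in> W" by blast
  define y0 where "y0 = Im w"
  have r: "Complex a (Im z) \<in> W" if "z \<in> W" for z
    using slice[OF that] by auto
  have cont: "continuous_on W (\<lambda>z. Complex a (Im z))"
    unfolding Complex_eq by (intro continuous_intros)
  have 1: "homotopic_with_canon (\<lambda>x. True) W W (\<lambda>z. z) (\<lambda>z. Complex a (Im z))"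
    by (rule homotopic_with_linear) (use cont slice in auto)
  have "homotopic_with_canon (\<lambda>x. True) W W (\<lambda>z. Complex a (Im z)) (\<lambda>z. Complex a y0)"
  proof (rule homotopic_with_linear)
    fix z assume z: "z \<in> W"
    have "Complex a y \<in> W" if "y \<in> closed_segment (Im z) y0" for y
      using closed_segment_subset[OF _ _ conn, of "Im z" y0] r[OF z] r[OF w] that by (auto simp: y0_def)
    moreover have "closed_segment (Complex a (Im z)) (Complex a y0)
        \<subseteq> Complex a ` closed_segment (Im z) y0"
    proof
      fix v assume "v \<in> closed_segment (Complex a (Im z)) (Complex a y0)"
      then obtain u where u: "0 \<le> u" "u \<le> 1" "v = (1 - u) *\<^sub>R Complex a (Im z) + u *\<^sub>R Complex a y0"
        by (auto simp: in_segment)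
      then have "v = Complex a ((1 - u) * Im z + u * y0)"
        by (simp add: complex_eq_iff algebra_simps)
      with u show "v \<in> Complex a ` closed_segment (Im z) y0"
        by (intro image_eqI[of _ _ "(1 - u) * Im z + u * y0"]) (auto simp: in_segment)
    qed
    ultimately show "closed_segment (Complex a (Im z)) (Complex a y0) \<subseteq> W" by blast
  qed (use cont in auto)
  from homotopic_with_trans[OF 1 this] show ?thesis
    unfolding contractible_def id_def by blast
qed simp

definition circle_dir :: "real \<Rightarrow> real^2" where
  "circle_dir s = vector [cos s, sin s]"

lemma wrap_polar: "wrap z = exp (Re z) *\<^sub>R circle_dir (Im z)"
  by (simp add: wrap_def circle_dir_def vec_eq_iff forall_2 Re_exp Im_exp)

lemma circle_norm: "x \<in> circle \<longleftrightarrow> norm x = 1"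
  by (simp add: circle_def norm_eq_1 inner_vec_def sum_2 power2_eq_square)

lemma circle_dir_in: "circle_dir s \<in> circle"
  by (simp add: circle_def circle_dir_def)

lemma dist_circle:
  assumes "norm u = 1" "norm p = 1"
  shows "(dist (r *\<^sub>R u) p)\<^sup>2 = r\<^sup>2 - 2 * r * (u \<bullet> p) + 1"
proof -
  have "u \<bullet> u = 1" "p \<bullet> p = 1" using assms by (simp_all add: norm_eq_1)
  then show ?thesis
    unfolding dist_norm power2_norm_eq_inner
    by (simp add: inner_diff_left inner_diff_right inner_commute power2_eq_square algebra_simps)
qed

text \<open>
  For \<open>0 \<le> t < 1\<close>: the arcs of half-angle \<open>arcsin t\<close> around the points of \<open>P\<close> cover the circle, since
  a unit vector \<open>u\<close> is at an angle of at most \<open>arcsin t\<close> from \<open>p\<close> iff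
  \<open>u \<bullet> p \<ge> cos (arcsin t) = sqrt (1 - t\<^sup>2)\<close>.
\<close>

definition covers :: "(real^2) set \<Rightarrow> real \<Rightarrow> bool" where
  "covers P t \<longleftrightarrow> (\<forall>s. \<exists>p\<in>P. sqrt (1 - t\<^sup>2) \<le> circle_dir s \<bullet> p)"

lemma closed_nbhd_finite:
  fixes P :: "'a::heine_borel set"
  assumes "finite P" "P \<noteq> {}"
  shows "closed_nbhd P t = (\<Union>p\<in>P. cball p t)"
proof -
  have "infdist x P \<le> t \<longleftrightarrow> (\<exists>p\<in>P. dist x p \<le> t)" for x
  proof
    assume "infdist x P \<le> t"
    moreover obtain p where "p \<in> P" "infdist x P = dist x p"
      using infdist_attains_inf[of P x] assms finite_imp_closed by metis
    ultimately show "\<exists>p\<in>P. dist x p \<le> t" by auto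
  qed (use infdist_le2 in blast)
  then show ?thesis by (auto simp: closed_nbhd_def dist_commute)
qed

locale circle_points =
  fixes P :: "(real^2) set"
  assumes fin: "finite P" and ne: "P \<noteq> {}" and circle: "P \<subseteq> circle"
begin

lemma norm_P: "p \<in> P \<Longrightarrow> norm p = 1"
  using circle circle_norm by blast

abbreviation "N \<equiv> closed_nbhd P"

lemma N_eq: "x \<in> N t \<longleftrightarrow> (\<exists>p\<in>P. dist x p \<le> t)"
  by (auto simp: closed_nbhd_finite[OF fin ne] dist_commute)

lemma zero_in_N: "0 \<in> N t \<longleftrightarrow> 1 \<le> t"
  using ne norm_P by (auto simp: N_eq)

text \<open>
  From \<open>t = 1\<close> on every ball contains the origin, so the neighbourhood is star-shaped.
\<close>

lemma far_acyclic:
  assumes "1 \<le> t" and c: "c \<in> coeff_cycles 1 (top_of_set (N t))"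
  shows "c \<in> coeff_boundaries 1 (top_of_set (N t))"
proof (rule contractible_acyclic[OF starlike_imp_contractible c])
  have "closed_segment 0 x \<subseteq> N t" if "x \<in> N t" for x
  proof -
    obtain p where p: "p \<in> P" "x \<in> cball p t" using \<open>x \<in> N t\<close> by (auto simp: N_eq dist_commute)
    have "0 \<in> cball p t" using norm_P[OF p(1)] assms(1) by simp
    then have "closed_segment 0 x \<subseteq> cball p t" using p(2) by (intro closed_segment_subset) auto
    with p(1) show ?thesis by (auto simp: closed_nbhd_finite[OF fin ne])
  qed
  moreover have "0 \<in> N t" using assms(1) by (simp add: zero_in_N)
  ultimately show "starlike (N t)" unfolding starlike_def by blast
qed

context
  fixes t :: real
  assumes t: "0 \<le> t" "t < 1"
begin

abbreviation (input) "c \<equiv> sqrt (1 - t\<^sup>2)"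

lemma c_pos: "0 < c" and c_sq: "c\<^sup>2 = 1 - t\<^sup>2"
proof -
  have "t\<^sup>2 < 1" using t power_strict_mono[of t 1 2] by simp
  then show "0 < c" "c\<^sup>2 = 1 - t\<^sup>2" by auto
qed

text \<open>
  The ball about \<open>p\<close> meets the ray through \<open>u\<close> in an interval whose end points have product
  \<open>c\<^sup>2\<close>; this symmetry about \<open>c\<close> in logarithmic scale is what makes \<open>c\<close> the right radius.
\<close>

lemma ray_iff:
  assumes u: "norm u = 1" and p: "p \<in> P"
  shows "dist (r *\<^sub>R u) p \<le> t \<longleftrightarrow> r\<^sup>2 + c\<^sup>2 \<le> 2 * r * (u \<bullet> p)"
proof -
  have "dist (r *\<^sub>R u) p \<le> t \<longleftrightarrow> (dist (r *\<^sub>R u) p)\<^sup>2 \<le> t\<^sup>2"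
    using t by (simp add: power2_le_iff_abs_le)
  also have "\<dots> \<longleftrightarrow> r\<^sup>2 + c\<^sup>2 \<le> 2 * r * (u \<bullet> p)"
    unfolding dist_circle[OF u norm_P[OF p]] c_sq by linarith
  finally show ?thesis .
qed

lemma core_iff:
  assumes u: "norm u = 1" and p: "p \<in> P"
  shows "dist (c *\<^sub>R u) p \<le> t \<longleftrightarrow> c \<le> u \<bullet> p"
proof -
  have "c\<^sup>2 + c\<^sup>2 \<le> 2 * c * (u \<bullet> p) \<longleftrightarrow> 2 * c * c \<le> 2 * c * (u \<bullet> p)"
    by (simp add: power2_eq_square del: real_sqrt_mult_self)
  also have "\<dots> \<longleftrightarrow> c \<le> u \<bullet> p" using c_pos by (intro mult_le_cancel_left_pos) simp
  finally show ?thesis using ray_iff[OF u p] by metis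
qed

lemma wrap_core: "wrap (Complex (ln c) s) = c *\<^sub>R circle_dir s"
  using c_pos by (simp add: wrap_polar)

text \<open>
  Since \<open>2 * r * c \<le> r\<^sup>2 + c\<^sup>2\<close>, a ball that meets a ray at distance \<open>r\<close> also meets it at
  distance \<open>c\<close>, and it contains the points in between because it is convex.
\<close>

lemma slice_nbhd:
  assumes z: "wrap z \<in> N t"
  shows "closed_segment z (Complex (ln c) (Im z)) \<subseteq> wrap -` N t"
proof
  define u where "u = circle_dir (Im z)"
  have u: "norm u = 1" using circle_dir_in circle_norm by (auto simp: u_def)
  define r where "r = exp (Re z)"
  have r: "0 < r" "wrap z = r *\<^sub>R u" by (simp_all add: r_def u_def wrap_polar)
  obtain p where p: "p \<in> P" "dist (r *\<^sub>R u) p \<le> t" using z r by (auto simp: N_eq)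
  have "2 * r * c \<le> r\<^sup>2 + c\<^sup>2" using sum_squares_bound[of r c] by simp
  also have "\<dots> \<le> 2 * r * (u \<bullet> p)" using p ray_iff[OF u p(1)] by blast
  finally have "c \<le> u \<bullet> p" using r by (simp add: mult_le_cancel_left_pos)
  then have core: "c *\<^sub>R u \<in> cball p t" using core_iff[OF u p(1)] by (simp add: dist_commute)
  have conv: "x *\<^sub>R u \<in> N t" if "x \<in> closed_segment r c" for x
  proof -
    have "\<exists>v\<ge>0. v \<le> 1 \<and> x = (1 - v) * r + v * c"
      using that unfolding in_segment real_scaleR_def by metis
    then obtain v where "0 \<le> v" "v \<le> 1" "x = (1 - v) * r + v * c" by blast
    then have "x *\<^sub>R u \<in> closed_segment (r *\<^sub>R u) (c *\<^sub>R u)"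
      unfolding in_segment by (intro exI[of _ v]) (simp add: scaleR_left_distrib)
    also have "\<dots> \<subseteq> cball p t"
      using core p(2) by (intro closed_segment_subset) (auto simp: dist_commute)
    finally show ?thesis using p(1) by (auto simp: N_eq dist_commute)
  qed
  fix y assume "y \<in> closed_segment z (Complex (ln c) (Im z))"
  then obtain v where v: "0 \<le> v" "v \<le> 1" "y = (1 - v) *\<^sub>R z + v *\<^sub>R Complex (ln c) (Im z)"
    by (auto simp: in_segment)
  have y: "Re y = (1 - v) * Re z + v * ln c" "Im y = Im z" by (simp_all add: v(3) algebra_simps)
  have "Re y \<in> closed_segment (Re z) (ln c)"
    using v(1,2) y(1) by (auto simp: in_segment)
  then have "exp (Re y) \<in> closed_segment (exp (Re z)) (exp (ln c))"
    by (auto simp: closed_segment_eq_real_ivl simp del: exp_ln split: if_splits)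
  then have "exp (Re y) \<in> closed_segment r c"
    unfolding exp_ln[OF c_pos] r_def .
  from conv[OF this] show "y \<in> wrap -` N t" by (simp add: wrap_polar y(2) u_def)
qed

lemma covers_iff: "(\<forall>s. wrap (Complex (ln c) s) \<in> N t) \<longleftrightarrow> covers P t"
  "wrap (Complex (ln c) s) \<in> N t \<longleftrightarrow> (\<exists>p\<in>P. c \<le> circle_dir s \<bullet> p)"
proof -
  show *: "wrap (Complex (ln c) s) \<in> N t \<longleftrightarrow> (\<exists>p\<in>P. c \<le> circle_dir s \<bullet> p)" for s
    unfolding wrap_core N_eq using core_iff[of "circle_dir s"] circle_dir_in circle_norm by blast
  show "(\<forall>s. wrap (Complex (ln c) s) \<in> N t) \<longleftrightarrow> covers P t"
    by (simp only: * covers_def)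
qed

lemma covered_contractible:
  assumes "covers P t"
  shows "contractible (wrap -` N t)"
proof (rule slice_contractible)
  show "closed_segment z (Complex (ln c) (Im z)) \<subseteq> wrap -` N t" if "z \<in> wrap -` N t" for z
    using that by (intro slice_nbhd) simp
  have "{y. Complex (ln c) y \<in> wrap -` N t} = UNIV"
    using assms covers_iff(1) by blast
  then show "convex {y. Complex (ln c) y \<in> wrap -` N t}" by simp
qed

text \<open>
  If the direction \<open>s0\<close> is not covered, the neighbourhood misses the whole ray in this direction,
  and a branch \<open>L\<close> of the logarithm is continuous on it. This branch maps every path component
  homeomorphically onto a set to which \<open>slice_contractible\<close> applies.
\<close>

lemma uncovered_acyclic:
  assumes nc: "\<not> covers P t" and cyc: "d \<in> coeff_cycles 1 (top_of_set (N t))"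
  shows "d \<in> coeff_boundaries 1 (top_of_set (N t))"
proof (rule contractible_components_acyclic[OF _ cyc])
  obtain s0 where s0: "wrap (Complex (ln c) s0) \<notin> N t" using nc covers_iff(1) by blast
  \<comment> \<open>The cut of \<open>Ln\<close> along the negative reals is rotated into the direction \<open>s0\<close>.\<close>
  define w where "w = \<i> * of_real (s0 - pi)"
  define L where "L x = Ln (to_complex x * exp (- w)) + w" for x
  have strip_ne: "Im z \<noteq> s0 + 2 * pi * of_int k" if "wrap z \<in> N t" for z k
  proof
    assume eq: "Im z = s0 + 2 * pi * of_int k"
    have "wrap (Complex (ln c) (Im z)) \<in> N t" using slice_nbhd[OF that] by auto
    moreover have "Complex (ln c) (Im z) = Complex (ln c) s0 + turns k"
      by (simp add: complex_eq_iff eq mult_ac)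
    ultimately show False using s0 by (simp only: wrap_turns)
  qed
  have wrapL: "wrap (L x) = x" if "x \<noteq> 0" for x
  proof -
    have "exp (L x) = to_complex x"
      using that to_complex_inj[of x 0] by (simp add: L_def exp_add exp_minus)
    then show ?thesis by (metis to_complex_inj to_complex_wrap)
  qed
  have N0: "x \<noteq> 0" if "x \<in> N t" for x using that zero_in_N t by force
  have notneg: "to_complex x * exp (- w) \<notin> \<real>\<^sub>\<le>\<^sub>0" if x: "x \<in> N t" for x
  proof
    assume neg: "to_complex x * exp (- w) \<in> \<real>\<^sub>\<le>\<^sub>0"
    moreover have nz: "to_complex x * exp (- w) \<noteq> 0" using N0[OF x] to_complex_inj[of x 0] by simp
    ultimately have "Im (Ln (to_complex x * exp (- w))) = pi"
      using Im_Ln_eq_pi[OF nz]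
          by (auto simp: complex_nonpos_Reals_iff complex_eq_iff simp del: mult_eq_0_iff)
    then have "Im (L x) = s0 + 2 * pi * of_int 0" by (simp add: L_def w_def)
    then show False using strip_ne[of "L x" 0] wrapL[OF N0[OF x]] x by simp
  qed
  have contL: "continuous_on (N t) L"
    unfolding L_def using notneg by (intro continuous_intros) auto
  have L_range: "s0 - 2 * pi < Im (L x)" "Im (L x) < s0" if x: "x \<in> N t" for x
  proof -
    have nz: "to_complex x * exp (- w) \<noteq> 0" using N0[OF x] to_complex_inj[of x 0] by simp
    have "- pi < Im (Ln (to_complex x * exp (- w)))" "Im (Ln (to_complex x * exp (- w))) \<le> pi"
      using mpi_less_Im_Ln[OF nz] Im_Ln_le_pi[OF nz] by auto
    moreover have "Im (L x) \<noteq> s0" using strip_ne[of "L x" 0] wrapL[OF N0[OF x]] x by simp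
    ultimately show "s0 - 2 * pi < Im (L x)" "Im (L x) < s0" by (auto simp: L_def w_def)
  qed
  have Lwrap: "L (wrap z) = z" if "s0 - 2 * pi < Im z" "Im z < s0" for z
  proof -
    have "Ln (exp (z - w)) = z - w"
      using that by (intro Ln_exp) (auto simp: w_def)
    then show ?thesis by (simp add: L_def exp_diff exp_minus field_simps)
  qed
  fix x assume x: "x \<in> N t"
  define C where "C = path_component_set (N t) x"
  have CN: "C \<subseteq> N t" by (simp add: C_def path_component_subset)
  have pcC: "path_connected C" by (simp add: C_def path_connected_path_component)
  define W where "W = L ` C"
  have contLC: "continuous_on C L" using contL CN continuous_on_subset by blast
  have slice: "closed_segment z (Complex (ln c) (Im z)) \<subseteq> W" if "z \<in> W" for z
  proof -
    let ?I = "closed_segment z (Complex (ln c) (Im z))"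
    obtain y where y: "y \<in> C" "z = L y" using \<open>z \<in> W\<close> by (auto simp: W_def)
    have yN: "y \<in> N t" using y(1) CN by blast
    have wz: "wrap z = y" using y(2) wrapL[OF N0[OF yN]] by simp
    then have I: "wrap ` ?I \<subseteq> N t" using slice_nbhd[of z] yN by auto
    have "wrap ` ?I \<subseteq> path_component_set (N t) y"
    proof (rule path_component_maximal)
      show "y \<in> wrap ` ?I" using wz by (intro image_eqI[of _ _ z]) auto
      show "path_connected (wrap ` ?I)"
        by (intro path_connected_continuous_image convex_imp_path_connected convex_closed_segment)
           (intro continuous_intros)
    qed (rule I)
    also have "path_component_set (N t) y = C"
      using y(1) unfolding C_def by (metis path_component_eq)
    finally have IC: "wrap ` ?I \<subseteq> C" .
    show ?thesis
    proof
      fix v assume v: "v \<in> ?I"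
      then obtain u where "v = (1 - u) *\<^sub>R z + u *\<^sub>R Complex (ln c) (Im z)"
        unfolding in_segment by blast
      then have "Im v = Im (L y)" using y(2) by (simp add: left_diff_distrib)
      with L_range[OF yN] have "L (wrap v) = v" by (intro Lwrap) simp_all
      moreover have "wrap v \<in> C" using IC v by blast
      then have "L (wrap v) \<in> W" unfolding W_def by (rule imageI)
      ultimately show "v \<in> W" by (simp only:)
    qed
  qed
  \<comment> \<open>The trace of \<open>W\<close> on the line is the shadow of \<open>W\<close>, hence connected.\<close>
  have "{y. Complex (ln c) y \<in> W} = Im ` W"
  proof (intro equalityI subsetI)
    fix y assume "y \<in> {y. Complex (ln c) y \<in> W}"
    then show "y \<in> Im ` W" by (intro image_eqI[of _ _ "Complex (ln c) y"]) auto
  next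
    fix y assume "y \<in> Im ` W"
    then show "y \<in> {y. Complex (ln c) y \<in> W}" using slice by auto
  qed
  moreover have "connected (Im ` W)"
    unfolding W_def
    by (intro connected_continuous_image path_connected_imp_connected pcC contLC continuous_intros)
  ultimately have "convex {y. Complex (ln c) y \<in> W}"
    by (simp only: is_interval_convex_1[symmetric] is_interval_connected_1)
  then have "contractible W" using slice by (intro slice_contractible) auto
  moreover have "W homeomorphic C"
  proof -
    have "homeomorphism W C wrap L"
    proof (rule homeomorphismI)
      show "continuous_on W wrap" by (intro continuous_intros)
      show "wrap ` W \<subseteq> C" unfolding W_def using CN N0 wrapL by auto
      show "L ` C \<subseteq> W" by (simp add: W_def)
      show "L (wrap z) = z" if "z \<in> W" for z
        using that CN N0 wrapL unfolding W_def by auto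
      show "wrap (L y) = y" if "y \<in> C" for y using that CN N0 wrapL by blast
    qed (rule contLC)
    then show ?thesis unfolding homeomorphic_def by blast
  qed
  ultimately show "contractible (path_component_set (N t) x)"
    using homeomorphic_contractible unfolding C_def by blast
qed

end

end

section \<open>The barcode\<close>

definition interval_sum :: "real set list \<Rightarrow> ('k::field, 'k list) pers_mod" where
  "interval_sum Is = pers_sum (map interval_mod Is)"

lemma interval_sum_carrier:
  "xs \<in> carrier (space_at (interval_sum Is) t) \<longleftrightarrow>
     length xs = length Is \<and> (\<forall>i<length Is. t \<notin> Is ! i \<longrightarrow> xs ! i = 0)"
  by (auto simp: interval_sum_def pers_sum_def interval_mod_def)

lemma interval_sum_ops:
  "xs \<oplus>\<^bsub>space_at (interval_sum Is) t\<^esub> ys = map (\<lambda>i. xs ! i + ys ! i) [0..<length Is]"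
  "r \<odot>\<^bsub>space_at (interval_sum Is) t\<^esub> xs = map (\<lambda>i. r * xs ! i) [0..<length Is]"
  "trans_map (interval_sum Is) s t xs =
     map (\<lambda>i. if s \<in> Is ! i \<and> t \<in> Is ! i then xs ! i else 0) [0..<length Is]"
  by (simp_all add: interval_sum_def pers_sum_def interval_mod_def)

definition unit_at :: "nat \<Rightarrow> nat \<Rightarrow> 'k::field list" where
  "unit_at n i = map (\<lambda>j. if j = i then 1 else 0) [0..<n]"

lemma unit_at_carrier:
  "i < length Is \<Longrightarrow> t \<in> Is ! i \<Longrightarrow> unit_at (length Is) i \<in> carrier (space_at (interval_sum Is) t)"
  by (auto simp: interval_sum_carrier unit_at_def)

lemma unit_at_nth: "j < n \<Longrightarrow> unit_at n i ! j = (if j = i then 1 else 0)"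
  by (simp add: unit_at_def)

lemma zero_bar_carrier:
  "replicate (length Is) 0 \<in> carrier (space_at (interval_sum Is) t)"
  by (simp add: interval_sum_carrier)

lemma has_barcodeE:
  fixes M :: "('k::field, 'v) pers_mod"
  assumes "has_barcode M B"
  obtains Is and \<theta> :: "real \<Rightarrow> 'v \<Rightarrow> 'k list" where "mset Is = B"
    and "\<And>t. 0 \<le> t \<Longrightarrow> linear_between (space_at M t) (space_at (interval_sum Is) t) (\<theta> t)"
    and "\<And>t. 0 \<le> t \<Longrightarrow> bij_betw (\<theta> t) (carrier (space_at M t)) (carrier (space_at (interval_sum Is) t))"
    and "\<And>s t x. 0 \<le> s \<Longrightarrow> s \<le> t \<Longrightarrow> x \<in> carrier (space_at M s) \<Longrightarrow>
          \<theta> t (trans_map M s t x) = trans_map (interval_sum Is) s t (\<theta> s x)"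
proof -
  obtain Is where Is: "mset Is = B" "pers_iso M (interval_sum Is)"
    using assms unfolding has_barcode_def interval_sum_def by blast
  from Is(2) obtain \<theta> where \<theta>:
    "\<forall>t\<ge>0. linear_between (space_at M t) (space_at (interval_sum Is) t) (\<theta> t) \<and>
       bij_betw (\<theta> t) (carrier (space_at M t)) (carrier (space_at (interval_sum Is) t))"
    "\<forall>s\<ge>0. \<forall>t\<ge>s. \<forall>x\<in>carrier (space_at M s).
       \<theta> t (trans_map M s t x) = trans_map (interval_sum Is) s t (\<theta> s x)"
    unfolding pers_iso_def by (elim exE conjE)
  show thesis by (rule that[OF Is(1), of \<theta>]) (simp_all add: \<theta>)
qed

lemma no_bar_unique:
  fixes M :: "('k::field, 'v) pers_mod"
  assumes M0: "has_barcode M {#}" and MB: "has_barcode M B"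
  shows "B = {#}"
proof (rule ccontr)
  assume "B \<noteq> {#}"
  obtain Is and \<theta> :: "real \<Rightarrow> 'v \<Rightarrow> 'k list" where "mset Is = {#}" and
    "\<And>t. 0 \<le> t \<Longrightarrow> bij_betw (\<theta> t) (carrier (space_at M t)) (carrier (space_at (interval_sum Is) t))"
    using has_barcodeE[OF M0] by metis
  then have \<theta>: "\<And>t. 0 \<le> t
      \<Longrightarrow> bij_betw (\<theta> t) (carrier (space_at M t)) (carrier (space_at (interval_sum []) t))"
    by simp
  obtain Js and \<eta> :: "real \<Rightarrow> 'v \<Rightarrow> 'k list" where Js: "mset Js = B" and
    \<eta>: "\<And>t. 0 \<le> t \<Longrightarrow> bij_betw (\<eta> t) (carrier (space_at M t)) (carrier (space_at (interval_sum Js) t))"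
    using has_barcodeE[OF MB] by metis
  have len: "0 < length Js" using Js \<open>B \<noteq> {#}\<close> by auto
  then have "Js ! 0 \<in># B" using Js by (metis nth_mem set_mset_mset)
  then obtain t where t: "t \<in> Js ! 0" "0 \<le> t" using MB unfolding has_barcode_def by blast
  have "carrier (space_at (interval_sum []) t) = {[] :: 'k list}"
    by (auto simp: interval_sum_carrier)
  then have "\<theta> t x = []" if "x \<in> carrier (space_at M t)" for x
    using bij_betwE[OF \<theta>[OF t(2)]] that by simp
  then have M1: "x = y" if "x \<in> carrier (space_at M t)" "y \<in> carrier (space_at M t)" for x y
    using inj_onD[OF bij_betw_imp_inj_on[OF \<theta>[OF t(2)]]] that by simp
  have "x = y" if x: "x \<in> carrier (space_at (interval_sum Js) t)"
      and y: "y \<in> carrier (space_at (interval_sum Js) t)"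
    for x y :: "'k list"
  proof -
    note im = bij_betw_imp_surj_on[OF \<eta>[OF t(2)], symmetric]
    obtain x' where "x' \<in> carrier (space_at M t)" "x = \<eta> t x'" using x unfolding im by (rule imageE)
    moreover obtain y' where "y' \<in> carrier (space_at M t)" "y = \<eta> t y'" using y unfolding im
        by (rule imageE)
    ultimately show ?thesis using M1[of x' y'] by simp
  qed
  from this[OF unit_at_carrier[OF len t(1)] zero_bar_carrier]
  have "unit_at (length Js) 0 ! 0 = replicate (length Js) (0::'k) ! 0" by (simp only:)
  then show False using len by (simp add: unit_at_nth)
qed

text \<open>
  Compare the two decompositions through the generators of the bars of the second one. At each
  time such a generator is a nonzero multiple of the generator of \<open>I\<close>. Two bars alive at the same
  time would make two independent vectors proportional. For two bars alive at times \<open>s\<close> and \<open>t\<close>,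
  \<open>s < t\<close>, the transition map would kill the generator of the first, whereas in \<open>I\<close> it is the
  identity. So there is just one bar, and it is alive exactly when the module is nonzero.
\<close>

lemma single_bar_unique:
  fixes M :: "('k::field, 'v) pers_mod"
  assumes M: "is_pers_mod M" and MI: "has_barcode M {#I#}" and MB: "has_barcode M B"
  shows "B = {#I#}"
proof -
  have "mset Is = {#I#} \<Longrightarrow> Is = [I]" for Is by (cases Is) auto
  then obtain \<theta> :: "real \<Rightarrow> 'v \<Rightarrow> 'k list" where \<theta>:
      "\<And>t. 0 \<le> t \<Longrightarrow> linear_between (space_at M t) (space_at (interval_sum [I]) t) (\<theta> t)"
      "\<And>t. 0 \<le> t \<Longrightarrow> bij_betw (\<theta> t) (carrier (space_at M t)) (carrier (space_at (interval_sum [I]) t))"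
      "\<And>s t x. 0 \<le> s \<Longrightarrow> s \<le> t \<Longrightarrow> x \<in> carrier (space_at M s) \<Longrightarrow>
          \<theta> t (trans_map M s t x) = trans_map (interval_sum [I]) s t (\<theta> s x)"
    using has_barcodeE[OF MI] by metis
  have I: "I \<noteq> {}" "I \<subseteq> {0..}" using MI by (auto simp: has_barcode_def)
  obtain Js and \<eta> :: "real \<Rightarrow> 'v \<Rightarrow> 'k list" where Js: "mset Js = B" and \<eta>:
      "\<And>t. 0 \<le> t \<Longrightarrow> linear_between (space_at M t) (space_at (interval_sum Js) t) (\<eta> t)"
      "\<And>t. 0 \<le> t \<Longrightarrow> bij_betw (\<eta> t) (carrier (space_at M t)) (carrier (space_at (interval_sum Js) t))"
      "\<And>s t x. 0 \<le> s \<Longrightarrow> s \<le> t \<Longrightarrow> x \<in> carrier (space_at M s) \<Longrightarrow>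
          \<eta> t (trans_map M s t x) = trans_map (interval_sum Js) s t (\<eta> s x)"
    using has_barcodeE[OF MB] by metis
  define n where "n = length Js"
  have J: "Js ! i \<noteq> {}" "Js ! i \<subseteq> {0..}" if "i < n" for i
  proof -
    have "Js ! i \<in># B" using Js that unfolding n_def by (metis nth_mem set_mset_mset)
    then show "Js ! i \<noteq> {}" "Js ! i \<subseteq> {0..}" using MB by (auto simp: has_barcode_def)
  qed
  have closed: "r \<odot>\<^bsub>space_at M t\<^esub> x \<in> carrier (space_at M t)"
      "x \<oplus>\<^bsub>space_at M t\<^esub> y \<in> carrier (space_at M t)"
    if "0 \<le> t" "x \<in> carrier (space_at M t)" "y \<in> carrier (space_at M t)" for r t x y
  proof -
    have m: "module scalar_ring (space_at M t)" using M that(1) by (simp add: is_pers_mod_def)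
    show "r \<odot>\<^bsub>space_at M t\<^esub> x \<in> carrier (space_at M t)"
      using module.smult_closed[OF m _ that(2), of r] by (simp add: scalar_ring_def)
    show "x \<oplus>\<^bsub>space_at M t\<^esub> y \<in> carrier (space_at M t)"
      using abelian_monoid.a_closed[OF abelian_group.axioms(1)[OF module.axioms(2)[OF m]] that(2,3)] .
  qed
  have lin: "\<theta> t (r \<odot>\<^bsub>space_at M t\<^esub> x) = [r * \<theta> t x ! 0]"
      "\<theta> t (x \<oplus>\<^bsub>space_at M t\<^esub> y) = [\<theta> t x ! 0 + \<theta> t y ! 0]"
      "\<eta> t (r \<odot>\<^bsub>space_at M t\<^esub> x) = map (\<lambda>i. r * \<eta> t x ! i) [0..<n]"
      "\<eta> t (x \<oplus>\<^bsub>space_at M t\<^esub> y) = map (\<lambda>i. \<eta> t x ! i + \<eta> t y ! i) [0..<n]"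
    if "0 \<le> t" "x \<in> carrier (space_at M t)" "y \<in> carrier (space_at M t)" for r t x y
    using \<theta>(1)[OF that(1)] \<eta>(1)[OF that(1)] that(2,3)
    by (simp_all add: linear_between_def interval_sum_ops n_def)
  have injs: "x = y" if "0 \<le> t" "x \<in> carrier (space_at M t)" "y \<in> carrier (space_at M t)"
      "\<theta> t x = \<theta> t y \<or> \<eta> t x = \<eta> t y" for t x y
    using \<theta>(2)[OF that(1)] \<eta>(2)[OF that(1)] that(2-4) by (auto simp: bij_betw_def inj_on_def)
  have shape: "\<theta> t x = [\<theta> t x ! 0]" "t \<notin> I \<Longrightarrow> \<theta> t x ! 0 = 0" if "0 \<le> t" "x \<in> carrier (space_at M t)"
      for t x
  proof -
    have "\<theta> t x \<in> carrier (space_at (interval_sum [I]) t)"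
      using \<theta>(2)[OF that(1)] that(2) by (auto simp: bij_betw_def)
    then show "\<theta> t x = [\<theta> t x ! 0]" "t \<notin> I \<Longrightarrow> \<theta> t x ! 0 = 0"
      by (auto simp: interval_sum_carrier length_Suc_conv)
  qed
  \<comment> \<open>The vector \<open>a\<close> corresponds to the generator of the bar with index \<open>i\<close>; it is not zero, so \<open>t\<close> lies in \<open>I\<close>.\<close>
  have gen: "\<exists>a\<in>carrier (space_at M t). \<eta> t a = unit_at n i \<and> \<theta> t a ! 0 \<noteq> 0 \<and> t \<in> I"
    if i: "i < n" and t: "t \<in> Js ! i" for i t
  proof -
    have t0: "0 \<le> t" using J(2)[OF i] t by auto
    have "unit_at n i \<in> carrier (space_at (interval_sum Js) t)"
      using unit_at_carrier[of i Js t] i t by (simp add: n_def)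
    then obtain a where a: "a \<in> carrier (space_at M t)" "\<eta> t a = unit_at n i"
      using \<eta>(2)[OF t0] unfolding bij_betw_def by (metis imageE)
    have "\<theta> t a ! 0 \<noteq> 0"
    proof
      assume "\<theta> t a ! 0 = 0"
      then have "\<theta> t (0 \<odot>\<^bsub>space_at M t\<^esub> a) = \<theta> t a"
        using lin(1)[OF t0 a(1) a(1), of 0] shape(1)[OF t0 a(1)] by simp
      then have "0 \<odot>\<^bsub>space_at M t\<^esub> a = a"
        using injs[OF t0 closed(1)[OF t0 a(1) a(1)] a(1)] by blast
      then have "unit_at n i = map (\<lambda>i. 0::'k) [0..<n]" using lin(3)[OF t0 a(1) a(1), of 0] a(2) by simp
      then have "unit_at n i ! i = map (\<lambda>i. 0::'k) [0..<n] ! i" by (simp only:)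
      then show False using i by (simp add: unit_at_nth)
    qed
    moreover from this have "t \<in> I" using shape(2)[OF t0 a(1)] by blast
    ultimately show ?thesis using a by blast
  qed
  have disj: "i = j" if i: "i < n" "t \<in> Js ! i" and j: "j < n" "t \<in> Js ! j" for i j t
  proof (rule ccontr)
    assume ij: "i \<noteq> j"
    have t0: "0 \<le> t" using J(2)[OF i(1)] i(2) by auto
    obtain a where a: "a \<in> carrier (space_at M t)" "\<eta> t a = unit_at n i" "\<theta> t a ! 0 \<noteq> 0"
      using gen[OF i] by blast
    obtain b where b: "b \<in> carrier (space_at M t)" "\<eta> t b = unit_at n j" "\<theta> t b ! 0 \<noteq> 0"
      using gen[OF j] by blast
    let ?\<alpha> = "\<theta> t a ! 0" and ?\<beta> = "\<theta> t b ! 0"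
    \<comment> \<open>The combination \<open>\<beta> a - \<alpha> b\<close> vanishes in the line belonging to \<open>I\<close>, but its coordinate \<open>i\<close> in the second decomposition is \<open>\<beta>\<close>.\<close>
    let ?x = "?\<beta> \<odot>\<^bsub>space_at M t\<^esub> a" and ?y = "(- ?\<alpha>) \<odot>\<^bsub>space_at M t\<^esub> b"
    have xy: "?x \<in> carrier (space_at M t)" "?y \<in> carrier (space_at M t)"
      using closed(1)[OF t0] a b by blast+
    have "\<theta> t (?x \<oplus>\<^bsub>space_at M t\<^esub> ?y) = \<theta> t (0 \<odot>\<^bsub>space_at M t\<^esub> a)"
      using lin(2)[OF t0 xy] lin(1)[OF t0 a(1) a(1)] lin(1)[OF t0 b(1) b(1)] by simp
    then have "?x \<oplus>\<^bsub>space_at M t\<^esub> ?y = 0 \<odot>\<^bsub>space_at M t\<^esub> a"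
      using injs[OF t0 closed(2)[OF t0 xy] closed(1)[OF t0 a(1) a(1)]] by blast
    then have "\<eta> t (?x \<oplus>\<^bsub>space_at M t\<^esub> ?y) ! i = \<eta> t (0 \<odot>\<^bsub>space_at M t\<^esub> a) ! i" by simp
    then show False
      using lin(4)[OF t0 xy] lin(3)[OF t0 a(1) a(1)] lin(3)[OF t0 b(1) b(1)] ij i(1) a b
      by (simp add: unit_at_def)
  qed
  have no_jump: "i = j" if i: "i < n" "s \<in> Js ! i" and j: "j < n" "t \<in> Js ! j" and st: "s \<le> t"
      for i j s t
  proof (rule ccontr)
    assume ij: "i \<noteq> j"
    have s0: "0 \<le> s" using J(2)[OF i(1)] i(2) by auto
    then have t0: "0 \<le> t" using st by simp
    have ti: "t \<notin> Js ! i" using disj[OF i(1) _ j] ij by blast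
    obtain a where a: "a \<in> carrier (space_at M s)" "\<eta> s a = unit_at n i" "\<theta> s a ! 0 \<noteq> 0" "s \<in> I"
      using gen[OF i] by blast
    have tI: "t \<in> I" using gen[OF j] by blast
    let ?b = "trans_map M s t a"
    have b: "?b \<in> carrier (space_at M t)"
    proof -
      have "linear_between (space_at M s) (space_at M t) (trans_map M s t)"
        using M s0 st unfolding is_pers_mod_def by blast
      then show ?thesis using a(1) unfolding linear_between_def by blast
    qed
    have "\<eta> t ?b = map (\<lambda>i. 0) [0..<n]"
      unfolding \<eta>(3)[OF s0 st a(1)] interval_sum_ops a(2) n_def[symmetric]
      using ti by (auto simp: unit_at_def)
    then have "\<eta> t ?b = \<eta> t (0 \<odot>\<^bsub>space_at M t\<^esub> ?b)"
      using lin(3)[OF t0 b b, of 0] by simp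
    then have "?b = 0 \<odot>\<^bsub>space_at M t\<^esub> ?b"
      using injs[OF t0 b closed(1)[OF t0 b b]] by blast
    then have "\<theta> t ?b = [0]" using lin(1)[OF t0 b b, of 0] by simp
    moreover have "\<theta> t ?b = [\<theta> s a ! 0]"
      unfolding \<theta>(3)[OF s0 st a(1)] interval_sum_ops using tI a(4) by simp
    ultimately show False using a(3) by simp
  qed
  have eq: "i = j" if ij: "i < n" "j < n" for i j
  proof -
    obtain s t where st: "s \<in> Js ! i" "t \<in> Js ! j" using J(1)[OF ij(1)] J(1)[OF ij(2)] by blast
    then show ?thesis using no_jump[OF ij(1) st(1) ij(2) st(2)] no_jump[OF ij(2) st(2) ij(1) st(1)]
      by linarith
  qed
  have cover: "\<exists>i<n. t \<in> Js ! i" if t: "t \<in> I" for t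
  proof (rule ccontr)
    assume no: "\<not> (\<exists>i<n. t \<in> Js ! i)"
    have t0: "0 \<le> t" using I(2) t by auto
    have all0: "xs = ys" if "xs \<in> carrier (space_at (interval_sum Js) t)" "ys
        \<in> carrier (space_at (interval_sum Js) t)"
      for xs ys :: "'k list"
      using that no by (auto simp: interval_sum_carrier n_def list_eq_iff_nth_eq)
    have single: "x = y" if "x \<in> carrier (space_at M t)" "y \<in> carrier (space_at M t)" for x y
      using injs[OF t0 that] all0[of "\<eta> t x" "\<eta> t y"] bij_betwE[OF \<eta>(2)[OF t0]] that by simp
    obtain x y where xy: "x \<in> carrier (space_at M t)" "y \<in> carrier (space_at M t)" "\<theta> t x
        = [1]" "\<theta> t y = [0]"
    proof -
      have "[r] \<in> \<theta> t ` carrier (space_at M t)" for r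
        unfolding bij_betw_imp_surj_on[OF \<theta>(2)[OF t0]] using t by (simp add: interval_sum_carrier)
      from this[of 1] this[of 0] show ?thesis by (elim imageE) (rule that, simp_all)
    qed
    show False using single[OF xy(1,2)] xy(3,4) by simp
  qed
  obtain t0 where "t0 \<in> I" using I by blast
  then have "0 < n" using cover by fastforce
  have "n = 1"
    using eq[of 0 1] \<open>0 < n\<close> by (cases "n = 1") auto
  then obtain J0 where J0: "Js = [J0]" unfolding n_def by (auto simp: length_Suc_conv)
  have "J0 = I"
    using gen[of 0] cover \<open>n = 1\<close> by (auto simp: J0)
  then show ?thesis using Js J0 by simp
qed

context circle_points
begin

\<comment> \<open>The degree of the homology has to stay the literal \<open>1\<close> for the rules below to apply.\<close>
declare One_nat_def [simp del]

lemma covers_mono: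
  assumes "covers P s" "0 \<le> s" "s \<le> t" "t < 1"
  shows "covers P t"
proof -
  have "s\<^sup>2 \<le> t\<^sup>2" using assms by (intro power_mono) auto
  then have "sqrt (1 - t\<^sup>2) \<le> sqrt (1 - s\<^sup>2)" by simp
  then show ?thesis using assms(1) unfolding covers_def by (meson order_trans)
qed

definition bar :: "real set" where
  "bar = {t. 0 \<le> t \<and> t < 1 \<and> covers P t}"

lemma is_interval_bar: "is_interval bar"
  unfolding is_interval_1 bar_def using covers_mono by auto

text \<open>
  Below time one \<open>winding_form\<close> is constant on homology classes, so any representative will do.
\<close>

definition class_winding :: "(real^2, 'k::field) coeff_chain set \<Rightarrow> 'k" where
  "class_winding A = winding_form (SOME a. a \<in> A)"

lemma class_winding_class:
  assumes t: "t < 1" and a: "a \<in> coeff_cycles 1 (top_of_set (N t))"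
  shows "class_winding (homologous 1 (top_of_set (N t)) `` {a}) = winding_form a"
proof -
  let ?A = "homologous 1 (top_of_set (N t)) `` {a}"
  have "a \<in> ?A" using a by (simp add: homologous_def coeff_boundaries_closed)
  then have "(SOME a. a \<in> ?A) \<in> ?A" by (rule someI)
  then obtain b where b: "(SOME a. a \<in> ?A) = b" "a - b \<in> coeff_boundaries 1 (top_of_set (N t))"
    by (auto simp: homologous_def)
  have "winding_form a = winding_form (a - b) + winding_form b"
    by (simp flip: winding_form_add)
  also have "winding_form (a - b) = 0"
    using winding_form_boundary[OF b(2)] zero_in_N t by auto
  finally show ?thesis unfolding class_winding_def b(1) by simp
qed

abbreviation "H t \<equiv> homology_space 1 (top_of_set (N t))"

lemma homology_trivial:
  fixes A B :: "(real^2, 'k::field) coeff_chain set"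
  assumes "0 \<le> t" "t \<notin> bar" "A \<in> carrier (H t)" "B \<in> carrier (H t)"
  shows "A = B"
proof -
  have *: "c \<in> coeff_boundaries 1 (top_of_set (N t))" if "c \<in> coeff_cycles 1 (top_of_set (N t))"
    for c :: "(real^2, 'k) coeff_chain"
    using far_acyclic[OF _ that] uncovered_acyclic[OF assms(1) _ _ that] assms(1,2)
    by (cases "t < 1") (auto simp: bar_def)
  from assms(3,4) show ?thesis
    by (elim homology_space_cases) (simp add: homologous_class_eq coeff_boundaries_diff *)
qed

lemma class_winding_linear:
  assumes t: "t < 1" and A: "A \<in> carrier (H t)"
  shows "B \<in> carrier (H t) \<Longrightarrow> class_winding (A \<oplus>\<^bsub>H t\<^esub> B) = class_winding A + class_winding B"
    and "class_winding (r \<odot>\<^bsub>H t\<^esub> A) = r * class_winding A"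
  using A by (auto elim!: homology_space_cases simp: homology_space_ops class_winding_class[OF t]
      coeff_cycles_closed winding_form_add winding_form_scale)

text \<open>
  Injective by \<open>annulus_cycle\<close>, surjective because the circle has winding number one.
\<close>

lemma class_winding_bij:
  assumes t: "t \<in> bar"
  shows "bij_betw class_winding (carrier (H t)) (UNIV :: 'k::field set)"
proof (rule bij_betwI')
  have t': "0 \<le> t" "t < 1" "covers P t" using t by (auto simp: bar_def)
  let ?a = "ln (sqrt (1 - t\<^sup>2))"
  have core: "wrap (Complex ?a y) \<in> N t" for y
    using covers_iff(1)[OF t'(1,2)] t'(3) by blast
  have zero: "0 \<notin> N t" using zero_in_N t'(2) by auto
  fix A B :: "(real^2, 'k) coeff_chain set" assume A: "A \<in> carrier (H t)" and B: "B \<in> carrier (H t)"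
  obtain a where a: "a \<in> coeff_cycles 1 (top_of_set (N t))" "A = homologous 1 (top_of_set (N t)) `` {a}"
    using A by (rule homology_space_cases)
  obtain b where b: "b \<in> coeff_cycles 1 (top_of_set (N t))" "B = homologous 1 (top_of_set (N t)) `` {b}"
    using B by (rule homology_space_cases)
  show "class_winding A = class_winding B \<longleftrightarrow> A = B"
  proof
    assume eq: "class_winding A = class_winding B"
    have ab: "a - b \<in> coeff_cycles 1 (top_of_set (N t))"
      using coeff_cycles_closed(2)[OF a(1) coeff_cycles_closed(3)[OF b(1), of "-1"]]
          by (simp add: scale_minus_one)
    have "winding_form a = winding_form (a - b) + winding_form b"
      by (simp flip: winding_form_add)
    then have "winding_form (a - b) = 0"
      using eq a b by (simp add: class_winding_class t')
    then have "a - b \<in> coeff_boundaries 1 (top_of_set (N t))"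
      using annulus_cycle[OF zero covered_contractible[OF t'] core ab]
          by (simp only: scale_0_left diff_zero)
    then show "A = B" using homologous_class_eq[OF a(1) b(1)] a(2) b(2) by blast
  qed simp
next
  fix r :: 'k
  have t': "0 \<le> t" "t < 1" "covers P t" using t by (auto simp: bar_def)
  let ?a = "ln (sqrt (1 - t\<^sup>2))"
  have core: "wrap (Complex ?a y) \<in> N t" for y
    using covers_iff(1)[OF t'(1,2)] t'(3) by blast
  have c: "scale r (circle_cycle ?a) \<in> coeff_cycles 1 (top_of_set (N t))"
    by (rule coeff_cycles_closed(3)[OF circle_cycle_in[OF core]])
  show "\<exists>A\<in>carrier (H t). r = class_winding A"
    by (rule bexI[of _ "homologous 1 (top_of_set (N t)) `` {scale r (circle_cycle ?a)}"])
       (simp_all only: class_winding_class[OF t'(2) c] winding_form_scale winding_form_circle_cycle mult_1_right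
          homology_space_ops(1)[OF c])
qed simp

text \<open>
  The winding number about the origin does not refer to the neighbourhood. This is why the
  isomorphisms with the field at different times commute with the inclusions.
\<close>

lemma homology_inclusion_winding:
  fixes A :: "(real^2, 'k::field) coeff_chain set"
  assumes st: "s \<le> t" "t < 1" and A: "A \<in> carrier (H s)"
  shows "class_winding (homology_inclusion 1 (top_of_set (N t)) A) = class_winding A"
proof -
  have sub: "N s \<subseteq> N t" using st by (auto simp: closed_nbhd_def)
  show ?thesis
    using A st by (auto elim!: homology_space_cases
      simp: homology_inclusion_class[OF sub] class_winding_class)
qed

lemma class_winding_zero:
  fixes A :: "(real^2, 'k::field) coeff_chain set"
  assumes t: "0 \<le> t" "t < 1" "t \<notin> bar" and A: "A \<in> carrier (H t)"
  shows "class_winding A = 0"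
proof -
  have z: "0 \<in> coeff_cycles 1 (top_of_set (N t))" by (rule coeff_cycles_closed)
  have "A = homologous 1 (top_of_set (N t)) `` {0}"
    by (rule homology_trivial[OF t(1,3) A homology_space_ops(1)[OF z]])
  then show ?thesis using class_winding_class[OF t(2) z] by (simp add: winding_form_0)
qed

lemma homology_nonempty: "carrier (H t) \<noteq> {}"
  using homology_space_ops(1)[OF coeff_cycles_closed(1)] by blast

lemma has_barcode_PH:
  "has_barcode (PH 1 P :: ('k::field, (real^2, 'k) coeff_chain set) pers_mod) (if bar
      = {} then {#} else {#bar#})"
proof -
  let ?M = "PH 1 P :: ('k, (real^2, 'k) coeff_chain set) pers_mod"
  define Is where "Is = (if bar = {} then [] else [bar])"
  define \<theta> :: "real \<Rightarrow> (real^2, 'k) coeff_chain set \<Rightarrow> 'k list" where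
    "\<theta> t A = (if bar = {} then [] else [if t \<in> bar then class_winding A else 0])" for t A
  have M: "space_at ?M t = H t" "trans_map ?M s t = homology_inclusion 1 (top_of_set (N t))" for s t
    by (simp_all add: PH_def)
  have lt1: "t < 1" if "t \<in> bar" for t using that by (simp add: bar_def)
  have lin: "linear_between (space_at ?M t) (space_at (interval_sum Is) t) (\<theta> t)" for t
    unfolding linear_between_def M interval_sum_ops
    by (auto simp: interval_sum_carrier \<theta>_def Is_def class_winding_linear lt1)
  have bij: "bij_betw (\<theta> t) (carrier (space_at ?M t)) (carrier (space_at (interval_sum Is) t))"
      if t: "0 \<le> t" for t
  proof (cases "t \<in> bar")
    case True
    then have eq: "\<theta> t = (\<lambda>x. [x]) \<circ> class_winding" "Is = [bar]"
      by (auto simp: \<theta>_def Is_def fun_eq_iff)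
    have "carrier (space_at (interval_sum [bar]) t) = range (\<lambda>x::'k. [x])"
      using True by (auto simp: interval_sum_carrier length_Suc_conv)
    then have "bij_betw (\<lambda>x::'k. [x]) UNIV (carrier (space_at (interval_sum [bar]) t))"
      by (auto simp: bij_betw_def inj_on_def)
    from bij_betw_trans[OF class_winding_bij[OF True] this] show ?thesis
      unfolding eq M .
  next
    case False
    have "\<theta> t A = replicate (length Is) 0" for A using False by (auto simp: \<theta>_def Is_def)
    moreover have "carrier (space_at (interval_sum Is) t) = {replicate (length Is) (0::'k)}"
      using False by (auto simp: interval_sum_carrier Is_def length_Suc_conv)
    ultimately show ?thesis
      unfolding M using homology_trivial[OF t False] homology_nonempty[of t]
      by (auto simp: bij_betw_def inj_on_def)
  qed
  have nat: "\<theta> t (trans_map ?M s t A) = trans_map (interval_sum Is) s t (\<theta> s A)"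
    if st: "0 \<le> s" "s \<le> t" and A: "A \<in> carrier (space_at ?M s)" for s t A
  proof -
    have A': "A \<in> carrier (H s)" using A by (simp add: M)
    have "class_winding A = 0" if "t \<in> bar" "s \<notin> bar"
      using class_winding_zero[OF st(1) _ that(2) A'] st lt1[OF that(1)] by simp
    then show ?thesis
      unfolding M interval_sum_ops using homology_inclusion_winding[OF st(2) _ A'] lt1
      by (auto simp: \<theta>_def Is_def)
  qed
  have "pers_iso ?M (interval_sum Is)"
    unfolding pers_iso_def using lin bij nat by blast
  moreover have "mset Is = (if bar = {} then {#} else {#bar#})" by (simp add: Is_def)
  ultimately have "\<exists>Is. mset Is = (if bar = {} then {#} else {#bar#})
      \<and> pers_iso ?M (pers_sum (map interval_mod Is))"
    unfolding interval_sum_def by blast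
  moreover have "bar \<subseteq> {0..}" by (auto simp: bar_def)
  then have "\<forall>J\<in>#(if bar = {} then {#} else {#bar#}). is_interval J \<and> J \<noteq> {} \<and> J \<subseteq> {0..}"
    using is_interval_bar by simp
  ultimately show ?thesis unfolding has_barcode_def by blast
qed

lemma beta1_eq: "beta1 TYPE('k::field) P = (if bar = {} then {#} else {#bar#})"
  unfolding beta1_def barcode_def
proof (rule the_equality)
  let ?M = "PH 1 P :: ('k, (real^2, 'k) coeff_chain set) pers_mod"
  show "has_barcode ?M (if bar = {} then {#} else {#bar#})" by (rule has_barcode_PH)
  fix B assume "has_barcode ?M B"
  then show "B = (if bar = {} then {#} else {#bar#})"
    using has_barcode_PH[where 'k = 'k] no_bar_unique[of ?M B] single_bar_unique[OF is_pers_mod_PH, of 1 P bar B]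
    by (auto split: if_splits)
qed

text \<open>
  If no bar exists, both sides are zero, so no distinction of cases remains.
\<close>

theorem bar_length_beta1: "bar_length (beta1 TYPE('k::field) P) = measure lborel {t. 0 \<le> t \<and> t < 1
    \<and> covers P t}"
  by (auto simp: beta1_eq bar_length_def simp flip: bar_def)

end

section \<open>Gaps between uniform points in an interval\<close>

text \<open>
  The truncated power of spline theory, with value \<open>0\<close> at \<open>0\<close> for all exponents: at exponent \<open>0\<close>
  this makes \<open>1 - plus_pow 0 (L - g)\<close> the indicator of \<open>L \<le> g\<close>.
\<close>

definition plus_pow :: "nat \<Rightarrow> real \<Rightarrow> real" where
  "plus_pow m x = (if 0 < x then x ^ m else 0)"

lemma plus_pow_measurable [measurable]: "plus_pow m \<in> borel_measurable borel"
  unfolding plus_pow_def[abs_def] by measurable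

lemma plus_pow_continuous: "continuous_on S (plus_pow (Suc m))"
proof -
  have "plus_pow (Suc m) = (\<lambda>x. (max 0 x) ^ Suc m)"
    by (auto simp: plus_pow_def fun_eq_iff max_def)
  then show ?thesis by (simp only:) (intro continuous_intros)
qed

lemma plus_pow_deriv:
  assumes "x \<noteq> 0"
  shows "(plus_pow (Suc m) has_real_derivative real (Suc m) * plus_pow m x) (at x)"
proof (cases "0 < x")
  case True
  have "((\<lambda>x. x ^ Suc m) has_real_derivative real (Suc m) * x ^ m) (at x)"
    using DERIV_pow[of "Suc m" x] by simp
  then have "(plus_pow (Suc m) has_real_derivative real (Suc m) * x ^ m) (at x)"
    by (rule DERIV_cong_ev[THEN iffD1, rotated -1])
       (use True eventually_gt_at_top in \<open>auto simp: plus_pow_def eventually_nhds intro!: exI[of _ "{0<..}"]\<close>)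
  then show ?thesis using True by (simp add: plus_pow_def)
next
  case False
  with assms have x: "x < 0" by simp
  have "((\<lambda>x. 0) has_real_derivative 0) (at x)" by simp
  then have "(plus_pow (Suc m) has_real_derivative 0) (at x)"
    by (rule DERIV_cong_ev[THEN iffD1, rotated -1])
       (use x in \<open>auto simp: plus_pow_def eventually_nhds intro!: exI[of _ "{..<0}"]\<close>)
  then show ?thesis using x by (simp add: plus_pow_def)
qed

text \<open>
  For positive \<open>g\<close> and \<open>L\<close>: the measure of the configurations of \<open>m\<close> points in an interval of
  length \<open>L\<close> that divide it into \<open>m + 1\<close> gaps of length at most \<open>g\<close> each.
\<close>

definition spacing_poly :: "real \<Rightarrow> nat \<Rightarrow> real \<Rightarrow> real" where
  "spacing_poly g m L = (\<Sum>k\<le>Suc m. (-1) ^ k * real (Suc m choose k) * plus_pow m (L - real k * g))"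

lemma spacing_poly_measurable [measurable]: "spacing_poly g m \<in> borel_measurable borel"
  unfolding spacing_poly_def[abs_def] by measurable

lemma spacing_poly_nonpos: "0 < g \<Longrightarrow> L \<le> 0 \<Longrightarrow> spacing_poly g m L = 0"
  unfolding spacing_poly_def
proof (rule sum.neutral, rule ballI)
  fix k assume "0 < g" "L \<le> 0"
  then have "L - real k * g \<le> 0" by (simp add: mult_nonneg_nonneg le_diff_eq)
      (meson less_imp_le mult_nonneg_nonneg of_nat_0_le_iff order_trans)
  then show "(-1) ^ k * real (Suc m choose k) * plus_pow m (L - real k * g) = 0"
    by (simp add: plus_pow_def)
qed

text \<open>
  Summation by parts with the rule of Pascal.
\<close>

lemma pascal_difference:
  fixes p :: "nat \<Rightarrow> real"
  shows "(\<Sum>k\<le>n. (-1) ^ k * real (n choose k) * (p k - p (Suc k))) =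
    (\<Sum>k\<le>Suc n. (-1) ^ k * real (Suc n choose k) * p k)"
proof -
  have "(\<Sum>k\<le>Suc n. (-1) ^ k * real (Suc n choose k) * p k) =
      p 0 + (\<Sum>k\<le>n. (-1) ^ Suc k * real (Suc n choose Suc k) * p (Suc k))"
    by (subst sum.atMost_Suc_shift) simp
  also have "\<dots> = p 0 + (\<Sum>k\<le>n. (-1) ^ Suc k * real (n choose Suc k) * p (Suc k)) -
      (\<Sum>k\<le>n. (-1) ^ k * real (n choose k) * p (Suc k))"
    by (simp add: sum.distrib[symmetric] sum_subtractf[symmetric] algebra_simps)
  also have "p 0 + (\<Sum>k\<le>n. (-1) ^ Suc k * real (n choose Suc k) * p (Suc k)) =
      (\<Sum>k\<le>Suc n. (-1) ^ k * real (n choose k) * p k)"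
    using sum.atMost_Suc_shift[of "\<lambda>k. (-1) ^ k * real (n choose k) * p k" n] by simp
  also have "\<dots> = (\<Sum>k\<le>n. (-1) ^ k * real (n choose k) * p k)" by simp
  finally show ?thesis by (simp add: right_diff_distrib sum_subtractf)
qed

text \<open>
  The recursion in the number of points, with \<open>x\<close> in the role of the first point: one antiderivative
  of the truncated powers, then \<open>pascal_difference\<close>.
\<close>

lemma spacing_poly_integral:
  assumes g: "0 < g"
  shows "((\<lambda>x. spacing_poly g m (b - x)) has_integral spacing_poly g (Suc m) (b - a) / real (Suc m)) {a..a + g}"
proof -
  define F where "F x = - (\<Sum>k\<le>Suc m. (-1) ^ k * real (Suc m choose k) *
      plus_pow (Suc m) (b - x - real k * g)) / real (Suc m)" for x
  have "((\<lambda>x. spacing_poly g m (b - x)) has_integral F (a + g) - F a) {a..a + g}"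
  proof (rule fundamental_theorem_of_calculus_strong)
    \<comment> \<open>For \<open>m = 0\<close> the antiderivative has kinks at these points.\<close>
    show "finite ((\<lambda>k. b - real k * g) ` {..Suc m})" by simp
    show "a \<le> a + g" using g by simp
    show "continuous_on {a..a + g} F"
      unfolding F_def by (intro continuous_intros continuous_on_compose2[OF plus_pow_continuous[of UNIV]]) auto
    fix x assume x: "x \<in> {a..a + g} - (\<lambda>k. b - real k * g) ` {..Suc m}"
    have "((\<lambda>x. plus_pow (Suc m) (b - x - real k * g)) has_real_derivative
        (real (Suc m) * plus_pow m (b - x - real k * g)) * (- 1)) (at x)" if "k \<in> {..Suc m}" for k
    proof (rule DERIV_chain2[where g = "\<lambda>x. b - x - real k * g"])
      show "(plus_pow (Suc m) has_real_derivative real (Suc m) * plus_pow m (b - x - real k * g))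
          (at (b - x - real k * g))"
        using x that by (intro plus_pow_deriv) (auto simp: algebra_simps)
      show "((\<lambda>x. b - x - real k * g) has_real_derivative - 1) (at x)"
        by (auto intro!: derivative_eq_intros)
    qed
    then have "((\<lambda>x. \<Sum>k\<le>Suc m. (-1) ^ k * real (Suc m choose k) * plus_pow (Suc m) (b - x - real k * g))
      has_real_derivative (\<Sum>k\<le>Suc m. (-1) ^ k * real (Suc m choose k) *
        ((real (Suc m) * plus_pow m (b - x - real k * g)) * (- 1)))) (at x)"
      by (intro DERIV_sum DERIV_cmult) auto
    then have "(F has_real_derivative - (\<Sum>k\<le>Suc m. (-1) ^ k * real (Suc m choose k) *
        ((real (Suc m) * plus_pow m (b - x - real k * g)) * (- 1))) / real (Suc m)) (at x)"
      unfolding F_def by (intro DERIV_cdivide DERIV_minus)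
    also have "- (\<Sum>k\<le>Suc m. (-1) ^ k * real (Suc m choose k) *
        ((real (Suc m) * plus_pow m (b - x - real k * g)) * (- 1))) / real (Suc m) = spacing_poly g m (b - x)"
      unfolding spacing_poly_def sum_negf[symmetric] sum_divide_distrib by (intro sum.cong) simp_all
    finally show "(F has_vector_derivative spacing_poly g m (b - x)) (at x)"
      by (simp add: has_real_derivative_iff_has_vector_derivative)
  qed
  also have "F (a + g) - F a = (\<Sum>k\<le>Suc m. (-1) ^ k * real (Suc m choose k) *
      (plus_pow (Suc m) (b - a - real k * g) - plus_pow (Suc m) (b - a - real (Suc k) * g))) / real (Suc m)"
  proof -
    have shift: "b - (a + g) - real k * g = b - a - real (Suc k) * g" for k
      by (simp add: algebra_simps)
    show ?thesis
      unfolding F_def shift right_diff_distrib sum_subtractf diff_divide_distrib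
      by (simp del: sum.atMost_Suc)
  qed
  also have "\<dots> = spacing_poly g (Suc m) (b - a) / real (Suc m)"
    using pascal_difference[of "Suc m" "\<lambda>k. plus_pow (Suc m) (b - a - real k * g)"]
    by (simp only: spacing_poly_def)
  finally show ?thesis .
qed

text \<open>
  Consecutive points among \<open>a\<close>, the \<open>u i\<close> and \<open>b\<close> are at most \<open>g\<close> apart. Without sorting the
  points, this says that every one of them that is farther than \<open>g\<close> from \<open>b\<close> is followed by
  another one at distance at most \<open>g\<close>.
\<close>

definition spaced :: "real \<Rightarrow> real \<Rightarrow> 'i set \<Rightarrow> real \<Rightarrow> ('i \<Rightarrow> real) \<Rightarrow> bool" where
  "spaced g b I a u \<longleftrightarrow> (\<forall>i\<in>I. a < u i \<and> u i \<le> b) \<and> (\<forall>i\<in>I. \<forall>j\<in>I. u i = u j \<longrightarrow> i = j) \<and>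
     (b - g \<le> a \<or> (\<exists>j\<in>I. a < u j \<and> u j \<le> a + g)) \<and>
     (\<forall>i\<in>I. b - g \<le> u i \<or> (\<exists>j\<in>I. u i < u j \<and> u j \<le> u i + g))"

lemma spaced_cong: "(\<And>i. i \<in> I \<Longrightarrow> u i = v i) \<Longrightarrow> spaced g b I a u \<longleftrightarrow> spaced g b I a v"
  by (simp add: spaced_def)

text \<open>
  The index \<open>i\<close> is that of the smallest point; it is unique because the points are distinct.
\<close>

lemma spaced_first:
  assumes I: "finite I" "I \<noteq> {}" and g: "0 < g"
  shows "spaced g b I a u \<longleftrightarrow> (\<exists>i\<in>I. a < u i \<and> u i \<le> b \<and> u i \<le> a + g \<and> spaced g b (I - {i}) (u i) u)"
proof
  assume s: "spaced g b I a u"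
  obtain i where i: "i \<in> I" "\<And>j. j \<in> I \<Longrightarrow> u i \<le> u j"
  proof -
    have "Min (u ` I) \<in> u ` I" using I by (intro Min_in) auto
    then obtain i where "i \<in> I" "Min (u ` I) = u i" by auto
    moreover from this have "u i \<le> u j" if "j \<in> I" for j using that I Min_le[of "u ` I" "u j"] by simp
    ultimately show ?thesis using that by blast
  qed
  have bounds: "a < u j" "u j \<le> b" if "j \<in> I" for j using s that by (auto simp: spaced_def)
  have inj: "j = k" if "j \<in> I" "k \<in> I" "u j = u k" for j k using s that by (auto simp: spaced_def)
  have first: "u i < u j" if "j \<in> I - {i}" for j
    using i(2)[of j] inj[of i j] i(1) that by force
  have "u i \<le> a + g"
  proof (cases "b - g \<le> a")
    case True
    then show ?thesis using bounds(2)[OF i(1)] by simp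
  next
    case False
    then obtain j where "j \<in> I" "u j \<le> a + g" using s by (auto simp: spaced_def)
    then show ?thesis using i(2)[of j] by simp
  qed
  moreover have next_point: "b - g \<le> u k \<or> (\<exists>j\<in>I - {i}. u k < u j \<and> u j \<le> u k + g)" if k: "k \<in> I" for k
  proof (cases "b - g \<le> u k")
    case False
    then obtain j where j: "j \<in> I" "u k < u j" "u j \<le> u k + g"
      using s k unfolding spaced_def by blast
    then have "j \<noteq> i" using i(2)[OF k] by auto
    with j show ?thesis by blast
  qed simp
  have "spaced g b (I - {i}) (u i) u"
    unfolding spaced_def using first bounds(2) inj next_point i(1) by blast
  ultimately show "\<exists>i\<in>I. a < u i \<and> u i \<le> b \<and> u i \<le> a + g \<and> spaced g b (I - {i}) (u i) u"
    using i(1) bounds by blast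
next
  assume "\<exists>i\<in>I. a < u i \<and> u i \<le> b \<and> u i \<le> a + g \<and> spaced g b (I - {i}) (u i) u"
  then obtain i where i: "i \<in> I" "a < u i" "u i \<le> b" "u i \<le> a + g" "spaced g b (I - {i}) (u i) u"
      by blast
  then have gt: "u i < u j" "u j \<le> b" if "j \<in> I" "j \<noteq> i" for j using that by (auto simp: spaced_def)
  show "spaced g b I a u"
    unfolding spaced_def
  proof (intro conjI ballI impI)
    fix j assume j: "j \<in> I"
    show "a < u j" "u j \<le> b" using gt[of j] i j by (cases "j = i"; force)+
    show "b - g \<le> u j \<or> (\<exists>k\<in>I. u j < u k \<and> u k \<le> u j + g)"
      using i(5) j by (cases "j = i") (auto simp: spaced_def)
    fix k assume k: "k \<in> I" "u j = u k"
    show "j = k" using i(5) j k gt[of j] gt[of k]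
        by (cases "j = i"; cases "k = i") (auto simp: spaced_def)
  next
    show "b - g \<le> a \<or> (\<exists>j\<in>I. a < u j \<and> u j \<le> a + g)" using i by blast
  qed
qed

lemma spaced_measurable:
  assumes [measurable]: "a \<in> borel_measurable M" "\<And>i. i \<in> I \<Longrightarrow> (\<lambda>u. f u i) \<in> borel_measurable M"
      and [simp]: "finite I"
  shows "Measurable.pred M (\<lambda>u. spaced g b I (a u) (f u))"
  unfolding spaced_def by measurable

text \<open>
  By \<open>spaced_first\<close> the event is a disjoint union over the index of the first point. Once this point
  is placed at \<open>x\<close> between \<open>a\<close> and \<open>a + g\<close>, the remaining ones have to be spaced in the interval from
  \<open>x\<close> to \<open>b\<close>, which is an event of the same form with one point less. Keeping \<open>b\<close> fixed and
  letting \<open>a\<close> vary means that no measure has to be translated.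
\<close>

lemma spaced_probability:
  fixes b :: real and I :: "'i set"
  defines "U \<equiv> uniform_measure lborel {b - 1<..b}"
  assumes "finite I" and g: "0 < g" and a: "b - 1 \<le> a" "a < b"
  shows "measure (PiM I (\<lambda>_. U)) {u \<in> space (PiM I (\<lambda>_. U)). spaced g b I a u}
      = spacing_poly g (card I) (b - a)"
  using assms(2) a
proof (induction "card I" arbitrary: I a)
  case 0
  then have I: "I = {}" by simp
  show ?case
    using 0 by (simp add: I space_PiM PiM_empty spaced_def measure_def emeasure_count_space spacing_poly_def plus_pow_def)
next
  case (Suc m)
  interpret U: prob_space U
    unfolding U_def by (rule prob_space_uniform_measure) auto
  interpret P: product_sigma_finite "\<lambda>_::'i. U"
    by unfold_locales
  have setsU [measurable_cong, simp]: "sets U = sets borel" by (simp add: U_def)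
  have probP: "prob_space (PiM J (\<lambda>_. U))" for J :: "'i set"
    by (intro prob_space_PiM U.prob_space_axioms)
  define T where "T i = {u \<in> space (PiM I (\<lambda>_. U)). a < u i \<and> u i \<le> b \<and> u i \<le> a + g \<and>
      spaced g b (I - {i}) (u i) u}" for i
  have I: "finite I" "I \<noteq> {}" using Suc by auto
  have Tmeas: "T i \<in> sets (PiM I (\<lambda>_. U))" if i: "i \<in> I" for i
  proof -
    have [measurable]: "(\<lambda>u. u j) \<in> borel_measurable (PiM I (\<lambda>_. U))" if "j \<in> I" for j
      using measurable_component_singleton[OF that, of "\<lambda>_. U"] by (simp cong: measurable_cong_sets)
    have [measurable]: "Measurable.pred (PiM I (\<lambda>_. U)) (\<lambda>u. spaced g b (I - {i}) (u i) u)"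
      using i I by (intro spaced_measurable) auto
    show ?thesis unfolding T_def using i by measurable
  qed
  have Tval: "measure (PiM I (\<lambda>_. U)) (T i) = spacing_poly g (Suc m) (b - a) / real (Suc m)"
      if i: "i \<in> I" for i
  proof -
    define J where "J = I - {i}"
    have J: "finite J" "i \<notin> J" "I = insert i J" "card J = m"
      using I i Suc(2) by (auto simp: J_def)
    have IH: "measure (PiM J (\<lambda>_. U)) {u \<in> space (PiM J (\<lambda>_. U)). spaced g b J x u}
        = spacing_poly g m (b - x)"
      if "b - 1 \<le> x" "x < b" for x
      using Suc.hyps(1)[of J x] J that by simp
    have nonneg: "0 \<le> spacing_poly g m (b - x)" if "b - 1 \<le> x" for x
    proof (cases "x < b")
      case True
      show ?thesis unfolding IH[OF that True, symmetric] by simp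
    qed (use g spacing_poly_nonpos in simp)
    have TI [measurable]: "T i \<in> sets (PiM (insert i J) (\<lambda>_. U))" using Tmeas[OF i] J(3) by simp
    have "emeasure (PiM I (\<lambda>_. U)) (T i) = (\<integral>\<^sup>+u. indicator (T i) u \<partial>PiM (insert i J) (\<lambda>_. U))"
      unfolding J(3) by simp
    also have "\<dots> = (\<integral>\<^sup>+x. (\<integral>\<^sup>+u. indicator (T i) (u(i := x)) \<partial>PiM J (\<lambda>_. U)) \<partial>U)"
      by (rule P.product_nn_integral_insert_rev) (use J in auto)
    also have "\<dots> = (\<integral>\<^sup>+x. indicator {a<..a + g} x * (indicator {..b} x *
        emeasure (PiM J (\<lambda>_. U)) {u \<in> space (PiM J (\<lambda>_. U)). spaced g b J x u}) \<partial>U)"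
    proof (rule nn_integral_cong)
      fix x
      have "(\<integral>\<^sup>+u. indicator (T i) (u(i := x)) \<partial>PiM J (\<lambda>_. U)) =
          (\<integral>\<^sup>+u. indicator {a<..a + g} x * indicator {..b} x *
             indicator {u \<in> space (PiM J (\<lambda>_. U)). spaced g b J x u} u \<partial>PiM J (\<lambda>_. U))"
      proof (rule nn_integral_cong)
        fix u assume u: "u \<in> space (PiM J (\<lambda>_. U))"
        have "u(i := x) \<in> space (PiM I (\<lambda>_. U))"
          using u unfolding J(3) by (auto simp: space_PiM U_def PiE_def extensional_def)
        moreover have "spaced g b J x (u(i := x)) \<longleftrightarrow> spaced g b J x u"
          using J(2) by (intro spaced_cong) auto
        ultimately show "indicator (T i) (u(i := x)) = (indicator {a<..a + g} x * indicator {..b} x *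
             indicator {u \<in> space (PiM J (\<lambda>_. U)). spaced g b J x u} u :: ennreal)"
          using u by (auto simp: T_def J_def[symmetric] indicator_def)
      qed
      also have "\<dots> = indicator {a<..a + g} x * indicator {..b} x *
          emeasure (PiM J (\<lambda>_. U)) {u \<in> space (PiM J (\<lambda>_. U)). spaced g b J x u}"
      proof -
        have [measurable]: "(\<lambda>u. u j) \<in> borel_measurable (PiM J (\<lambda>_. U))" if "j \<in> J" for j
          using measurable_component_singleton[OF that, of "\<lambda>_. U"] by (simp cong: measurable_cong_sets)
        have [measurable]: "Measurable.pred (PiM J (\<lambda>_. U)) (\<lambda>u. spaced g b J x u)"
          using J by (intro spaced_measurable) auto
        show ?thesis by (subst nn_integral_cmult_indicator) auto
      qed
      finally show "(\<integral>\<^sup>+u. indicator (T i) (u(i := x)) \<partial>PiM J (\<lambda>_. U))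
          = indicator {a<..a + g} x * (indicator {..b} x *
          emeasure (PiM J (\<lambda>_. U)) {u \<in> space (PiM J (\<lambda>_. U)). spaced g b J x u})"
        by (simp add: mult.assoc)
    qed
    also have "\<dots> = (\<integral>\<^sup>+x. ennreal (spacing_poly g m (b - x)) * indicator {a..a + g} x \<partial>lborel)"
    proof -
      have "(\<integral>\<^sup>+x. indicator {a<..a + g} x * (indicator {..b} x *
          emeasure (PiM J (\<lambda>_. U)) {u \<in> space (PiM J (\<lambda>_. U)). spaced g b J x u}) \<partial>U) =
        (\<integral>\<^sup>+x. indicator {a<..a + g} x * ennreal (spacing_poly g m (b - x)) \<partial>U)"
      proof (rule nn_integral_cong_AE)
        have "AE x in lborel. x \<noteq> b" by (rule AE_lborel_singleton)
        then have "AE x in U. x \<noteq> b" unfolding U_def by (intro AE_uniform_measureI) auto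
        then show "AE x in U. indicator {a<..a + g} x * (indicator {..b} x *
            emeasure (PiM J (\<lambda>_. U)) {u \<in> space (PiM J (\<lambda>_. U)). spaced g b J x u}) =
            indicator {a<..a + g} x * ennreal (spacing_poly g m (b - x))"
        proof eventually_elim
          case (elim x)
          interpret PJ: prob_space "PiM J (\<lambda>_. U)" by (rule probP)
          show ?case
          proof (cases "a < x \<and> x < b")
            case True
            then show ?thesis using IH[of x] Suc.prems
                by (simp add: PJ.emeasure_eq_measure indicator_def)
          next
            case False
            then show ?thesis using elim spacing_poly_nonpos[OF g, of "b - x" m]
                by (auto simp: indicator_def)
          qed
        qed
      qed
      also have "\<dots> = (\<integral>\<^sup>+x. indicator {a<..a + g} x * ennreal (spacing_poly g m (b - x)) * indicator {b - 1<..b} x \<partial>lborel)"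
        unfolding U_def by (subst nn_integral_uniform_measure) (auto simp: divide_ennreal_def)
      also have "\<dots> = (\<integral>\<^sup>+x. ennreal (spacing_poly g m (b - x)) * indicator {a..a + g} x \<partial>lborel)"
      proof (rule nn_integral_cong_AE)
        have "AE x in lborel. x \<noteq> a" by (rule AE_lborel_singleton)
        then show "AE x in lborel. indicator {a<..a + g} x * ennreal (spacing_poly g m (b - x)) * indicator {b - 1<..b} x =
            ennreal (spacing_poly g m (b - x)) * indicator {a..a + g} x"
        proof eventually_elim
          case (elim x)
          then show ?case using Suc.prems spacing_poly_nonpos[OF g, of "b - x" m]
            by (auto simp: indicator_def)
        qed
      qed
      finally show ?thesis .
    qed
    also have "\<dots> = ennreal (spacing_poly g (Suc m) (b - a) / real (Suc m))"
      by (rule nn_integral_has_integral_lebesgue'[OF _ spacing_poly_integral[OF g]])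
         (use nonneg Suc.prems in auto)
    finally have em: "emeasure (PiM I (\<lambda>_. U)) (T i)
        = ennreal (spacing_poly g (Suc m) (b - a) / real (Suc m))" .
    have "0 \<le> spacing_poly g (Suc m) (b - a) / real (Suc m)"
      using has_integral_nonneg[OF spacing_poly_integral[OF g]] nonneg Suc.prems by auto
    then show ?thesis using em by (simp add: measure_def)
  qed
  interpret PI: prob_space "PiM I (\<lambda>_. U)" by (rule probP)
  have "{u \<in> space (PiM I (\<lambda>_. U)). spaced g b I a u} = (\<Union>i\<in>I. T i)"
    using spaced_first[OF I g] by (auto simp: T_def)
  moreover have "disjoint_family_on T I"
    unfolding disjoint_family_on_def
  proof (intro ballI impI)
    fix i j assume ij: "i \<in> I" "j \<in> I" "i \<noteq> j"
    show "T i \<inter> T j = {}"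
    proof (rule equals0I)
      fix u assume "u \<in> T i \<inter> T j"
      then have "u i < u j" "u j < u i" using ij by (auto simp: T_def spaced_def)
      then show False by simp
    qed
  qed
  ultimately have "measure (PiM I (\<lambda>_. U)) {u \<in> space (PiM I (\<lambda>_. U)). spaced g b I a u}
      = (\<Sum>i\<in>I. measure (PiM I (\<lambda>_. U)) (T i))"
    using Tmeas I by (simp add: PI.finite_measure_finite_Union image_subset_iff)
  also have "\<dots> = spacing_poly g (card I) (b - a)"
    using Suc(2) by (simp add: Tval)
  finally show ?case .
qed

section \<open>Covering the circle by arcs around uniform points\<close>

declare One_nat_def [simp]

definition unit_pt :: "real \<Rightarrow> real^2" where
  "unit_pt s = circle_dir (2 * pi * s)"

lemma continuous_circle_dir: "continuous_on S circle_dir"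
proof -
  have "circle_dir s = wrap (Complex 0 s)" for s by (simp add: wrap_polar)
  then have eq: "circle_dir = (\<lambda>s. wrap (of_real s * \<i>))"
      by (simp add: fun_eq_iff Complex_eq mult.commute)
  show ?thesis unfolding eq by (intro continuous_intros)
qed

lemma unit_pt_measurable [measurable]: "unit_pt \<in> borel \<rightarrow>\<^sub>M circle_borel"
proof -
  have "continuous_on UNIV unit_pt"
    unfolding unit_pt_def[abs_def]
    by (intro continuous_on_compose2[OF continuous_circle_dir[of UNIV]] continuous_intros) auto
  then have "unit_pt \<in> borel \<rightarrow>\<^sub>M borel" by (rule borel_measurable_continuous_onI)
  then show ?thesis
    unfolding circle_borel_def
        by (rule measurable_restrict_space2[rotated]) (simp add: unit_pt_def circle_dir_in)
qed

lemma unit_pt_periodic: "unit_pt (s + of_int k) = unit_pt s"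
proof -
  have eq: "unit_pt s = wrap (Complex 0 (2 * pi * s))" for s by (simp add: unit_pt_def wrap_polar)
  have "Complex 0 (2 * pi * (s + of_int k)) = Complex 0 (2 * pi * s) + turns k"
    by (simp add: complex_eq_iff algebra_simps)
  then show ?thesis by (simp only: eq wrap_turns)
qed

lemma emeasure_shift:
  assumes [measurable]: "B \<in> sets borel" and per: "\<And>s. s + c \<in> B \<longleftrightarrow> s \<in> B"
  shows "emeasure lborel (B \<inter> {p + c<..q + c}) = emeasure lborel (B \<inter> {p<..q :: real})"
proof -
  have "emeasure lborel (B \<inter> {p + c<..q + c}) = (\<integral>\<^sup>+s. indicator (B \<inter> {p + c<..q + c}) s \<partial>lborel)"
    by simp
  also have "\<dots> = ennreal \<bar>1\<bar> * (\<integral>\<^sup>+s. indicator (B \<inter> {p + c<..q + c}) (c + 1 * s) \<partial>lborel)"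
    by (rule nn_integral_real_affine) auto
  also have "(\<lambda>s. indicator (B \<inter> {p + c<..q + c}) (c + 1 * s) :: ennreal) = indicator (B \<inter> {p<..q})"
    using per by (auto simp: fun_eq_iff indicator_def add.commute)
  finally show ?thesis by simp
qed

text \<open>
  A periodic set has the same measure in all intervals whose length is the period.
\<close>

lemma emeasure_period:
  assumes [measurable]: "B \<in> sets borel" and per: "\<And>s (k::int). s + of_int k \<in> B \<longleftrightarrow> s \<in> B"
  shows "emeasure lborel (B \<inter> {b - 1<..b}) = emeasure lborel (B \<inter> {0..<1::real})"
proof -
  define y where "y = frac b"
  have y: "0 \<le> y" "y < 1" by (simp_all add: y_def frac_lt_1)
  have b: "b = y + of_int \<lfloor>b\<rfloor>" by (simp add: y_def frac_def)
  have "emeasure lborel (B \<inter> {b - 1<..b}) = emeasure lborel (B \<inter> {y - 1<..y})"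
    using emeasure_shift[OF assms(1) per, of "y - 1" "\<lfloor>b\<rfloor>" y] b by (simp add: algebra_simps)
  also have "\<dots> = emeasure lborel (B \<inter> {y - 1<..0}) + emeasure lborel (B \<inter> {0<..y})"
    using y by (subst plus_emeasure) (auto intro!: arg_cong[where f = "emeasure lborel"])
  also have "emeasure lborel (B \<inter> {y - 1<..0}) = emeasure lborel (B \<inter> {y<..1})"
    using emeasure_shift[OF assms(1) per, of "y - 1" 1 0] by simp
  also have "emeasure lborel (B \<inter> {y<..1}) + emeasure lborel (B \<inter> {0<..y})
      = emeasure lborel (B \<inter> {0<..1})"
    using y by (subst plus_emeasure) (auto intro!: arg_cong[where f = "emeasure lborel"])
  also have "\<dots> = emeasure lborel (B \<inter> {0..<1})"
  proof (rule emeasure_eq_AE)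
    have "AE x in lborel. x \<noteq> 0 \<and> x \<noteq> (1::real)"
      using AE_lborel_singleton[of 0] AE_lborel_singleton[of "1::real"] by eventually_elim simp
    then show "AE x in lborel. x \<in> B \<inter> {0<..1} \<longleftrightarrow> x \<in> B \<inter> {0..<1}"
      by eventually_elim auto
  qed auto
  finally show ?thesis .
qed

abbreviation unif :: "real \<Rightarrow> real measure" where
  "unif b \<equiv> uniform_measure lborel {b - 1<..b}"

lemma prob_space_unif: "prob_space (unif b)"
  by (rule prob_space_uniform_measure) auto

text \<open>
  Rotation invariance: the angles may be drawn from any interval of length one. If this interval
  starts at one of the points, gaps on the circle become gaps in the interval.
\<close>

lemma circle_uniform_unif: "circle_uniform = distr (unif b) circle_borel unit_pt"
proof (rule measure_eqI)
  show "sets circle_uniform = sets (distr (unif b) circle_borel unit_pt)"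
    by (simp add: circle_uniform_def)
  fix A assume "A \<in> sets circle_uniform"
  then have A [measurable]: "A \<in> sets circle_borel" by (simp add: circle_uniform_def)
  have vec: "(\<lambda>\<phi>. vector [cos \<phi>, sin \<phi>] :: real^2) = (\<lambda>\<phi>. unit_pt (\<phi> / (2 * pi)))"
    by (simp add: unit_pt_def circle_dir_def fun_eq_iff)
  have meas [measurable]: "(\<lambda>\<phi>. unit_pt (\<phi> / (2 * pi))) \<in> borel \<rightarrow>\<^sub>M circle_borel"
    by measurable
  define B where "B = unit_pt -` A"
  have B [measurable]: "B \<in> sets borel"
    using measurable_sets[OF unit_pt_measurable A] by (simp add: B_def)
  have per: "s + of_int k \<in> B \<longleftrightarrow> s \<in> B" for s and k :: int
    by (simp add: B_def unit_pt_periodic)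
  have C [measurable]: "{\<phi>. unit_pt (\<phi> / (2 * pi)) \<in> A} \<in> sets borel"
    using measurable_sets[OF meas A] by (simp add: vimage_def)
  have "emeasure circle_uniform A
      = emeasure (uniform_measure lborel {0..<2 * pi}) {\<phi>. unit_pt (\<phi> / (2 * pi)) \<in> A}"
    unfolding circle_uniform_def vec by (subst emeasure_distr) (auto simp: vimage_def)
  also have "\<dots> = emeasure lborel ({0..<2 * pi} \<inter> {\<phi>. unit_pt (\<phi> / (2 * pi)) \<in> A}) / ennreal (2 * pi)"
    by (subst emeasure_uniform_measure) auto
  also have "emeasure lborel ({0..<2 * pi} \<inter> {\<phi>. unit_pt (\<phi> / (2 * pi)) \<in> A}) =
      (\<integral>\<^sup>+\<phi>. indicator ({0..<2 * pi} \<inter> {\<phi>. unit_pt (\<phi> / (2 * pi)) \<in> A}) \<phi> \<partial>lborel)"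
    by simp
  also have "\<dots> = ennreal \<bar>2 * pi\<bar> * (\<integral>\<^sup>+s. indicator ({0..<2 * pi} \<inter> {\<phi>. unit_pt (\<phi> / (2 * pi))
      \<in> A}) (0 + (2 * pi) * s) \<partial>lborel)"
    by (rule nn_integral_real_affine) auto
  also have "(\<integral>\<^sup>+s. indicator ({0..<2 * pi} \<inter> {\<phi>. unit_pt (\<phi> / (2 * pi))
      \<in> A}) (0 + (2 * pi) * s) \<partial>lborel)
      = (\<integral>\<^sup>+s. indicator (B \<inter> {0..<1}) s \<partial>lborel)"
  proof (rule nn_integral_cong)
    have "\<not> pi \<le> 0" by (simp add: not_le)
    then show "indicator ({0..<2 * pi} \<inter> {\<phi>. unit_pt (\<phi> / (2 * pi)) \<in> A}) (0 + (2 * pi) * s) =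
        (indicator (B \<inter> {0..<1}) s :: ennreal)" for s
      by (auto simp: indicator_def B_def zero_le_mult_iff)
  qed
  also have "\<dots> = emeasure lborel (B \<inter> {0..<1})" by simp
  also have "ennreal \<bar>2 * pi\<bar> * emeasure lborel (B \<inter> {0..<1}) / ennreal (2 * pi)
      = emeasure lborel (B \<inter> {0..<1})"
    by (simp add: ennreal_times_divide[symmetric] mult.commute[of "ennreal _"] ennreal_mult_divide_eq)
  also have "\<dots> = emeasure lborel (B \<inter> {b - 1<..b})" by (rule emeasure_period[symmetric, OF B per])
  also have "\<dots> = emeasure (unif b) B"
    by (subst emeasure_uniform_measure) (auto simp: divide_ennreal_def Int_commute)
  also have "\<dots> = emeasure (distr (unif b) circle_borel unit_pt) A"
    by (subst emeasure_distr) (auto simp: B_def)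
  finally show "emeasure circle_uniform A = emeasure (distr (unif b) circle_borel unit_pt) A" .
qed

lemma cos_near_iff:
  assumes g: "0 < g" "g \<le> 1/2"
  shows "cos (pi * g) \<le> cos (2 * pi * d) \<longleftrightarrow> (\<exists>k::int. \<bar>d - of_int k\<bar> \<le> g / 2)"
proof -
  have near: "cos (pi * g) \<le> cos (2 * pi * e) \<longleftrightarrow> \<bar>e\<bar> \<le> g / 2" if e: "\<bar>e\<bar> \<le> 1/2" for e
  proof -
    have "cos (2 * pi * e) = cos (2 * pi * \<bar>e\<bar>)"
      by (cases "0 \<le> e") auto
    moreover have "cos (pi * g) \<le> cos (2 * pi * \<bar>e\<bar>) \<longleftrightarrow> 2 * pi * \<bar>e\<bar> \<le> pi * g"
      using g e by (intro cos_mono_le_eq) auto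
    ultimately show ?thesis by (simp add: field_simps)
  qed
  have shift: "cos (2 * pi * d) = cos (2 * pi * (d - of_int k))" for k :: int
  proof -
    have "2 * pi * (d - of_int k) = 2 * pi * d - 2 * pi * of_int k" by (simp add: algebra_simps)
    then show ?thesis by (simp add: cos_diff cos_int_2pin sin_int_2pin)
  qed
  show ?thesis
  proof
    assume *: "cos (pi * g) \<le> cos (2 * pi * d)"
    have "\<bar>d - of_int (round d)\<bar> \<le> 1/2" using of_int_round_abs_le[of d] by linarith
    from near[OF this] * shift[of "round d"] show "\<exists>k::int. \<bar>d - of_int k\<bar> \<le> g / 2" by auto
  next
    assume "\<exists>k::int. \<bar>d - of_int k\<bar> \<le> g / 2"
    then obtain k :: int where k: "\<bar>d - of_int k\<bar> \<le> g / 2" by blast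
    then show "cos (pi * g) \<le> cos (2 * pi * d)" using near[of "d - of_int k"] g shift[of k] by auto
  qed
qed

lemma covers_unit_pt:
  assumes g: "0 < g" "g \<le> 1/2"
  shows "covers (unit_pt ` V) (sin (pi * g)) \<longleftrightarrow> (\<forall>s. \<exists>v\<in>V. \<exists>k::int. \<bar>s - v - of_int k\<bar> \<le> g / 2)"
proof -
  have "0 \<le> cos (pi * g)"
    using g by (intro cos_ge_zero) (auto simp: field_simps intro: order_trans[of _ 0])
  then have c: "sqrt (1 - (sin (pi * g))\<^sup>2) = cos (pi * g)"
    by (simp add: cos_squared_eq[symmetric])
  have inner: "circle_dir \<phi> \<bullet> unit_pt v = cos (2 * pi * (\<phi> / (2 * pi) - v))" for \<phi> v
    by (simp add: circle_dir_def unit_pt_def inner_vec_def sum_2 cos_diff right_diff_distrib)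
  have "covers (unit_pt ` V) (sin (pi * g)) \<longleftrightarrow>
      (\<forall>\<phi>. \<exists>v\<in>V. \<exists>k::int. \<bar>\<phi> / (2 * pi) - v - of_int k\<bar> \<le> g / 2)"
    unfolding covers_def c by (simp add: inner cos_near_iff[OF g])
  also have "\<dots> \<longleftrightarrow> (\<forall>s. \<exists>v\<in>V. \<exists>k::int. \<bar>s - v - of_int k\<bar> \<le> g / 2)"
  proof (intro iffI allI)
    fix s assume "\<forall>\<phi>. \<exists>v\<in>V. \<exists>k::int. \<bar>\<phi> / (2 * pi) - v - of_int k\<bar> \<le> g / 2"
    from spec[OF this, of "2 * pi * s"] show "\<exists>v\<in>V. \<exists>k::int. \<bar>s - v - of_int k\<bar> \<le> g / 2" by simp
  qed blast
  finally show ?thesis .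
qed

text \<open>
  A gap longer than \<open>g\<close> leaves its midpoint uncovered. Conversely each \<open>s\<close> lies, up to a period,
  between consecutive points that are at most \<open>g\<close> apart, one of which is within \<open>g / 2\<close>.
\<close>

lemma periodic_cover_iff_gaps:
  fixes V :: "real set"
  assumes V: "finite V" "x \<in> V" "V \<subseteq> {x..x + 1}" and g: "0 < g"
  shows "(\<forall>s. \<exists>v\<in>V. \<exists>k::int. \<bar>s - v - of_int k\<bar> \<le> g / 2) \<longleftrightarrow>
    (\<forall>p\<in>V. x + 1 - g \<le> p \<or> (\<exists>q\<in>V. p < q \<and> q \<le> p + g))"
proof (intro iffI ballI allI)
  fix p assume cov: "\<forall>s. \<exists>v\<in>V. \<exists>k::int. \<bar>s - v - of_int k\<bar> \<le> g / 2" and p: "p \<in> V"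
  show "x + 1 - g \<le> p \<or> (\<exists>q\<in>V. p < q \<and> q \<le> p + g)"
  proof (rule ccontr)
    assume no: "\<not> (x + 1 - g \<le> p \<or> (\<exists>q\<in>V. p < q \<and> q \<le> p + g))"
    \<comment> \<open>The point after \<open>p\<close>, which is \<open>x + 1\<close>, a translate of \<open>x\<close>, if \<open>p\<close> is the last one.\<close>
    define S where "S = insert (x + 1) {v \<in> V. p < v}"
    define q where "q = Min S"
    have S: "finite S" "S \<noteq> {}" using V by (auto simp: S_def)
    have "q \<in> S" unfolding q_def using S by (rule Min_in)
    then have pq: "p + g < q" using no by (auto simp: S_def not_le)
    have qle: "q \<le> v" if "v \<in> S" for v unfolding q_def using S that by (intro Min_le)
    obtain v and k :: int where vk: "v \<in> V" "\<bar>(p + q) / 2 - v - of_int k\<bar> \<le> g / 2" using cov by blast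
    have w1: "p < v + of_int k" using abs_le_D1[OF vk(2)] pq by (simp add: field_simps)
    have w2: "v + of_int k < q" using abs_le_D2[OF vk(2)] pq by (simp add: field_simps)
    note w = w1 w2
    have "x \<le> p" "q \<le> x + 1" using V p qle[of "x + 1"] by (auto simp: S_def)
    moreover have "x \<le> v" "v \<le> x + 1" using V vk(1) by auto
    ultimately have "- 1 < (of_int k :: real)" "(of_int k :: real) < 1" using w by linarith+
    then have "k = 0" by linarith
    then show False using w qle[of v] vk(1) by (simp add: S_def)
  qed
next
  fix s assume gaps: "\<forall>p\<in>V. x + 1 - g \<le> p \<or> (\<exists>q\<in>V. p < q \<and> q \<le> p + g)"
  \<comment> \<open>Move \<open>s\<close> into the period that starts at \<open>x\<close>; \<open>p\<close> is the last point before it.\<close>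
  define k where "k = \<lfloor>s - x\<rfloor>"
  define r where "r = s - of_int k"
  have r: "x \<le> r" "r < x + 1" unfolding r_def k_def by linarith+
  define S where "S = {v \<in> V. v \<le> r}"
  define p where "p = Max S"
  have S: "finite S" "S \<noteq> {}" using V r by (auto simp: S_def)
  have "p \<in> S" unfolding p_def using S by (rule Max_in)
  then have p: "p \<in> V" "p \<le> r" by (auto simp: S_def)
  have ple: "v \<le> p" if "v \<in> V" "v \<le> r" for v unfolding p_def using S that
      by (intro Max_ge) (auto simp: S_def)
  consider "r - p \<le> g / 2" | "x + 1 - r \<le> g / 2" | q where "q \<in> V" "r < q" "q - r \<le> g / 2"
  proof -
    from gaps p(1) consider "x + 1 - g \<le> p" | q where "q \<in> V" "p < q" "q \<le> p + g" by blast
    then show thesis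
    proof cases
      case 1
      then show thesis using that(1,2) by linarith
    next
      case (2 q)
      then have "r < q" using ple[of q] by linarith
      then show thesis using that(1) that(3)[of q] 2 by linarith
    qed
  qed
  then show "\<exists>v\<in>V. \<exists>k::int. \<bar>s - v - of_int k\<bar> \<le> g / 2"
  proof cases
    case 1
    then have "\<bar>s - p - of_int k\<bar> \<le> g / 2" using p r_def by (intro abs_leI) linarith+
    then show ?thesis using p(1) by blast
  next
    case 2
    then have "\<bar>s - x - of_int (k + 1)\<bar> \<le> g / 2"
      using r r_def of_int_add[of k 1, where 'a = real] by (intro abs_leI) linarith+
    then show ?thesis using V(2) by blast
  next
    case (3 q)
    then have "\<bar>s - q - of_int k\<bar> \<le> g / 2" using r_def by (intro abs_leI) linarith+
    then show ?thesis using 3(1) by blast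
  qed
qed

lemma covers_iff_spaced:
  assumes g: "0 < g" "g \<le> 1/2" and J: "finite J"
    and u: "\<And>j. j \<in> J \<Longrightarrow> x < u j \<and> u j \<le> x + 1" "\<forall>i\<in>J. \<forall>j\<in>J. u i = u j \<longrightarrow> i = j"
  shows "covers (unit_pt ` insert x (u ` J)) (sin (pi * g)) \<longleftrightarrow> spaced g (x + 1) J x u"
proof -
  have "covers (unit_pt ` insert x (u ` J)) (sin (pi * g)) \<longleftrightarrow>
    (\<forall>p\<in>insert x (u ` J). x + 1 - g \<le> p \<or> (\<exists>q\<in>insert x (u ` J). p < q \<and> q \<le> p + g))"
    unfolding covers_unit_pt[OF g]
  proof (rule periodic_cover_iff_gaps)
    have "x \<le> u j \<and> u j \<le> x + 1" if "j \<in> J" for j using u(1)[OF that] by linarith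
    then show "insert x (u ` J) \<subseteq> {x..x + 1}" by auto
  qed (use J g in auto)
  also have "\<dots> \<longleftrightarrow> (\<forall>p\<in>insert x (u ` J). x + 1 - g \<le> p \<or> (\<exists>j\<in>J. p < u j \<and> u j \<le> p + g))"
  proof (intro ball_cong refl)
    fix p assume "p \<in> insert x (u ` J)"
    moreover have "\<forall>j\<in>J. x \<le> u j" using u(1) less_imp_le by blast
    ultimately have "\<not> p < x" by auto
    then have "(\<exists>q\<in>insert x (u ` J). p < q \<and> q \<le> p + g) \<longleftrightarrow> (\<exists>j\<in>J. p < u j \<and> u j \<le> p + g)"
      by simp
    then show "(x + 1 - g \<le> p \<or> (\<exists>q\<in>insert x (u ` J). p < q \<and> q \<le> p + g)) \<longleftrightarrow>
      (x + 1 - g \<le> p \<or> (\<exists>j\<in>J. p < u j \<and> u j \<le> p + g))" by (simp only:)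
  qed
  also have "\<dots> \<longleftrightarrow> spaced g (x + 1) J x u"
    using u by (simp add: spaced_def)
  finally show ?thesis .
qed

text \<open>
  For fixed \<open>P\<close> the covered directions form a closed set. Testing countably many of them makes
  coverage a measurable event.
\<close>

lemma covers_rational:
  assumes "finite P"
  shows "covers P t \<longleftrightarrow> (\<forall>q::rat. \<exists>p\<in>P. sqrt (1 - t\<^sup>2) \<le> circle_dir (of_rat q) \<bullet> p)"
proof
  assume *: "\<forall>q::rat. \<exists>p\<in>P. sqrt (1 - t\<^sup>2) \<le> circle_dir (of_rat q) \<bullet> p"
  define C where "C = (\<Union>p\<in>P. {s. sqrt (1 - t\<^sup>2) \<le> circle_dir s \<bullet> p})"
  have "closed C"
    unfolding C_def using assms
    by (intro closed_UN closed_Collect_le continuous_intros continuous_circle_dir ballI)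
  moreover have "\<rat> \<subseteq> C" using * by (auto simp: C_def elim!: Rats_cases)
  ultimately have "closure \<rat> \<subseteq> C" by (intro closure_minimal)
  then have "s \<in> C" for s by (auto simp: Rats_closure_real)
  then show "covers P t" by (simp add: covers_def C_def)
qed (simp add: covers_def)

lemma circle_borel_imp_borel: "f \<in> M \<rightarrow>\<^sub>M circle_borel \<Longrightarrow> f \<in> M \<rightarrow>\<^sub>M borel"
  unfolding circle_borel_def by (simp add: measurable_restrict_space2_iff)

lemma covers_measurable:
  assumes Y: "\<And>i. i \<in> I \<Longrightarrow> Y i \<in> M \<rightarrow>\<^sub>M circle_borel" and I: "finite I"
      and [measurable]: "t \<in> borel_measurable M"
  shows "Measurable.pred M (\<lambda>\<omega>. covers ((\<lambda>i. Y i \<omega>) ` I) (t \<omega>))"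
proof -
  have [measurable]: "Y i \<in> borel_measurable M" if "i \<in> I" for i
    using Y[OF that] by (rule circle_borel_imp_borel)
  have "covers ((\<lambda>i. Y i \<omega>) ` I) (t \<omega>) \<longleftrightarrow>
      (\<forall>q::rat. \<exists>i\<in>I. sqrt (1 - (t \<omega>)\<^sup>2) \<le> circle_dir (of_rat q) \<bullet> Y i \<omega>)" for \<omega>
    using covers_rational[of "(\<lambda>i. Y i \<omega>) ` I"] I by simp
  then show ?thesis using I by (simp only:) measurable
qed

lemma AE_distinct:
  fixes J :: "'i set"
  assumes J: "finite J"
  shows "AE u in PiM J (\<lambda>_. unif b). \<forall>i\<in>J. \<forall>j\<in>J. u i = u j \<longrightarrow> i = j"
proof -
  interpret U: prob_space "unif b" by (rule prob_space_unif)
  interpret P: product_sigma_finite "\<lambda>_::'i. unif b" by unfold_locales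
  have [measurable_cong, simp]: "sets (unif b) = sets borel" by simp
  have "AE u in PiM J (\<lambda>_. unif b). u i \<noteq> u j" if ij: "i \<in> J" "j \<in> J" "i \<noteq> j" for i j
  proof (rule AE_I')
    define K where "K = J - {i}"
    have K: "finite K" "i \<notin> K" "J = insert i K" "j \<in> K" using ij J by (auto simp: K_def)
    let ?A = "{u \<in> space (PiM J (\<lambda>_. unif b)). u i = u j}"
    have [measurable]: "(\<lambda>u. u l) \<in> borel_measurable (PiM J (\<lambda>_. unif b))" if "l \<in> J" for l
      using measurable_component_singleton[OF that, of "\<lambda>_. unif b"]
          by (simp cong: measurable_cong_sets)
    have A [measurable]: "?A \<in> sets (PiM J (\<lambda>_. unif b))"
      using ij by measurable
    have "emeasure (PiM J (\<lambda>_. unif b)) ?A = (\<integral>\<^sup>+u. indicator ?A u \<partial>PiM (insert i K) (\<lambda>_. unif b))"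
      unfolding K(3)[symmetric] using A by simp
    also have "\<dots> = (\<integral>\<^sup>+u. (\<integral>\<^sup>+x. indicator ?A (u(i := x)) \<partial>unif b) \<partial>PiM K (\<lambda>_. unif b))"
      by (rule P.product_nn_integral_insert) (use K A in auto)
    also have "\<dots> = (\<integral>\<^sup>+u. 0 \<partial>PiM K (\<lambda>_. unif b))"
    proof (rule nn_integral_cong)
      fix u :: "'i \<Rightarrow> real"
      have "AE x in lborel. x \<noteq> u j" by (rule AE_lborel_singleton)
      then have "AE x in unif b. x \<noteq> u j" by (intro AE_uniform_measureI) auto
      then have "AE x in unif b. indicator ?A (u(i := x)) = (0::ennreal)"
        by eventually_elim (use ij in \<open>auto simp: indicator_def\<close>)
      then have "(\<integral>\<^sup>+x. indicator ?A (u(i := x)) \<partial>unif b) = (\<integral>\<^sup>+x. 0 \<partial>unif b)"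
        by (rule nn_integral_cong_AE)
      then show "(\<integral>\<^sup>+x. indicator ?A (u(i := x)) \<partial>unif b) = 0" by simp
    qed
    finally show "?A \<in> null_sets (PiM J (\<lambda>_. unif b))" using A by (auto simp: null_sets_def)
    show "{u \<in> space (PiM J (\<lambda>_. unif b)). \<not> u i \<noteq> u j} \<subseteq> ?A" by auto
  qed
  then have "AE u in PiM J (\<lambda>_. unif b). i \<noteq> j \<longrightarrow> u i \<noteq> u j" if "i \<in> J" "j \<in> J" for i j
    using that by (cases "i = j") auto
  then have "AE u in PiM J (\<lambda>_. unif b). \<forall>i\<in>J. \<forall>j\<in>J. i \<noteq> j \<longrightarrow> u i \<noteq> u j"
    using J by (intro AE_finite_allI) auto
  then show ?thesis by eventually_elim blast
qed

text \<open>
  Single out one of the points. Wherever it lies, the others are uniform in the interval of length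
  one that starts there, so \<open>spaced_probability\<close> gives the same value for all its positions. Almost
  surely the points are distinct, as \<open>spaced\<close> demands.
\<close>

lemma covering_probability:
  fixes I :: "'i set"
  assumes I: "finite I" "I \<noteq> {}" and g: "0 < g" "g \<le> 1/2"
  shows "measure (PiM I (\<lambda>_. circle_uniform))
      {Y \<in> space (PiM I (\<lambda>_. circle_uniform)). covers (Y ` I) (sin (pi * g))} = spacing_poly g (card I - 1) 1"
proof -
  let ?t = "sin (pi * g)"
  interpret C: prob_space circle_uniform by (rule prob_space_circle_uniform)
  interpret P: product_sigma_finite "\<lambda>_::'i. circle_uniform" by unfold_locales
  have setsC [measurable_cong, simp]: "sets circle_uniform = sets circle_borel"
      by (simp add: circle_uniform_def)
  have spC: "space circle_uniform = circle"
      by (simp add: circle_uniform_def circle_borel_def space_restrict_space)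
  have comp [measurable]: "(\<lambda>Y. Y i) \<in> PiM K (\<lambda>_. circle_uniform) \<rightarrow>\<^sub>M circle_borel" if "i \<in> K" for i
      and K :: "'i set"
    using measurable_component_singleton[OF that, of "\<lambda>_. circle_uniform"]
        by (simp cong: measurable_cong_sets)
  obtain i0 where i0: "i0 \<in> I" using I by blast
  define J where "J = I - {i0}"
  have J: "finite J" "i0 \<notin> J" "I = insert i0 J" "card J = card I - 1" using i0 I by (auto simp: J_def)
  define A where "A = {Y \<in> space (PiM I (\<lambda>_. circle_uniform)). covers (Y ` I) ?t}"
  have A [measurable]: "A \<in> sets (PiM I (\<lambda>_. circle_uniform))"
    unfolding A_def using I by (intro predE covers_measurable[where Y = "\<lambda>i Y. Y i"]) auto
    have B: "{Y \<in> space (PiM J (\<lambda>_. circle_uniform)). covers (insert (unit_pt x) (Y ` J)) ?t}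
        \<in> sets (PiM J (\<lambda>_. circle_uniform))" for x
    proof -
      have "Measurable.pred (PiM J (\<lambda>_. circle_uniform))
          (\<lambda>Y. covers ((\<lambda>i. case i of None \<Rightarrow> unit_pt x | Some j \<Rightarrow> Y j) ` insert None (Some ` J)) ?t)"
        using J(1) comp
        by (intro covers_measurable[where Y = "\<lambda>i Y. case i of None \<Rightarrow> unit_pt x | Some j \<Rightarrow> Y j"])
           (auto split: option.splits simp: circle_borel_def space_restrict_space unit_pt_def circle_dir_in)
      then show ?thesis by (simp add: image_image pred_def)
    qed
  have inner: "emeasure (PiM J (\<lambda>_. circle_uniform)) {Y
      \<in> space (PiM J (\<lambda>_. circle_uniform)). covers (insert (unit_pt x) (Y ` J)) ?t}
      = ennreal (spacing_poly g (card J) 1)" for x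
  proof -
    define U where "U = unif (x + 1)"
    have pU: "prob_space U" unfolding U_def by (rule prob_space_unif)
    have setsU [measurable_cong, simp]: "sets U = sets borel" by (simp add: U_def)
    interpret PU: prob_space "PiM J (\<lambda>_. U)" by (intro prob_space_PiM pU)
    have um: "unit_pt \<in> U \<rightarrow>\<^sub>M circle_uniform" by (simp cong: measurable_cong_sets)
    have du: "distr U circle_uniform unit_pt = circle_uniform"
      unfolding U_def by (subst (2) circle_uniform_unif[of "x + 1"]) (rule distr_cong, simp_all)
    have "PiM J (\<lambda>_. circle_uniform) = PiM J (\<lambda>_. distr U circle_uniform unit_pt)"
      by (simp only: du)
    also have "\<dots> = distr (PiM J (\<lambda>_. U)) (PiM J (\<lambda>_. circle_uniform)) (compose J unit_pt)"
      by (rule distr_PiM_finite_prob_space'[OF J(1) pU prob_space_circle_uniform um, symmetric])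
    finally have D: "PiM J (\<lambda>_. circle_uniform) =
        distr (PiM J (\<lambda>_. U)) (PiM J (\<lambda>_. circle_uniform)) (compose J unit_pt)" .
    have cm: "compose J unit_pt \<in> PiM J (\<lambda>_. U) \<rightarrow>\<^sub>M PiM J (\<lambda>_. circle_uniform)"
      unfolding compose_def
      by (rule measurable_restrict) (rule measurable_compose[OF _ um], rule measurable_component_singleton)
    let ?B = "{Y \<in> space (PiM J (\<lambda>_. circle_uniform)). covers (insert (unit_pt x) (Y ` J)) ?t}"
    have "emeasure (PiM J (\<lambda>_. circle_uniform)) ?B =
        emeasure (PiM J (\<lambda>_. U)) (compose J unit_pt -` ?B \<inter> space (PiM J (\<lambda>_. U)))"
      by (subst D, subst emeasure_distr[OF cm]) (use B in simp_all)
    also have "\<dots> = emeasure (PiM J (\<lambda>_. U)) {u \<in> space (PiM J (\<lambda>_. U)). spaced g (x + 1) J x u}"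
    proof (rule emeasure_eq_AE)
      have range: "AE u in PiM J (\<lambda>_. U). x < u j \<and> u j \<le> x + 1" if "j \<in> J" for j
      proof (rule AE_PiM_component)
        show "AE v in U. x < v \<and> v \<le> x + 1" unfolding U_def by (rule AE_uniform_measureI) auto
      qed (use that pU in auto)
      have "AE u in PiM J (\<lambda>_. U). \<forall>j\<in>J. x < u j \<and> u j \<le> x + 1"
        using J(1) range by (intro AE_finite_allI) auto
      with AE_distinct[OF J(1), of "x + 1", folded U_def]
      show "AE u in PiM J (\<lambda>_. U). u \<in> compose J unit_pt -` ?B \<inter> space (PiM J (\<lambda>_. U)) \<longleftrightarrow>
          u \<in> {u \<in> space (PiM J (\<lambda>_. U)). spaced g (x + 1) J x u}"
        using AE_space
      proof eventually_elim
        case (elim u)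
        have "compose J unit_pt u \<in> space (PiM J (\<lambda>_. circle_uniform))"
          using measurable_space[OF cm elim(3)] .
        moreover have "insert (unit_pt x) (compose J unit_pt u ` J) = unit_pt ` insert x (u ` J)"
          by (auto simp: compose_def image_image)
        ultimately show ?case
          using covers_iff_spaced[OF g J(1), of x u] elim by simp
      qed
    next
      show "compose J unit_pt -` ?B \<inter> space (PiM J (\<lambda>_. U)) \<in> sets (PiM J (\<lambda>_. U))"
        by (rule measurable_sets[OF cm B])
      have [measurable]: "(\<lambda>u. u j) \<in> borel_measurable (PiM J (\<lambda>_. U))" if "j \<in> J" for j
        using measurable_component_singleton[OF that, of "\<lambda>_. U"] by (simp cong: measurable_cong_sets)
      show "{u \<in> space (PiM J (\<lambda>_. U)). spaced g (x + 1) J x u} \<in> sets (PiM J (\<lambda>_. U))"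
        using J by (intro predE spaced_measurable) auto
    qed
    also have "\<dots> = ennreal (spacing_poly g (card J) 1)"
      using spaced_probability[OF J(1) g(1), of "x + 1" x, folded U_def]
          by (simp add: PU.emeasure_eq_measure)
    finally show ?thesis .
  qed
  have A' [measurable]: "A \<in> sets (PiM (insert i0 J) (\<lambda>_. circle_uniform))" using A J(3) by simp
  have "emeasure (PiM I (\<lambda>_. circle_uniform)) A
      = (\<integral>\<^sup>+Y. indicator A Y \<partial>PiM (insert i0 J) (\<lambda>_. circle_uniform))"
    unfolding J(3)[symmetric] using A by simp
  also have "\<dots> = (\<integral>\<^sup>+y. (\<integral>\<^sup>+Y. indicator A (Y(i0 := y)) \<partial>PiM J (\<lambda>_. circle_uniform)) \<partial>circle_uniform)"
    by (rule P.product_nn_integral_insert_rev) (use J A' in auto)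
  also have "\<dots> = (\<integral>\<^sup>+y. ennreal (spacing_poly g (card J) 1) \<partial>circle_uniform)"
  proof (rule nn_integral_cong)
    fix y assume "y \<in> space circle_uniform"
    then have "(y $ 1)\<^sup>2 + (y $ 2)\<^sup>2 = 1" by (simp add: spC circle_def)
    then obtain \<phi> where "y $ 1 = cos \<phi>" "y $ 2 = sin \<phi>" by (rule sincos_total_2pi)
    then have y: "y = unit_pt (\<phi> / (2 * pi))"
      by (simp add: unit_pt_def circle_dir_def vec_eq_iff forall_2)
    define x where "x = \<phi> / (2 * pi)"
    have "(\<integral>\<^sup>+Y. indicator A (Y(i0 := unit_pt x)) \<partial>PiM J (\<lambda>_. circle_uniform)) =
       (\<integral>\<^sup>+Y. indicator {Y \<in> space (PiM J (\<lambda>_. circle_uniform)). covers (insert (unit_pt x) (Y ` J)) ?t} Y \<partial>PiM J (\<lambda>_. circle_uniform))"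
    proof (rule nn_integral_cong)
      fix Y assume Y: "Y \<in> space (PiM J (\<lambda>_. circle_uniform))"
      have "Y(i0 := unit_pt x) \<in> space (PiM I (\<lambda>_. circle_uniform))"
        using Y circle_dir_in unfolding J(3)
            by (auto simp: space_PiM spC unit_pt_def PiE_def extensional_def)
      moreover have "(Y(i0 := unit_pt x)) ` I = insert (unit_pt x) (Y ` J)"
        using J(2) unfolding J(3) by auto
      ultimately show "indicator A (Y(i0 := unit_pt x)) =
          (indicator {Y \<in> space (PiM J (\<lambda>_. circle_uniform)). covers (insert (unit_pt x) (Y ` J)) ?t} Y :: ennreal)"
        using Y by (simp add: A_def indicator_def)
    qed
    also have "\<dots> = emeasure (PiM J (\<lambda>_. circle_uniform)) {Y
        \<in> space (PiM J (\<lambda>_. circle_uniform)). covers (insert (unit_pt x) (Y ` J)) ?t}"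
      by (rule nn_integral_indicator[OF B])
    finally show "(\<integral>\<^sup>+Y. indicator A (Y(i0 := y)) \<partial>PiM J (\<lambda>_. circle_uniform))
        = ennreal (spacing_poly g (card J) 1)"
      unfolding y x_def[symmetric] inner .
  qed
  also have "\<dots> = ennreal (spacing_poly g (card J) 1)"
    by (simp add: C.emeasure_space_1)
  finally have "emeasure (PiM I (\<lambda>_. circle_uniform)) A = ennreal (spacing_poly g (card I - 1) 1)"
    by (simp add: J(4))
  moreover have "0 \<le> spacing_poly g (card I - 1) 1"
  proof -
    have "spacing_poly g (card J) (1 - 0) = measure (PiM J (\<lambda>_. unif 1))
        {u \<in> space (PiM J (\<lambda>_. unif 1)). spaced g 1 J 0 u}"
      by (rule spaced_probability[symmetric, OF J(1) g(1)]) simp_all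
    then show ?thesis by (simp add: J(4))
  qed
  ultimately show ?thesis by (simp add: A_def measure_def)
qed

section \<open>The expected length of the bar\<close>

lemma plus_pow_cos_integral:
  assumes k: "1 \<le> k"
  shows "((\<lambda>g. plus_pow m (1 - real k * g) * (pi * cos (pi * g))) has_integral
     integral {0..min (1/2) (1 / real k)} (\<lambda>t. pi * cos (pi * t) * (1 - real k * t) ^ m)) {0..1/2}"
proof -
  let ?b = "min (1/2) (1 / real k)"
  have "((\<lambda>t. pi * cos (pi * t) * (1 - real k * t) ^ m) has_integral
      integral {0..?b} (\<lambda>t. pi * cos (pi * t) * (1 - real k * t) ^ m)) {0..?b}"
    by (intro integrable_integral integrable_continuous_real continuous_intros)
  then have "((\<lambda>g. plus_pow m (1 - real k * g) * (pi * cos (pi * g))) has_integral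
      integral {0..?b} (\<lambda>t. pi * cos (pi * t) * (1 - real k * t) ^ m)) {0..?b}"
    by (rule has_integral_spike_finite[rotated 2, where S = "{1 / real k}"])
       (use k in \<open>auto simp: plus_pow_def field_simps\<close>)
  then have "((\<lambda>g. if g
      \<in> {0..?b} then plus_pow m (1 - real k * g) * (pi * cos (pi * g)) else 0) has_integral
      integral {0..?b} (\<lambda>t. pi * cos (pi * t) * (1 - real k * t) ^ m)) {0..1/2}"
    by (subst has_integral_restrict) auto
  then show ?thesis
    by (rule has_integral_eq[rotated]) (use k in \<open>auto simp: plus_pow_def field_simps min_def split: if_splits\<close>)
qed

lemma cos_integral: "((\<lambda>g. pi * cos (pi * g)) has_integral 1) {0..1/2}"
proof -
  have "((\<lambda>g. pi * cos (pi * g)) has_integral (sin (pi * (1/2)) - sin (pi * 0))) {0..1/2}"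
    by (rule fundamental_theorem_of_calculus)
       (auto intro!: derivative_eq_intros simp: has_real_derivative_iff_has_vector_derivative[symmetric])
  then show ?thesis by simp
qed

definition gap_integral :: "nat \<Rightarrow> nat \<Rightarrow> real" where
  "gap_integral n k = integral {0..min (1/2) (1 / real k)} (\<lambda>t. pi * cos (pi * t) * (1 - real k * t) ^ (n - 1))"

text \<open>
  The summand \<open>k = 0\<close> contributes the leading \<open>1\<close>. In the summand \<open>k\<close> the truncated power cuts the
  range of integration at \<open>1 / k\<close>.
\<close>

lemma spacing_poly_cos_integral:
  assumes n: "1 \<le> n"
  shows "((\<lambda>g. spacing_poly g (n - 1) 1 * (pi * cos (pi * g))) has_integral
    1 - (\<Sum>k=1..n. (-1) ^ (k - 1) * real (n choose k) * gap_integral n k)) {0..1/2}"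
proof -
  let ?J = "\<lambda>k. if k = 0 then 1 else gap_integral n k"
  have "((\<lambda>g. plus_pow (n - 1) (1 - real k * g) * (pi * cos (pi * g))) has_integral ?J k) {0..1/2}"
      for k
    using plus_pow_cos_integral[of k "n - 1"] cos_integral
    by (cases "k = 0") (auto simp: plus_pow_def gap_integral_def)
  then have "((\<lambda>g. \<Sum>k\<le>n. ((-1) ^ k * real (n choose k)) * (plus_pow (n - 1) (1 - real k * g) * (pi * cos (pi * g))))
      has_integral (\<Sum>k\<le>n. ((-1) ^ k * real (n choose k)) * ?J k)) {0..1/2}"
    by (intro has_integral_sum has_integral_mult_right) auto
  moreover have "(\<Sum>k\<le>n. ((-1) ^ k * real (n choose k)) * (plus_pow (n - 1) (1 - real k * g) * (pi * cos (pi * g))))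
      = spacing_poly g (n - 1) 1 * (pi * cos (pi * g))" for g
    using n by (simp add: spacing_poly_def sum_distrib_right mult.assoc)
  moreover have "(\<Sum>k\<le>n. ((-1) ^ k * real (n choose k)) * ?J k) =
      1 - (\<Sum>k=1..n. (-1) ^ (k - 1) * real (n choose k) * gap_integral n k)"
  proof -
    have "{..n} = insert 0 {1..n}" using n by auto
    then have "(\<Sum>k\<le>n. ((-1) ^ k * real (n choose k)) * ?J k)
        = 1 + (\<Sum>k=1..n. ((-1) ^ k * real (n choose k)) * ?J k)"
      by simp
    also have "(\<Sum>k=1..n. ((-1) ^ k * real (n choose k)) * ?J k) =
        - (\<Sum>k=1..n. (-1) ^ (k - 1) * real (n choose k) * gap_integral n k)"
      unfolding sum_negf[symmetric]
    proof (rule sum.cong[OF refl])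
      fix k assume "k \<in> {1..n}"
      then obtain j where "k = Suc j" by (cases k) auto
      then show "((-1) ^ k * real (n choose k)) * ?J k
          = - ((-1) ^ (k - 1) * real (n choose k) * gap_integral n k)"
        by simp
    qed
    finally show ?thesis by simp
  qed
  ultimately show ?thesis by simp
qed

text \<open>
  The bar consists of the radii \<open>t < 1\<close> at which the arcs cover, so by the theorem of Tonelli its
  expected length is the integral over \<open>t\<close> of the probability of coverage. The substitution
  \<open>t = sin (\<pi> g)\<close> replaces the radius by the length \<open>g\<close> of the arcs as a fraction of the circle.
\<close>

theorem theorem5p5:
  fixes M :: "'w measure" and X :: "nat \<Rightarrow> 'w \<Rightarrow> real^2" and n :: nat
  assumes "prob_space M"
    and "n \<ge> 1"
    and "prob_space.indep_vars M (\<lambda>_. circle_borel) X {1..n}"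
    and "\<And>i. i \<in> {1..n} \<Longrightarrow> distr M circle_borel (X i) = circle_uniform"
  shows "integrable M (\<lambda>\<omega>. bar_length (beta1 TYPE('k::field) ((\<lambda>i. X i \<omega>) ` {1..n}))) \<and>
    prob_space.expectation M
        (\<lambda>\<omega>. bar_length (beta1 TYPE('k::field) ((\<lambda>i. X i \<omega>) ` {1..n}))) =
      1 - (\<Sum>\<^sub>\<infinity>k\<in>{1..}. (-1) ^ (k - 1) * real (n choose k) *
             integral {0..min (1/2) (1 / real k)}
               (\<lambda>t. pi * cos (pi * t) * (1 - real k * t) ^ (n - 1)))"
proof -
  interpret prob_space M by fact
  let ?I = "{1..n}"
  define len where "len \<omega> = bar_length (beta1 TYPE('k) ((\<lambda>i. X i \<omega>) ` ?I))" for \<omega>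
  define r where "r = 1 - (\<Sum>k=1..n. (-1) ^ (k - 1) * real (n choose k) * gap_integral n k)"
  have rv: "X i \<in> M \<rightarrow>\<^sub>M circle_borel" if "i \<in> ?I" for i
    using assms(3) that by (auto simp: indep_vars_def)
  have Xcircle: "X i \<omega> \<in> circle" if "i \<in> ?I" "\<omega> \<in> space M" for i \<omega>
    using measurable_space[OF rv[OF that(1)] that(2)]
        by (simp add: circle_borel_def space_restrict_space)
  define cov where "cov \<omega> t \<longleftrightarrow> 0 \<le> t \<and> t < 1 \<and> covers ((\<lambda>i. X i \<omega>) ` ?I) t" for \<omega> t
  have len_eq: "len \<omega> = measure lborel {t. cov \<omega> t}" if "\<omega> \<in> space M" for \<omega>
  proof -
    interpret circle_points "(\<lambda>i. X i \<omega>) ` ?I"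
      using Xcircle[OF _ that] \<open>n \<ge> 1\<close> by unfold_locales auto
    show ?thesis unfolding len_def cov_def by (rule bar_length_beta1)
  qed
  interpret PS: pair_sigma_finite M lborel ..
  have cov_meas [measurable]: "Measurable.pred (M \<Otimes>\<^sub>M lborel) (\<lambda>z. cov (fst z) (snd z))"
  proof -
    have [measurable]: "Measurable.pred (M \<Otimes>\<^sub>M lborel) (\<lambda>z. covers ((\<lambda>i. X i (fst z)) ` ?I) (snd z))"
      by (intro covers_measurable measurable_compose[OF measurable_fst rv]) auto
    show ?thesis unfolding cov_def by measurable
  qed
  have sec: "{t. cov \<omega> t} \<in> sets lborel" if "\<omega> \<in> space M" for \<omega>
  proof -
    have "Measurable.pred lborel (\<lambda>t. cov \<omega> t)"
      using measurable_compose[OF measurable_Pair1'[OF that] cov_meas] by simp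
    then show ?thesis by (simp add: pred_def)
  qed
  have em_len: "ennreal (len \<omega>) = (\<integral>\<^sup>+t. indicator {z. cov (fst z) (snd z)} (\<omega>, t) \<partial>lborel)"
    if "\<omega> \<in> space M" for \<omega>
  proof -
    have "emeasure lborel {t. cov \<omega> t} \<le> emeasure lborel {0..1::real}"
      by (rule emeasure_mono) (auto simp: cov_def)
    then have "emeasure lborel {t. cov \<omega> t} \<noteq> \<infinity>" by (auto simp: top_unique)
    then have "ennreal (len \<omega>) = emeasure lborel {t. cov \<omega> t}"
      using len_eq[OF that] by (simp add: emeasure_eq_ennreal_measure)
    also have "\<dots> = (\<integral>\<^sup>+t. indicator {t. cov \<omega> t} t \<partial>lborel)"
      using sec[OF that] by simp
    finally show ?thesis by (simp add: indicator_def)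
  qed
  have ind [measurable]: "(indicator {z. cov (fst z) (snd z)} :: _ \<Rightarrow> ennreal)
      \<in> borel_measurable (M \<Otimes>\<^sub>M lborel)"
    using cov_meas by (intro borel_measurable_indicator') (simp add: pred_def)
  have len_meas: "(\<lambda>\<omega>. ennreal (len \<omega>)) \<in> borel_measurable M"
  proof (rule measurable_cong[THEN iffD2])
    show "(\<lambda>\<omega>. \<integral>\<^sup>+t. indicator {z. cov (fst z) (snd z)} (\<omega>, t) \<partial>lborel) \<in> borel_measurable M"
      by (rule lborel.borel_measurable_nn_integral) (use ind in simp)
  qed (rule em_len)
  define p where "p t = emeasure M {\<omega> \<in> space M. cov \<omega> t}" for t
  have p_eq: "p t = (\<integral>\<^sup>+\<omega>. indicator {z. cov (fst z) (snd z)} (\<omega>, t) \<partial>M)" for t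
  proof -
    have "Measurable.pred M (\<lambda>\<omega>. cov \<omega> t)"
      using measurable_compose[OF measurable_Pair2' cov_meas, of t] by simp
    then have "{\<omega> \<in> space M. cov \<omega> t} \<in> sets M" by measurable
    then have "p t = (\<integral>\<^sup>+\<omega>. indicator {\<omega> \<in> space M. cov \<omega> t} \<omega> \<partial>M)" by (simp add: p_def)
    also have "\<dots> = (\<integral>\<^sup>+\<omega>. indicator {z. cov (fst z) (snd z)} (\<omega>, t) \<partial>M)"
      by (rule nn_integral_cong) (simp add: indicator_def)
    finally show ?thesis .
  qed
  have p_meas [measurable]: "p \<in> borel_measurable borel"
  proof -
    have "(\<lambda>z. indicator {z. cov (fst z) (snd z)} (snd z, fst z) :: ennreal)
        \<in> borel_measurable (lborel \<Otimes>\<^sub>M M)"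
      by (rule measurable_compose[OF _ ind]) simp
    then have "(\<lambda>t. \<integral>\<^sup>+\<omega>. indicator {z. cov (fst z) (snd z)} (\<omega>, t) \<partial>M) \<in> borel_measurable lborel"
      by (intro borel_measurable_nn_integral) (simp add: case_prod_unfold)
    then show ?thesis by (simp add: p_eq[abs_def])
  qed
  have p_val: "p (sin (pi * g)) = ennreal (spacing_poly g (n - 1) 1)" if g: "0 < g" "g < 1/2" for g
  proof -
    have "0 \<le> sin (pi * g)" using g by (intro sin_ge_zero) auto
    moreover have "sin (pi * g) < 1"
    proof -
      have "0 < pi * g" "pi * g < pi / 2" using g by simp_all
      moreover from this have "- (pi / 2) \<le> pi * g" by linarith
      ultimately have "sin (pi * g) < sin (pi / 2)" by (intro sin_monotone_2pi) simp_all
      then show ?thesis by simp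
    qed
    ultimately have cov_iff: "cov \<omega> (sin (pi * g)) \<longleftrightarrow> covers ((\<lambda>i. X i \<omega>) ` ?I) (sin (pi * g))" for \<omega>
      by (simp add: cov_def)
    let ?D = "PiM ?I (\<lambda>_. circle_uniform)"
    let ?A = "{Y \<in> space ?D. covers (Y ` ?I) (sin (pi * g))}"
    let ?X = "\<lambda>\<omega>. \<lambda>i\<in>?I. X i \<omega>"
    interpret D: prob_space ?D by (intro prob_space_PiM prob_space_circle_uniform)
    have setsD: "sets ?D = sets (PiM ?I (\<lambda>_. circle_borel))"
      by (intro sets_PiM_cong) (simp_all add: circle_uniform_def)
    have "distr M (PiM ?I (\<lambda>_. circle_borel)) ?X = PiM ?I (\<lambda>i. distr M circle_borel (X i))"
      by (rule iffD1[OF indep_vars_iff_distr_eq_PiM' assms(3)]) (use rv assms(2) in auto)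
    also have "\<dots> = ?D" using assms(4) by (intro PiM_cong) auto
    finally have D: "distr M (PiM ?I (\<lambda>_. circle_borel)) ?X = ?D" .
    have Xm: "?X \<in> M \<rightarrow>\<^sub>M PiM ?I (\<lambda>_. circle_borel)" using rv by (intro measurable_restrict)
    have "?A \<in> sets ?D"
    proof (intro predE covers_measurable)
      show "(\<lambda>Y. Y i) \<in> ?D \<rightarrow>\<^sub>M circle_borel" if "i \<in> ?I" for i
        using measurable_component_singleton[OF that, of "\<lambda>_. circle_uniform"]
        by (simp add: circle_uniform_def cong: measurable_cong_sets)
    qed auto
    then have A: "?A \<in> sets (PiM ?I (\<lambda>_. circle_borel))" by (simp only: setsD)
    have "emeasure ?D ?A = emeasure (distr M (PiM ?I (\<lambda>_. circle_borel)) ?X) ?A" by (simp only: D)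
    also have "\<dots> = emeasure M (?X -` ?A \<inter> space M)" by (rule emeasure_distr[OF Xm A])
    also have "?X -` ?A \<inter> space M = {\<omega> \<in> space M. cov \<omega> (sin (pi * g))}"
    proof (rule Set.set_eqI)
      fix \<omega>
      have im: "?X \<omega> ` ?I = (\<lambda>i. X i \<omega>) ` ?I" by (rule image_cong) simp_all
      have mem: "?X \<omega> \<in> space ?D" if "\<omega> \<in> space M"
        using measurable_space[OF Xm that] sets_eq_imp_space_eq[OF setsD] by simp
      show "\<omega> \<in> ?X -` ?A \<inter> space M \<longleftrightarrow> \<omega> \<in> {\<omega> \<in> space M. cov \<omega> (sin (pi * g))}"
        unfolding vimage_eq Int_iff mem_Collect_eq cov_iff im using mem by blast
    qed
    finally have "p (sin (pi * g)) = emeasure ?D ?A" by (simp add: p_def)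
    also have "\<dots> = ennreal (spacing_poly g (n - 1) 1)"
      unfolding D.emeasure_eq_measure using covering_probability[of ?I g] g assms(2) by simp
    finally show ?thesis .
  qed
  have cos_nonneg: "0 \<le> cos (pi * g)" if "g \<in> {0..1/2}" for g
    using that by (intro cos_ge_zero) (auto simp: field_simps intro: order_trans[of _ 0])
  have nonneg: "0 \<le> spacing_poly g (n - 1) 1" if g: "0 \<le> g" "g \<le> 1/2" for g
  proof (cases "g = 0")
    case True
    have "spacing_poly 0 (n - 1) 1 = (\<Sum>k\<le>n. (-1) ^ k * of_nat (n choose k))"
      using assms(2) by (simp add: spacing_poly_def plus_pow_def)
    also have "\<dots> = 0" using assms(2) by (intro choose_alternating_sum) simp
    finally show ?thesis using True by simp
  next
    case False
    then have "spacing_poly g (card ?I - 1) 1 = measure (PiM ?I (\<lambda>_. circle_uniform))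
        {Y \<in> space (PiM ?I (\<lambda>_. circle_uniform)). covers (Y ` ?I) (sin (pi * g))}"
      using g assms(2) by (intro covering_probability[symmetric]) auto
    then show ?thesis by simp
  qed
  have "(\<integral>\<^sup>+\<omega>. ennreal (len \<omega>) \<partial>M)
      = (\<integral>\<^sup>+\<omega>. (\<integral>\<^sup>+t. indicator {z. cov (fst z) (snd z)} (\<omega>, t) \<partial>lborel) \<partial>M)"
    by (intro nn_integral_cong em_len)
  also have "\<dots> = (\<integral>\<^sup>+t. (\<integral>\<^sup>+\<omega>. indicator {z. cov (fst z) (snd z)} (\<omega>, t) \<partial>M) \<partial>lborel)"
    using PS.Fubini'[of "\<lambda>\<omega> t. indicator {z. cov (fst z) (snd z)} (\<omega>, t)"] by simp
  also have "\<dots> = (\<integral>\<^sup>+t. p t * indicator {sin (pi * 0)..sin (pi * (1/2))} t \<partial>lborel)"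
  proof (rule nn_integral_cong)
    fix t
    have "p t = 0" if "t \<notin> {0..1}"
    proof -
      have "{\<omega> \<in> space M. cov \<omega> t} = {}" using that by (auto simp: cov_def)
      then show ?thesis by (simp only: p_def emeasure_empty)
    qed
    then have "p t = p t * indicator {0..1} t" by (cases "t \<in> {0..1}") auto
    then show "(\<integral>\<^sup>+\<omega>. indicator {z. cov (fst z) (snd z)} (\<omega>, t) \<partial>M)
        = p t * indicator {sin (pi * 0)..sin (pi * (1/2))} t"
      by (simp add: p_eq)
  qed
  also have "\<dots> = (\<integral>\<^sup>+g. p (sin (pi * g)) * ennreal (pi * cos (pi * g)) * indicator {0..1/2} g \<partial>lborel)"
  proof (rule nn_integral_substitution_aux)
    show "((\<lambda>g. sin (pi * g)) has_real_derivative pi * cos (pi * g)) (at g)" for g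
      by (auto intro!: derivative_eq_intros)
    show "continuous_on {0..1/2} (\<lambda>g. pi * cos (pi * g))" by (intro continuous_intros)
  qed (use p_meas cos_nonneg in auto)
  also have "\<dots> = (\<integral>\<^sup>+g. ennreal (spacing_poly g (n - 1) 1 * (pi * cos (pi * g))) * indicator {0..1/2} g \<partial>lborel)"
  proof (rule nn_integral_cong_AE)
    have "AE g in lborel. g \<noteq> 0 \<and> g \<noteq> (1/2::real)"
      using AE_lborel_singleton[of 0] AE_lborel_singleton[of "1/2::real"] by eventually_elim simp
    then show "AE g in lborel. p (sin (pi * g)) * ennreal (pi * cos (pi * g)) * indicator {0..1/2} g =
        ennreal (spacing_poly g (n - 1) 1 * (pi * cos (pi * g))) * indicator {0..1/2} g"
    proof eventually_elim
      case (elim g)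
      show ?case
      proof (cases "0 < g \<and> g < 1/2")
        case True
        then have "p (sin (pi * g)) * ennreal (pi * cos (pi * g)) =
            ennreal (spacing_poly g (n - 1) 1 * (pi * cos (pi * g)))"
          using nonneg[of g] p_val[of g] cos_nonneg[of g] ennreal_mult[of "spacing_poly g (n - 1) 1" "pi * cos (pi * g)"]
          by simp
        then show ?thesis by simp
      next
        case False
        with elim have "g \<notin> {0..1/2}" by auto
        then show ?thesis by simp
      qed
    qed
  qed
  also have "\<dots> = ennreal r"
    unfolding r_def
  proof (rule nn_integral_has_integral_lebesgue'[OF _ spacing_poly_cos_integral[OF assms(2)]])
    show "0 \<le> spacing_poly g (n - 1) 1 * (pi * cos (pi * g))" if "g \<in> {0..1/2}" for g
      using nonneg[of g] cos_nonneg[of g] that by (auto intro!: mult_nonneg_nonneg)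
  qed
  finally have int: "(\<integral>\<^sup>+\<omega>. ennreal (len \<omega>) \<partial>M) = ennreal r" .
  have r0: "0 \<le> r"
    unfolding r_def
  proof (rule has_integral_nonneg[OF spacing_poly_cos_integral[OF assms(2)]])
    show "0 \<le> spacing_poly g (n - 1) 1 * (pi * cos (pi * g))" if "g \<in> {0..1/2}" for g
      using nonneg[of g] cos_nonneg[of g] that by (auto intro!: mult_nonneg_nonneg)
  qed
  have len0: "0 \<le> len \<omega>" if "\<omega> \<in> space M" for \<omega>
    using len_eq[OF that] by simp
  have "(\<lambda>\<omega>. enn2real (ennreal (len \<omega>))) \<in> borel_measurable M"
    using len_meas by measurable
  then have "len \<in> borel_measurable M"
    by (rule measurable_cong[THEN iffD1, rotated]) (simp add: len0)
  then have "integrable M len \<and> expectation len = r"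
    using nn_integral_eq_integrable[of len M r] int r0 len0 by simp
  moreover have "(\<Sum>\<^sub>\<infinity>k\<in>{1..}. (-1) ^ (k - 1) * real (n choose k) * gap_integral n k) =
      (\<Sum>k=1..n. (-1) ^ (k - 1) * real (n choose k) * gap_integral n k)"
  proof -
    have "(\<Sum>\<^sub>\<infinity>k\<in>{1..}. (-1) ^ (k - 1) * real (n choose k) * gap_integral n k) =
        (\<Sum>\<^sub>\<infinity>k\<in>{1..n}. (-1) ^ (k - 1) * real (n choose k) * gap_integral n k)"
      by (rule infsum_cong_neutral) auto
    then show ?thesis by simp
  qed
  ultimately show ?thesis
    unfolding len_def[symmetric, abs_def] gap_integral_def[symmetric] r_def by simp
qed

end
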